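(* In $TTR$, let $A,B$ be arrow types with $Rep(A)=\forall\mathbf v(A_g\to A_d)$ and $Rep(B)=\forall\mathbf v'(B_g\to B_d)$. If $A\subseteq B$, then there is a sequence $\mathbf G$ of terms and/or formulas such that $B_g\subseteq A_g[\mathbf G/\mathbf v]$ and $A_d[\mathbf G/\mathbf v]\subseteq B_d$.
   Context: $TTR$ types: over a second-order language with first-order variables, function symbols, $n$-ary predicate variables and symbols, and a fixed system $\mathbf E$ of equations; atomic $\perp$ and $X(t_1,\dots,t_n)$; constructors $\to$, $\forall x$, $\forall X$, and $\mu Cx_1\dots x_nA\langle t_1,\dots,t_n\rangle$ for $C$ an $n$-ary predicate symbol occurring and positive in $A$ (usual positivity). Subtyping $\subseteq$ is the least relation closed under: $A\subseteq A$; from $A\subseteq A'$, $B\subseteq B'$ infer $A'\to B\subseteq A\to B'$; from $A[G/v]\subseteq B$ infer $\forall vA\subseteq B$ ($G$ a term or formula as appropriate); from $A\subseteq B$ infer $A\subseteq\forall vB$ if $v$ not free in $A$; from $A\subseteq B[v/y]$ infer $A\subseteq B[w/y]$ if $v=w$ is an instance of an equation of $\mathbf E$; transitivity; $D[\mu C\bar xD\langle\bar z\rangle/C(\bar z)][\bar t/\bar x]\subseteq\mu C\bar xD\langle\bar t\rangle$ and its converse; from $D[E/C(\bar x)]\subseteq E$ infer $\mu C\bar xD\langle\bar t\rangle\subseteq E[\bar t/\bar x]$. An arrow type is a type containing at least one $\to$. For an arrow type $A$, $Rep(A)$ is defined by induction: $Rep(E\to F)=E\to F$; $Rep(\forall vB)=\forall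 v\,Rep(B)$; $Rep(\mu Cx_1\dots x_nB\langle t_1,\dots,t_n\rangle)=Rep(B)[\mu Cx_1\dots x_nB\langle y_1,\dots,y_n\rangle/C(y_1,\dots,y_n)][t_1/x_1,\dots,t_n/x_n]$. $Rep(A)$ has the form $\forall\mathbf v(A_g\to A_d)$ for a (possibly empty) sequence of variables $\mathbf v$; $[\mathbf G/\mathbf v]$ denotes simultaneous substitution of terms (for first-order variables) and formulas (for predicate variables). *)

theory Defs
  imports Main
begin

datatype trm = TV nat | TF nat "trm list"

text \<open>Heads of atomic formulas: n-ary predicate variables PV X n and n-ary predicate
  symbols PS C n (the arity is part of the name).\<close>
datatype head = PV nat nat | PS nat nat

text \<open>Types.  Mu c xs D ts is  mu C x1..xn D <t1..tn>  with C = PS c (length xs).\<close>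
datatype ty =
    Bot
  | At head "trm list"
  | Imp ty ty
  | AllV nat ty
  | AllP nat nat ty
  | Mu nat "nat list" ty "trm list"

fun tsub :: "(nat \<Rightarrow> trm) \<Rightarrow> trm \<Rightarrow> trm" where
  "tsub \<theta> (TV x) = \<theta> x"
| "tsub \<theta> (TF f ts) = TF f (map (tsub \<theta>) ts)"

fun fvt :: "trm \<Rightarrow> nat set" where
  "fvt (TV x) = {x}"
| "fvt (TF f ts) = \<Union> (set (map fvt ts))"

fun fv :: "ty \<Rightarrow> nat set" where
  "fv Bot = {}"
| "fv (At h ts) = \<Union> (set (map fvt ts))"
| "fv (Imp A B) = fv A \<union> fv B"
| "fv (AllV x A) = fv A - {x}"
| "fv (AllP X n A) = fv A"
| "fv (Mu c xs D ts) = (fv D - set xs) \<union> \<Union> (set (map fvt ts))"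

fun fhd :: "ty \<Rightarrow> head set" where
  "fhd Bot = {}"
| "fhd (At h ts) = {h}"
| "fhd (Imp A B) = fhd A \<union> fhd B"
| "fhd (AllV x A) = fhd A"
| "fhd (AllP X n A) = fhd A - {PV X n}"
| "fhd (Mu c xs D ts) = fhd D - {PS c (length xs)}"

text \<open>An abstraction (ys, F) stands for the formula F with designated variables ys,
  substituted for an atom h(ts) as F[ts/ys].\<close>
type_synonym abstr = "nat list \<times> ty"

fun absfv :: "abstr option \<Rightarrow> nat set" where
  "absfv None = {}"
| "absfv (Some (ys, F)) = fv F - set ys"

fun absfh :: "abstr option \<Rightarrow> head set" where
  "absfh None = {}"
| "absfh (Some (ys, F)) = fhd F"

definition fresh :: "nat set \<Rightarrow> nat" where
  "fresh S = Suc (Max (insert 0 S))"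

definition fresh_list :: "nat set \<Rightarrow> nat \<Rightarrow> nat list" where
  "fresh_list S k = [fresh S ..< fresh S + k]"

definition updl :: "(nat \<Rightarrow> trm) \<Rightarrow> nat list \<Rightarrow> trm list \<Rightarrow> nat \<Rightarrow> trm" where
  "updl \<theta> xs us = (\<lambda>y. case map_of (zip xs us) y of Some u \<Rightarrow> u | None \<Rightarrow> \<theta> y)"

definition pvnames :: "head set \<Rightarrow> nat set" where
  "pvnames H = {x. \<exists>m. PV x m \<in> H}"

definition psnames :: "head set \<Rightarrow> nat set" where
  "psnames H = {x. \<exists>m. PS x m \<in> H}"

fun substT :: "(nat \<Rightarrow> trm) \<Rightarrow> ty \<Rightarrow> ty" where
  "substT \<theta> Bot = Bot"
| "substT \<theta> (At h ts) = At h (map (tsub \<theta>) ts)"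
| "substT \<theta> (Imp A B) = Imp (substT \<theta> A) (substT \<theta> B)"
| "substT \<theta> (AllV x A) =
     (let S = (\<Union>y\<in>fv A - {x}. fvt (\<theta> y));
          x' = (if x \<in> S then fresh (S \<union> fv A) else x)
      in AllV x' (substT (\<theta>(x := TV x')) A))"
| "substT \<theta> (AllP X n A) = AllP X n (substT \<theta> A)"
| "substT \<theta> (Mu c xs D ts) =
     (let S = (\<Union>y\<in>fv D - set xs. fvt (\<theta> y));
          xs' = (if set xs \<inter> S = {} then xs else fresh_list (S \<union> fv D) (length xs))
      in Mu c xs' (substT (updl \<theta> xs (map TV xs')) D) (map (tsub \<theta>) ts))"

fun subst :: "(nat \<Rightarrow> trm) \<Rightarrow> (head \<Rightarrow> abstr option) \<Rightarrow> ty \<Rightarrow> ty" where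
  "subst \<theta> \<rho> Bot = Bot"
| "subst \<theta> \<rho> (At h ts) =
     (case \<rho> h of None \<Rightarrow> At h (map (tsub \<theta>) ts)
      | Some (ys, F) \<Rightarrow> substT (updl TV ys (map (tsub \<theta>) ts)) F)"
| "subst \<theta> \<rho> (Imp A B) = Imp (subst \<theta> \<rho> A) (subst \<theta> \<rho> B)"
| "subst \<theta> \<rho> (AllV x A) =
     (let S = (\<Union>y\<in>fv A - {x}. fvt (\<theta> y)) \<union> (\<Union>h\<in>fhd A. absfv (\<rho> h));
          x' = (if x \<in> S then fresh (S \<union> fv A) else x)
      in AllV x' (subst (\<theta>(x := TV x')) \<rho> A))"
| "subst \<theta> \<rho> (AllP X n A) =
     (let R = (\<Union>h\<in>fhd A - {PV X n}. absfh (\<rho> h));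
          X' = (if PV X n \<in> R then fresh (pvnames (R \<union> fhd A)) else X);
          \<rho>' = \<rho>(PV X n := (if X' = X then None
                             else Some ([0..<n], At (PV X' n) (map TV [0..<n]))))
      in AllP X' n (subst \<theta> \<rho>' A))"
| "subst \<theta> \<rho> (Mu c xs D ts) =
     (let n = length xs;
          S = (\<Union>y\<in>fv D - set xs. fvt (\<theta> y)) \<union> (\<Union>h\<in>fhd D - {PS c n}. absfv (\<rho> h));
          xs' = (if set xs \<inter> S = {} then xs else fresh_list (S \<union> fv D) n);
          R = (\<Union>h\<in>fhd D - {PS c n}. absfh (\<rho> h));
          c' = (if PS c n \<in> R then fresh (psnames (R \<union> fhd D)) else c);
          \<rho>' = \<rho>(PS c n := (if c' = c then None
                             else Some ([0..<n], At (PS c' n) (map TV [0..<n]))))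
      in Mu c' xs' (subst (updl \<theta> xs (map TV xs')) \<rho>' D) (map (tsub \<theta>) ts))"

fun nonneg :: "head \<Rightarrow> ty \<Rightarrow> bool" and nonpos :: "head \<Rightarrow> ty \<Rightarrow> bool" where
  "nonneg h Bot = True"
| "nonneg h (At h' ts) = True"
| "nonneg h (Imp A B) = (nonpos h A \<and> nonneg h B)"
| "nonneg h (AllV x A) = nonneg h A"
| "nonneg h (AllP X n A) = (h = PV X n \<or> nonneg h A)"
| "nonneg h (Mu c xs D ts) = (h = PS c (length xs) \<or> nonneg h D)"
| "nonpos h Bot = True"
| "nonpos h (At h' ts) = (h' \<noteq> h)"
| "nonpos h (Imp A B) = (nonneg h A \<and> nonpos h B)"
| "nonpos h (AllV x A) = nonpos h A"
| "nonpos h (AllP X n A) = (h = PV X n \<or> nonpos h A)"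
| "nonpos h (Mu c xs D ts) = (h = PS c (length xs) \<or> nonpos h D)"

fun arity :: "head \<Rightarrow> nat" where
  "arity (PV X n) = n"
| "arity (PS c n) = n"

fun wf_ty :: "ty \<Rightarrow> bool" where
  "wf_ty Bot = True"
| "wf_ty (At h ts) = (length ts = arity h)"
| "wf_ty (Imp A B) = (wf_ty A \<and> wf_ty B)"
| "wf_ty (AllV x A) = wf_ty A"
| "wf_ty (AllP X n A) = wf_ty A"
| "wf_ty (Mu c xs D ts) =
     (wf_ty D \<and> distinct xs \<and> length ts = length xs
      \<and> PS c (length xs) \<in> fhd D \<and> nonneg (PS c (length xs)) D)"

definition eq_inst :: "(trm \<times> trm) set \<Rightarrow> trm \<Rightarrow> trm \<Rightarrow> bool" where
  "eq_inst E v w = (\<exists>(l, r)\<in>E. \<exists>\<sigma>. (v = tsub \<sigma> l \<and> w = tsub \<sigma> r) \<or> (v = tsub \<sigma> r \<and> w = tsub \<sigma> l))"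

definition unfold_mu :: "nat \<Rightarrow> nat list \<Rightarrow> ty \<Rightarrow> trm list \<Rightarrow> ty" where
  "unfold_mu c xs D ts =
     substT (updl TV xs ts) (subst TV ((\<lambda>_. None)(PS c (length xs) := Some (xs, Mu c xs D (map TV xs)))) D)"

inductive subty :: "(trm \<times> trm) set \<Rightarrow> ty \<Rightarrow> ty \<Rightarrow> bool" for E where
  refl: "wf_ty A \<Longrightarrow> subty E A A"
| arr: "subty E A A' \<Longrightarrow> subty E B B' \<Longrightarrow> subty E (Imp A' B) (Imp A B')"
| allV_l: "subty E (substT (TV(x := t)) A) B \<Longrightarrow> wf_ty (AllV x A) \<Longrightarrow> subty E (AllV x A) B"
| allP_l: "subty E (subst TV ((\<lambda>_. None)(PV X n := Some (ys, F))) A) B \<Longrightarrow>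
           length ys = n \<Longrightarrow> distinct ys \<Longrightarrow> wf_ty F \<Longrightarrow> wf_ty (AllP X n A) \<Longrightarrow>
           subty E (AllP X n A) B"
| allV_r: "subty E A B \<Longrightarrow> x \<notin> fv A \<Longrightarrow> subty E A (AllV x B)"
| allP_r: "subty E A B \<Longrightarrow> PV X n \<notin> fhd A \<Longrightarrow> subty E A (AllP X n B)"
| eq: "subty E A (substT (TV(y := v)) B) \<Longrightarrow> eq_inst E v w \<Longrightarrow>
       subty E A (substT (TV(y := w)) B)"
| trans: "subty E A B \<Longrightarrow> subty E B C \<Longrightarrow> subty E A C"
| fold: "wf_ty (Mu c xs D ts) \<Longrightarrow> subty E (unfold_mu c xs D ts) (Mu c xs D ts)"
| unfold: "wf_ty (Mu c xs D ts) \<Longrightarrow> subty E (Mu c xs D ts) (unfold_mu c xs D ts)"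
| ind: "wf_ty (Mu c xs D ts) \<Longrightarrow> wf_ty F \<Longrightarrow>
        subty E (subst TV ((\<lambda>_. None)(PS c (length xs) := Some (xs, F))) D) F \<Longrightarrow>
        subty E (Mu c xs D ts) (substT (updl TV xs ts) F)"

fun is_arrow :: "ty \<Rightarrow> bool" where
  "is_arrow Bot = False"
| "is_arrow (At h ts) = False"
| "is_arrow (Imp A B) = True"
| "is_arrow (AllV x A) = is_arrow A"
| "is_arrow (AllP X n A) = is_arrow A"
| "is_arrow (Mu c xs D ts) = is_arrow D"

text \<open>Rep (only meaningful for arrow types; identity on atoms).\<close>
fun rep_ty :: "ty \<Rightarrow> ty" where
  "rep_ty Bot = Bot"
| "rep_ty (At h ts) = At h ts"
| "rep_ty (Imp E F) = Imp E F"
| "rep_ty (AllV x B) = AllV x (rep_ty B)"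
| "rep_ty (AllP X n B) = AllP X n (rep_ty B)"
| "rep_ty (Mu c xs B ts) =
     substT (updl TV xs ts)
       (subst TV ((\<lambda>_. None)(PS c (length xs) := Some (xs, Mu c xs B (map TV xs)))) (rep_ty B))"

datatype qbinder = BV nat | BP nat nat
datatype inst = IT trm | IF "nat list" ty

fun all_b :: "qbinder \<Rightarrow> ty \<Rightarrow> ty" where
  "all_b (BV x) A = AllV x A"
| "all_b (BP X n) A = AllP X n A"

definition foralls :: "qbinder list \<Rightarrow> ty \<Rightarrow> ty" where
  "foralls vs A = foldr all_b vs A"

fun fits :: "qbinder \<Rightarrow> inst \<Rightarrow> bool" where
  "fits (BV x) (IT t) = True"
| "fits (BP X n) (IF ys F) = (length ys = n \<and> distinct ys \<and> wf_ty F)"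
| "fits _ _ = False"

text \<open>Simultaneous substitution; for repeated qbinder names the innermost one wins.\<close>
definition sim_theta :: "qbinder list \<Rightarrow> inst list \<Rightarrow> nat \<Rightarrow> trm" where
  "sim_theta vs Gs y = (case map_of (rev (zip vs Gs)) (BV y) of Some (IT t) \<Rightarrow> t | _ \<Rightarrow> TV y)"

definition sim_rho :: "qbinder list \<Rightarrow> inst list \<Rightarrow> head \<Rightarrow> abstr option" where
  "sim_rho vs Gs h = (case h of
      PV X n \<Rightarrow> (case map_of (rev (zip vs Gs)) (BP X n) of Some (IF ys F) \<Rightarrow> Some (ys, F) | _ \<Rightarrow> None)
    | PS c n \<Rightarrow> None)"

definition sim_subst :: "qbinder list \<Rightarrow> inst list \<Rightarrow> ty \<Rightarrow> ty" where
  "sim_subst vs Gs A = subst (sim_theta vs Gs) (sim_rho vs Gs) A"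

end

theory Submission
  imports Defs
begin

text \<open>Named types are translated to de Bruijn types, where substitution composes strictly. Since mutual subtyping
contains alpha-equivalence, the relation \<open>dle E\<close> induced by \<open>subty E\<close> on de Bruijn types satisfies all the subtyping
rules, with the freshness side conditions replaced by premises for all instances, and it is closed under
substitution and monotone in positive heads.

Call \<open>g \<rightarrow> h\<close> an instance of a representative \<open>\<forall>v (A\<^sub>g \<rightarrow> A\<^sub>d)\<close> if it is obtained by instantiating the whole prefix. By
induction on the derivation of \<open>A \<subseteq> B\<close>, for every substitution applied to both sides, each instance \<open>g2 \<rightarrow> h2\<close> of
\<open>Rep(B)\<close> is bounded by an instance \<open>g1 \<rightarrow> h1\<close> of \<open>Rep(A)\<close>: \<open>g2 \<subseteq> g1\<close> and \<open>h1 \<subseteq> h2\<close>. Quantifying over all instances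
and all substitutions makes transitivity and both right rules for \<open>\<forall>\<close> immediate. In the induction rule for \<open>\<mu>\<close> the
hypothesis concerns \<open>Rep(D)[E/C]\<close>, and since \<open>C\<close> is positive in \<open>Rep(D)\<close>, monotonicity along \<open>\<mu>C D \<subseteq> E\<close> turns it into a
statement about \<open>Rep(D)[\<mu>C D/C]\<close>. The theorem is the case of the identity instance of \<open>Rep(B)\<close>.\<close>

subsection \<open>de Bruijn types and substitution\<close>

text \<open>Three obstacles shape the proof. First, \<open>subst\<close> renames bound names by a
  test on free names, so its composition laws hold only up to renaming, while \<open>subty\<close>
  has no rule for renaming. For quantifiers a left rule followed by a right rule changes the name,
  but for \<mu> only \<open>ind\<close> and \<open>fold\<close> are at hand, and these lead to
  larger types; this is where literals come in. Second, the types inside a derivation of well-formed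
  types need not be well-formed, because renaming can repair a \<mu> with repeated variables. Hence
  \<open>dle\<close> asks for well-formed representatives, and inductions over \<open>subty\<close>
  speak about values of named types under arbitrary valuations (\<open>sem\<close>) instead of the
  types themselves. Third, forming the representative commutes with substitution only on arrow
  types, since an atom may be replaced by an arrow type. So arrow types have to be shown closed
  upwards under subtyping before transitivity can be treated.\<close>

text \<open>The head of an atom is a de Bruijn index relative to the arity given by the length of the argument list.
\<open>DMu a ts\<close> binds, in \<open>a\<close>, the head \<open>0\<close> of arity \<open>length ts\<close> and the term variables below \<open>length ts\<close>.
\<open>DLit k ts\<close> is a constant standing for a named fixed point; it is needed only for alpha-equivalence.\<close>

datatype dty = DBot | DAt nat "trm list" | DImp dty dty | DAll dty | DAllP nat dty
  | DMu dty "trm list" | DLit nat "trm list"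

definition consl :: "trm list \<Rightarrow> (nat \<Rightarrow> trm) \<Rightarrow> nat \<Rightarrow> trm" where
  "consl us s i = (if i < length us then us ! i else s (i - length us))"

definition upT :: "nat \<Rightarrow> (nat \<Rightarrow> trm) \<Rightarrow> nat \<Rightarrow> trm" where
  "upT n s i = (if i < n then TV i else tsub (\<lambda>j. TV (j + n)) (s (i - n)))"

lemma tsub_cong: "(\<And>i. i \<in> fvt u \<Longrightarrow> s i = s' i) \<Longrightarrow> tsub s u = tsub s' u"
  by (induction u) auto

lemma tsub_TV [simp]: "tsub TV u = u"
  by (induction u) (auto simp: map_idI)

lemma map_tsub_TV [simp]: "map (tsub TV) us = us"
  by (simp add: map_idI)

lemma tsub_tsub: "tsub s (tsub s' u) = tsub (\<lambda>i. tsub s (s' i)) u"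
  by (induction u) auto

lemma map_tsub_tsub: "map (tsub s) (map (tsub s') us) = map (tsub (\<lambda>i. tsub s (s' i))) us"
  by (simp add: tsub_tsub)

lemma fvt_tsub: "fvt (tsub s u) = (\<Union>i\<in>fvt u. fvt (s i))"
  by (induction u) auto

lemma finite_fvt [simp]: "finite (fvt u)"
  by (induction u) auto

lemma upT_TV [simp]: "upT n TV = TV"
  by (auto simp: upT_def fun_eq_iff)

lemma tsub_upT_shift: "tsub (upT n s) (tsub (\<lambda>j. TV (j + n)) u) = tsub (\<lambda>j. TV (j + n)) (tsub s u)"
  by (auto simp: tsub_tsub upT_def intro!: tsub_cong)

lemma tsub_upT_upT: "tsub (upT n s) (upT n s' i) = upT n (\<lambda>j. tsub s (s' j)) i"
  by (cases "i < n")
    (simp_all add: tsub_upT_shift upT_def[of n s'] upT_def[of n "\<lambda>j. tsub s (s' j)"], simp add: upT_def)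

lemma tsub_consl_shift: "tsub (consl us s) (tsub (\<lambda>j. TV (j + length us)) u) = tsub s u"
  by (auto simp: tsub_tsub consl_def intro!: tsub_cong)

lemma tsub_consl_upT:
  "length us = n \<Longrightarrow> tsub (consl us s) (upT n s' i) = consl us (\<lambda>j. tsub s (s' j)) i"
  using tsub_consl_shift[of us s "s' (i - n)"] by (auto simp: upT_def consl_def)

lemma tsub_consl: "tsub s (consl us s' i) = consl (map (tsub s) us) (\<lambda>j. tsub s (s' j)) i"
  by (auto simp: consl_def)

primrec dsubT :: "(nat \<Rightarrow> trm) \<Rightarrow> dty \<Rightarrow> dty" where
  "dsubT s DBot = DBot"
| "dsubT s (DAt i ts) = DAt i (map (tsub s) ts)"
| "dsubT s (DImp a b) = DImp (dsubT s a) (dsubT s b)"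
| "dsubT s (DAll a) = DAll (dsubT (upT 1 s) a)"
| "dsubT s (DAllP n a) = DAllP n (dsubT s a)"
| "dsubT s (DMu a ts) = DMu (dsubT (upT (length ts) s) a) (map (tsub s) ts)"
| "dsubT s (DLit k ts) = DLit k (map (tsub s) ts)"

primrec dfv :: "dty \<Rightarrow> nat set" where
  "dfv DBot = {}"
| "dfv (DAt i ts) = \<Union> (set (map fvt ts))"
| "dfv (DImp a b) = dfv a \<union> dfv b"
| "dfv (DAll a) = {i. i + 1 \<in> dfv a}"
| "dfv (DAllP n a) = dfv a"
| "dfv (DMu a ts) = {i. i + length ts \<in> dfv a} \<union> \<Union> (set (map fvt ts))"
| "dfv (DLit k ts) = \<Union> (set (map fvt ts))"

lemma dsubT_TV [simp]: "dsubT TV d = d"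
  by (induction d) (auto simp: upT_TV[unfolded One_nat_def])

lemma dsubT_dsubT: "dsubT s (dsubT s' d) = dsubT (\<lambda>i. tsub s (s' i)) d"
  by (induction d arbitrary: s s') (auto simp: tsub_tsub tsub_upT_upT[abs_def])

lemma upT_cong: "(i < n \<or> s (i - n) = s' (i - n)) \<Longrightarrow> upT n s i = upT n s' i"
  by (auto simp: upT_def)

definition up_ren :: "nat \<Rightarrow> (nat \<Rightarrow> nat \<Rightarrow> nat) \<Rightarrow> nat \<Rightarrow> nat \<Rightarrow> nat" where
  "up_ren n f m i = (if m = n then (case i of 0 \<Rightarrow> 0 | Suc j \<Rightarrow> Suc (f n j)) else f m i)"

primrec hren :: "(nat \<Rightarrow> nat \<Rightarrow> nat) \<Rightarrow> dty \<Rightarrow> dty" where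
  "hren f DBot = DBot"
| "hren f (DAt i ts) = DAt (f (length ts) i) ts"
| "hren f (DImp a b) = DImp (hren f a) (hren f b)"
| "hren f (DAll a) = DAll (hren f a)"
| "hren f (DAllP n a) = DAllP n (hren (up_ren n f) a)"
| "hren f (DMu a ts) = DMu (hren (up_ren (length ts) f) a) ts"
| "hren f (DLit k ts) = DLit k ts"

text \<open>Heads are indexed separately for each arity, so a binder for a head of arity
  \<open>n\<close> moves only the indices of that arity.\<close>

definition shift_idx :: "nat \<Rightarrow> nat \<Rightarrow> nat \<Rightarrow> nat" where
  "shift_idx n m i = (if m = n then Suc i else i)"

abbreviation shift_head :: "nat \<Rightarrow> dty \<Rightarrow> dty" where
  "shift_head n \<equiv> hren (shift_idx n)"

text \<open>Moves the image of a head of arity \<open>m\<close> under \<open>k\<close> term binders: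
  its parameters, the indices below \<open>m\<close>, stay in place and only its free variables are
  shifted.\<close>

definition lift_abs :: "nat \<Rightarrow> nat \<Rightarrow> dty \<Rightarrow> dty" where
  "lift_abs k m = dsubT (upT m (\<lambda>i. TV (i + k)))"

text \<open>The eta-expanded head. As an image it leaves every atom unchanged, so
  \<open>head_id\<close> is the identity among substitutions for heads.\<close>

definition head_id :: "nat \<Rightarrow> nat \<Rightarrow> dty" where
  "head_id n i = DAt i (map TV [0..<n])"

definition upH :: "nat \<Rightarrow> (nat \<Rightarrow> nat \<Rightarrow> dty) \<Rightarrow> nat \<Rightarrow> nat \<Rightarrow> dty" where
  "upH n t m i = (if m = n then (case i of 0 \<Rightarrow> head_id n 0 | Suc j \<Rightarrow> shift_head n (t n j)) else shift_head n (t m i))"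

definition liftH :: "nat \<Rightarrow> (nat \<Rightarrow> nat \<Rightarrow> dty) \<Rightarrow> nat \<Rightarrow> nat \<Rightarrow> dty" where
  "liftH k t m i = lift_abs k m (t m i)"

text \<open>The image of a head of arity \<open>n\<close> is a type whose term variables below \<open>n\<close> are the parameters.\<close>

primrec dsubst :: "(nat \<Rightarrow> trm) \<Rightarrow> (nat \<Rightarrow> nat \<Rightarrow> dty) \<Rightarrow> dty \<Rightarrow> dty" where
  "dsubst s t DBot = DBot"
| "dsubst s t (DAt i ts) = dsubT (consl (map (tsub s) ts) TV) (t (length ts) i)"
| "dsubst s t (DImp a b) = DImp (dsubst s t a) (dsubst s t b)"
| "dsubst s t (DAll a) = DAll (dsubst (upT 1 s) (liftH 1 t) a)"
| "dsubst s t (DAllP n a) = DAllP n (dsubst s (upH n t) a)"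
| "dsubst s t (DMu a ts) =
     DMu (dsubst (upT (length ts) s) (upH (length ts) (liftH (length ts) t)) a) (map (tsub s) ts)"
| "dsubst s t (DLit k ts) = DLit k (map (tsub s) ts)"

lemma hren_dsubT: "hren f (dsubT s d) = dsubT s (hren f d)"
  by (induction d arbitrary: f s) auto

lemma up_ren_comp: "up_ren n f m (up_ren n g m i) = up_ren n (\<lambda>m i. f m (g m i)) m i"
  by (auto simp: up_ren_def split: nat.split)

lemma hren_hren: "hren f (hren g d) = hren (\<lambda>m i. f m (g m i)) d"
  by (induction d arbitrary: f g) (auto simp: up_ren_comp[abs_def])

lemma lift_abs_head_id: "lift_abs k n (head_id n i) = head_id n i"
  by (auto simp: lift_abs_def head_id_def upT_def)

lemma liftH_head_id [simp]: "liftH k head_id = head_id"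
  by (auto simp: liftH_def lift_abs_head_id fun_eq_iff)

lemma hren_head_id: "hren f (head_id n i) = head_id n (f n i)"
  by (auto simp: head_id_def)

lemma upH_head_id [simp]: "upH n head_id = head_id"
  by (auto simp: upH_def hren_head_id shift_idx_def fun_eq_iff split: nat.split)

lemma map_nth_consl: "length us = n \<Longrightarrow> map (\<lambda>i. consl us s i) [0..<n] = us"
  by (rule nth_equalityI) (auto simp: consl_def)

lemma dsubT_consl_head_id: "length us = n \<Longrightarrow> dsubT (consl us s) (head_id n i) = DAt i us"
  using map_nth_consl[of us n s] by (simp add: head_id_def comp_def)

lemma dsubst_head_id: "dsubst s head_id d = dsubT s d"
  by (induction d arbitrary: s) (simp_all add: dsubT_consl_head_id)

lemma dsubst_id [simp]: "dsubst TV head_id d = d"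
  by (simp add: dsubst_head_id)

lemma tsub_consl_upT': "length us = n \<Longrightarrow> (\<lambda>i. tsub (consl us TV) (upT n s i)) = consl us s"
  by (auto simp: tsub_consl_upT fun_eq_iff)

lemma tsub_consl': "(\<lambda>i. tsub s (consl us TV i)) = consl (map (tsub s) us) s"
  by (auto simp: tsub_consl fun_eq_iff)

lemma lift_abs_lift_abs_swap:
  "lift_abs k m (dsubT (upT m s) d) = dsubT (upT m (upT k s)) (lift_abs k m d)"
proof -
  have "(\<lambda>j. tsub (\<lambda>i. TV (i + k)) (s j)) = (\<lambda>j. upT k s (j + k))"
    by (auto simp: upT_def)
  then show ?thesis
  unfolding lift_abs_def dsubT_dsubT tsub_upT_upT by simp
qed

lemma liftH_dsubT: "liftH k (\<lambda>m i. dsubT (upT m s) (t m i)) = (\<lambda>m i. dsubT (upT m (upT k s)) (liftH k t m i))"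
  by (simp add: liftH_def lift_abs_lift_abs_swap fun_eq_iff)

lemma upT_params: "map (tsub (upT n s)) (map TV [0..<n]) = map TV [0..<n]"
  by (auto simp: upT_def)

lemma dsubT_upT_head_id: "dsubT (upT n s) (head_id n i) = head_id n i"
  by (auto simp: head_id_def upT_def)

lemma upH_dsubT: "upH n (\<lambda>m i. dsubT (upT m s) (t m i)) = (\<lambda>m i. dsubT (upT m s) (upH n t m i))"
  by (auto simp: upH_def hren_dsubT dsubT_upT_head_id fun_eq_iff split: nat.split)

lemma dsubT_dsubst:
  "dsubT s' (dsubst s t d) = dsubst (\<lambda>i. tsub s' (s i)) (\<lambda>m i. dsubT (upT m s') (t m i)) d"
proof (induction d arbitrary: s s' t)
  case (DAt i ts)
  have "(\<lambda>i. tsub s' (consl (map (tsub s) ts) TV i)) =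
    (\<lambda>i. tsub (consl (map (tsub (\<lambda>i. tsub s' (s i))) ts) TV) (upT (length ts) s' i))"
    by (simp add: tsub_consl' tsub_consl_upT' tsub_tsub comp_def)
  then show ?case by (simp add: dsubT_dsubT)
next
  case (DMu d ts)
  then show ?case
    by (simp add: liftH_dsubT upH_dsubT tsub_upT_upT tsub_tsub)
qed (simp_all add: liftH_dsubT upH_dsubT tsub_upT_upT tsub_tsub)

lemma dsubst_dsubT: "dsubst s t (dsubT s' d) = dsubst (\<lambda>i. tsub s (s' i)) t d"
  by (induction d arbitrary: s s' t) (simp_all add: tsub_tsub tsub_upT_upT comp_def)

lemma liftH_hren: "liftH k (\<lambda>m i. hren f (t m i)) = (\<lambda>m i. hren f (liftH k t m i))"
  by (simp add: liftH_def lift_abs_def hren_dsubT fun_eq_iff)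

lemma up_ren_shift_idx: "up_ren n f m (shift_idx n m i) = shift_idx n m (f m i)"
  by (auto simp: up_ren_def shift_idx_def)

lemma hren_up_ren_shift_head: "hren (up_ren n f) (shift_head n d) = shift_head n (hren f d)"
  by (simp add: hren_hren up_ren_shift_idx)

lemma upH_hren: "upH n (\<lambda>m i. hren f (t m i)) = (\<lambda>m i. hren (up_ren n f) (upH n t m i))"
  by (auto simp: upH_def hren_up_ren_shift_head hren_head_id fun_eq_iff up_ren_def split: nat.split)

lemma hren_dsubst: "hren f (dsubst s t d) = dsubst s (\<lambda>m i. hren f (t m i)) d"
  by (induction d arbitrary: f s t) (simp_all add: hren_dsubT liftH_hren upH_hren)

lemma upH_up_ren: "upH n t m (up_ren n f m i) = upH n (\<lambda>m i. t m (f m i)) m i"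
  by (auto simp: upH_def up_ren_def split: nat.split)

lemma dsubst_hren: "dsubst s t (hren f d) = dsubst s (\<lambda>m i. t m (f m i)) d"
  by (induction d arbitrary: f s t) (simp_all add: upH_up_ren[abs_def] liftH_def[abs_def])

text \<open>The head part of a composite substitution. The first image has its own \<open>m\<close>
  parameters, so the second substitution acts on it underneath these.\<close>

definition compH :: "(nat \<Rightarrow> trm) \<Rightarrow> (nat \<Rightarrow> nat \<Rightarrow> dty) \<Rightarrow> (nat \<Rightarrow> nat \<Rightarrow> dty) \<Rightarrow> nat \<Rightarrow> nat \<Rightarrow> dty" where
  "compH s2 t2 t1 m i = dsubst (upT m s2) (liftH m t2) (t1 m i)"

lemma liftH_liftH_swap: "(\<lambda>m i. dsubT (upT m (upT j (\<lambda>i. TV (i + k)))) (liftH j t m i)) = liftH j (liftH k t)"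
  by (simp add: liftH_def lift_abs_lift_abs_swap[symmetric] fun_eq_iff) (simp add: lift_abs_def)

lemma upT_k_shift: "tsub (upT m (upT k s)) (upT m (\<lambda>i. TV (i + k)) i) = tsub (upT m (\<lambda>i. TV (i + k))) (upT m s i)"
proof -
  have "upT k s (j + k) = tsub (\<lambda>i. TV (i + k)) (s j)" for j by (auto simp: upT_def)
  then show ?thesis by (simp add: tsub_upT_upT)
qed

lemma compH_liftH: "compH (upT k s2) (liftH k t2) (liftH k t1) = liftH k (compH s2 t2 t1)"
proof -
  have "(\<lambda>n i. dsubT (upT n (upT m (\<lambda>i. TV (i + k)))) (liftH m t2 n i)) = liftH m (liftH k t2)" for m
    by (rule liftH_liftH_swap)
  then show ?thesis
    by (simp add: compH_def fun_eq_iff liftH_def[of k t1] liftH_def[of k "compH _ _ _"] lift_abs_def 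
      dsubT_dsubst dsubst_dsubT upT_k_shift)
qed

lemma upH_shift_idx: "upH n t m (shift_idx n m i) = shift_head n (t m i)"
  by (auto simp: upH_def shift_idx_def)

lemma compH_upH: "compH s2 (upH n t2) (upH n t1) = upH n (compH s2 t2 t1)"
proof -
  have z: "dsubst (upT n s2) t (head_id n i) = dsubT (consl (map TV [0..<n]) TV) (t n i)" for t i
    by (simp only: head_id_def dsubst.simps upT_params) simp
  have "dsubT (consl (map TV [0..<n]) TV) (head_id n 0) = head_id n 0" by (simp add: dsubT_consl_head_id) (simp add: head_id_def)
  then have 1: "dsubst (upT n s2) (liftH n (upH n t2)) (head_id n 0) = head_id n 0"
    by (simp add: z liftH_def upH_def lift_abs_head_id)
  have 2: "dsubst (upT m s2) (liftH m (upH n t2)) (shift_head n d) = shift_head n (dsubst (upT m s2) (liftH m t2) d)" for m d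
    by (simp add: dsubst_hren hren_dsubst liftH_def upH_shift_idx lift_abs_def hren_dsubT)
  show ?thesis
    by (auto simp: fun_eq_iff compH_def upH_def[of n t1] upH_def[of n "compH _ _ _"] 1 2 split: nat.split)
qed

text \<open>At an atom the second image has been lifted past the parameters of the first, and
  instantiating these parameters undoes the lift. At binders, lifting commutes with composition
  (\<open>compH_liftH\<close>, \<open>compH_upH\<close>).\<close>

lemma dsubst_dsubst: "dsubst s2 t2 (dsubst s1 t1 d) = dsubst (\<lambda>i. tsub s2 (s1 i)) (compH s2 t2 t1) d"
proof (induction d arbitrary: s1 s2 t1 t2)
  case (DAt i ts)
  have "(\<lambda>m i. dsubT (upT m (consl (map (tsub (\<lambda>i. tsub s2 (s1 i))) ts) TV)) (liftH (length ts) t2 m i)) = t2"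
    by (auto simp: liftH_def lift_abs_def dsubT_dsubT tsub_upT_upT fun_eq_iff consl_def)
  then show ?case
    by (simp add: compH_def dsubT_dsubst dsubst_dsubT tsub_consl_upT' tsub_consl' comp_def tsub_tsub)
qed (simp_all add: compH_liftH compH_upH tsub_upT_upT tsub_tsub)

subsection \<open>From named types to de Bruijn types\<close>

text \<open>Variables take the even and symbols the odd indices, so for each arity the heads are in
  bijection with the natural numbers. Free names thus have fixed indices and no list of free names
  has to be carried along.\<close>

fun head_idx :: "head \<Rightarrow> nat" where
  "head_idx (PV X n) = 2 * X"
| "head_idx (PS c n) = 2 * c + 1"

definition idx_head :: "nat \<Rightarrow> nat \<Rightarrow> head" where
  "idx_head n i = (if even i then PV (i div 2) n else PS (i div 2) n)"

lemma idx_head_head_idx [simp]: "idx_head (arity h) (head_idx h) = h"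
  by (cases h) (auto simp: idx_head_def)

lemma head_idx_idx_head [simp]: "head_idx (idx_head n i) = i" "arity (idx_head n i) = n"
  by (auto simp: idx_head_def)

text \<open>The first occurrence counts because \<open>updl\<close> also resolves repeated names in
  favour of the first one; lists of bound names need not be distinct at this stage.\<close>

primrec pos :: "nat list \<Rightarrow> nat \<Rightarrow> nat" where
  "pos [] y = 0"
| "pos (x # xs) y = (if y = x then 0 else Suc (pos xs y))"

lemma pos_less: "y \<in> set xs \<Longrightarrow> pos xs y < length xs"
  by (induction xs) auto

lemma nth_pos: "y \<in> set xs \<Longrightarrow> xs ! pos xs y = y"
  by (induction xs) auto

lemma pos_nth: "distinct xs \<Longrightarrow> i < length xs \<Longrightarrow> pos xs (xs ! i) = i"
  by (induction xs arbitrary: i) (auto simp: less_Suc_eq_0_disj)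

lemma map_of_zip_pos:
  "length us = length xs \<Longrightarrow>
    map_of (zip xs us) y = (if y \<in> set xs then Some (us ! pos xs y) else None)"
  by (induction us xs rule: list_induct2) auto

definition up_env :: "nat list \<Rightarrow> (nat \<Rightarrow> nat) \<Rightarrow> nat \<Rightarrow> nat" where
  "up_env xs e y = (if y \<in> set xs then pos xs y else e y + length xs)"

lemma updl_pos: "length us = length xs \<Longrightarrow>
    updl \<theta> xs us y = (if y \<in> set xs then us ! pos xs y else \<theta> y)"
  by (simp add: updl_def map_of_zip_pos)

lemma consl_up_env: "length us = length xs \<Longrightarrow>
    consl us s (up_env xs e y) = (if y \<in> set xs then us ! pos xs y else s (e y))"
  by (auto simp: consl_def up_env_def pos_less)

definition up_head :: "head \<Rightarrow> (head \<Rightarrow> nat) \<Rightarrow> head \<Rightarrow> nat" where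
  "up_head h r g = (if g = h then 0 else shift_idx (arity h) (arity g) (r g))"

primrec dfhd :: "dty \<Rightarrow> (nat \<times> nat) set" where
  "dfhd DBot = {}"
| "dfhd (DAt i ts) = {(length ts, i)}"
| "dfhd (DImp a b) = dfhd a \<union> dfhd b"
| "dfhd (DAll a) = dfhd a"
| "dfhd (DAllP n a) = {(m, i). (m, shift_idx n m i) \<in> dfhd a}"
| "dfhd (DMu a ts) = {(m, i). (m, shift_idx (length ts) m i) \<in> dfhd a}"
| "dfhd (DLit k ts) = {}"

primrec lits :: "dty \<Rightarrow> nat set" where
  "lits DBot = {}"
| "lits (DAt i ts) = {}"
| "lits (DImp a b) = lits a \<union> lits b"
| "lits (DAll a) = lits a"
| "lits (DAllP n a) = lits a"
| "lits (DMu a ts) = lits a"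
| "lits (DLit k ts) = {k}"

section \<open>Matching named types with de Bruijn types that contain literals\<close>

type_synonym lit = "nat \<times> nat list \<times> ty"

fun lit_fv :: "lit \<Rightarrow> nat set" where
  "lit_fv (c, xs, D) = fv D - set xs"

fun lit_fhd :: "lit \<Rightarrow> head set" where
  "lit_fhd (c, xs, D) = fhd D - {PS c (length xs)}"

text \<open>\<open>matches K e r A d\<close>: up to alpha-equivalence \<open>A\<close> is \<open>d\<close>, except that \<open>DLit k\<close> has to be the fixed point \<open>K k\<close>
literally. The side conditions at binders keep the free names of these fixed points from being captured, so that
substitutions acting trivially on them leave them syntactically unchanged.\<close>

primrec matches :: "(nat \<Rightarrow> lit) \<Rightarrow> (nat \<Rightarrow> nat) \<Rightarrow> (head \<Rightarrow> nat) \<Rightarrow> ty \<Rightarrow> dty \<Rightarrow> bool" where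
  "matches K e r A DBot = (A = Bot)"
| "matches K e r A (DAt i ts) = (\<exists>h us. A = At h us \<and> r h = i \<and> length us = arity h \<and>
     ts = map (tsub (\<lambda>y. TV (e y))) us)"
| "matches K e r A (DImp a b) = (\<exists>B C. A = Imp B C \<and> matches K e r B a \<and> matches K e r C b)"
| "matches K e r A (DAll a) = (\<exists>x B. A = AllV x B \<and> matches K (up_env [x] e) r B a \<and>
     (\<forall>k\<in>lits a. x \<notin> lit_fv (K k)))"
| "matches K e r A (DAllP n a) = (\<exists>X B. A = AllP X n B \<and> matches K e (up_head (PV X n) r) B a \<and>
     (\<forall>k\<in>lits a. PV X n \<notin> lit_fhd (K k)))"
| "matches K e r A (DMu a ts) = (\<exists>c xs D us. A = Mu c xs D us \<and> length us = length xs \<and>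
     ts = map (tsub (\<lambda>y. TV (e y))) us \<and> matches K (up_env xs e) (up_head (PS c (length xs)) r) D a \<and>
     (\<forall>k\<in>lits a. set xs \<inter> lit_fv (K k) = {} \<and> PS c (length xs) \<notin> lit_fhd (K k)))"
| "matches K e r A (DLit k ts) = (\<exists>c xs D us. A = Mu c xs D us \<and> K k = (c, xs, D) \<and>
     length us = length xs \<and> ts = map (tsub (\<lambda>y. TV (e y))) us)"

lemma finite_fv [simp]: "finite (fv A)"
  by (induction A) auto

lemma finite_fhd [simp]: "finite (fhd A)"
  by (induction A) auto

lemma finite_absfv [simp]: "finite (absfv p)"
  by (cases p) auto

lemma finite_absfh [simp]: "finite (absfh p)"
  by (cases p) auto

lemma finite_pvnames: "finite H \<Longrightarrow> finite (pvnames H)"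
  by (rule finite_subset[where B = "(\<lambda>h. case h of PV x m \<Rightarrow> x | PS x m \<Rightarrow> x) ` H"])
    (force simp: pvnames_def image_iff)+

lemma finite_psnames: "finite H \<Longrightarrow> finite (psnames H)"
  by (rule finite_subset[where B = "(\<lambda>h. case h of PV x m \<Rightarrow> x | PS x m \<Rightarrow> x) ` H"])
    (force simp: psnames_def image_iff)+

lemma fresh_greater: "finite S \<Longrightarrow> x \<in> S \<Longrightarrow> x < fresh S"
  by (simp add: fresh_def less_Suc_eq_le)

lemma fresh_notin: "finite S \<Longrightarrow> fresh S \<notin> S"
  using fresh_greater by blast

lemma fresh_list_props: "finite S \<Longrightarrow> set (fresh_list S n) \<inter> S = {}"
  "length (fresh_list S n) = n" "distinct (fresh_list S n)"
  using fresh_greater by (force simp: fresh_list_def)+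

lemma PV_fresh: "finite H \<Longrightarrow> PV (fresh (pvnames H)) n \<notin> H"
  using fresh_notin[OF finite_pvnames, of H] by (auto simp: pvnames_def)

lemma PS_fresh: "finite H \<Longrightarrow> PS (fresh (psnames H)) n \<notin> H"
  using fresh_notin[OF finite_psnames, of H] by (auto simp: psnames_def)

text \<open>The side conditions at binders in \<open>matches\<close> prevent any free name of a
  literal from being bound on the way out.\<close>

lemma matches_lits: "matches K e r A d \<Longrightarrow> k \<in> lits d \<Longrightarrow> lit_fv (K k) \<subseteq> fv A \<and> lit_fhd (K k) \<subseteq> fhd A"
proof (induction d arbitrary: A e r)
  case (DAll d)
  then obtain x B where "A = AllV x B" "matches K (up_env [x] e) r B d" "x \<notin> lit_fv (K k)" by auto
  with DAll.IH[of "up_env [x] e" r B] DAll.prems show ?case by auto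
next
  case (DAllP n d)
  then obtain x B where "A = AllP x n B" "matches K e (up_head (PV x n) r) B d" "PV x n \<notin> lit_fhd (K k)" by auto
  with DAllP.IH[of e "up_head (PV x n) r" B] DAllP.prems show ?case by auto
next
  case (DMu d ts)
  then obtain c xs D us where *: "A = Mu c xs D us" "matches K (up_env xs e) (up_head (PS c (length xs)) r) D d"
    "set xs \<inter> lit_fv (K k) = {}" "PS c (length xs) \<notin> lit_fhd (K k)" by auto
  with DMu.IH[OF *(2)] DMu.prems show ?case by auto
next
  case (DImp a b)
  from DImp.prems obtain B C where *: "A = Imp B C" "matches K e r B a" "matches K e r C b" by auto
  with DImp.IH(1)[OF *(2)] DImp.IH(2)[OF *(3)] DImp.prems(2) show ?case by auto
qed auto

text \<open>The second alternative is unavoidable: the names free in the body of a literal leave no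
  trace among the indices of \<open>d\<close>.\<close>

lemma matches_fv1: "matches K e r A d \<Longrightarrow> y \<in> fv A \<Longrightarrow> e y \<in> dfv d \<or> (\<exists>k\<in>lits d. y \<in> lit_fv (K k))"
proof (induction d arbitrary: A e r)
  case (DAll d)
  then obtain x B where *: "A = AllV x B" "matches K (up_env [x] e) r B d" "x \<noteq> y" "y \<in> fv B" by auto
  from DAll.IH[OF *(2,4)] * show ?case by (auto simp: up_env_def)
next
  case (DMu d ts)
  then obtain c xs D us where *: "A = Mu c xs D us" "matches K (up_env xs e) (up_head (PS c (length xs)) r) D d"
    "length us = length xs" "ts = map (tsub (\<lambda>y. TV (e y))) us" by auto
  with DMu.IH[OF *(2)] DMu.prems show ?case by (auto simp: up_env_def fvt_tsub)
next
  case (DLit k ts)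
  then show ?case by (force simp: fvt_tsub)
qed (auto simp: fvt_tsub, (blast | force)+)?

lemma matches_fv2: "matches K e r A d \<Longrightarrow> i \<in> dfv d \<Longrightarrow> \<exists>y\<in>fv A. e y = i"
proof (induction d arbitrary: A e r i)
  case (DAll d)
  then obtain x B where *: "A = AllV x B" "matches K (up_env [x] e) r B d" "i + 1 \<in> dfv d" by auto
  from DAll.IH[OF *(2,3)] * show ?case by (auto simp: up_env_def split: if_splits)
next
  case (DMu d ts)
  then obtain c xs D us where *: "A = Mu c xs D us" "matches K (up_env xs e) (up_head (PS c (length xs)) r) D d"
    "length us = length xs" "ts = map (tsub (\<lambda>y. TV (e y))) us" by auto
  show ?case
  proof (cases "i + length ts \<in> dfv d")
    case True
    from DMu.IH[OF *(2) this] obtain y where y: "y \<in> fv D" "up_env xs e y = i + length ts" by auto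
    with * pos_less[of y xs] have "y \<notin> set xs \<and> e y = i" by (auto simp: up_env_def split: if_splits)
    with y * show ?thesis by auto
  next
    case False
    with * DMu.prems show ?thesis by (auto simp: fvt_tsub)
  qed
qed (auto simp: fvt_tsub, (blast | force)+)?

lemma up_head_simps: "up_head h r h = 0" "g \<noteq> h \<Longrightarrow> up_head h r g = shift_idx (arity h) (arity g) (r g)"
  by (auto simp: up_head_def)

lemma shift_idx_inj [simp]: "shift_idx n m i = shift_idx n m j \<longleftrightarrow> i = j"
  by (auto simp: shift_idx_def)

lemma shift_idx_same [simp]: "shift_idx n n i = Suc i"
  by (auto simp: shift_idx_def)

lemma matches_fh1: "matches K e r A d \<Longrightarrow> h \<in> fhd A \<Longrightarrow>
  (arity h, r h) \<in> dfhd d \<or> (\<exists>k\<in>lits d. h \<in> lit_fhd (K k))"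
proof (induction d arbitrary: A e r)
  case (DAllP n d)
  then obtain x B where *: "A = AllP x n B" "matches K e (up_head (PV x n) r) B d" "h \<noteq> PV x n" "h \<in> fhd B" by auto
  from DAllP.IH[OF *(2,4)] * show ?case by (auto simp: up_head_def)
next
  case (DMu d ts)
  then obtain c xs D us where *: "A = Mu c xs D us" "matches K (up_env xs e) (up_head (PS c (length xs)) r) D d"
    "length us = length xs" "ts = map (tsub (\<lambda>y. TV (e y))) us" by auto
  with DMu.IH[OF *(2)] DMu.prems show ?case by (auto simp: up_head_def)
next
  case (DImp a b)
  from DImp.prems obtain B C where *: "A = Imp B C" "matches K e r B a" "matches K e r C b" by auto
  with DImp.IH(1)[OF *(2)] DImp.IH(2)[OF *(3)] DImp.prems(2) show ?case by auto
qed auto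

lemma matches_fh2: "matches K e r A d \<Longrightarrow> (n, i) \<in> dfhd d \<Longrightarrow> \<exists>h\<in>fhd A. arity h = n \<and> r h = i"
proof (induction d arbitrary: A e r n i)
  case (DAllP m d)
  then obtain x B where *: "A = AllP x m B" "matches K e (up_head (PV x m) r) B d" "(n, shift_idx m n i) \<in> dfhd d" by auto
  from DAllP.IH[OF *(2,3)] obtain h where h: "h \<in> fhd B" "arity h = n" "up_head (PV x m) r h = shift_idx m n i" by auto
  then have "h \<noteq> PV x m" by (auto simp: up_head_def)
  with h * show ?case by (auto simp: up_head_def)
next
  case (DMu d ts)
  then obtain c xs D us where *: "A = Mu c xs D us" "matches K (up_env xs e) (up_head (PS c (length xs)) r) D d"
    "length us = length xs" "ts = map (tsub (\<lambda>y. TV (e y))) us" by auto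
  with DMu.prems have "(n, shift_idx (length xs) n i) \<in> dfhd d" by simp
  from DMu.IH[OF *(2) this] obtain h where h: "h \<in> fhd D" "arity h = n"
    "up_head (PS c (length xs)) r h = shift_idx (length xs) n i" by auto
  then have "h \<noteq> PS c (length xs)" by (auto simp: up_head_def)
  with h * show ?case by (auto simp: up_head_def)
next
  case (DImp a b)
  from DImp.prems obtain B C where *: "A = Imp B C" "matches K e r B a" "matches K e r C b" by auto
  with DImp.IH(1)[OF *(2), of n i] DImp.IH(2)[OF *(3), of n i] DImp.prems(2) show ?case by auto
qed auto

lemma lits_dsubT [simp]: "lits (dsubT s d) = lits d"
  by (induction d arbitrary: s) auto

lemma lits_hren [simp]: "lits (hren f d) = lits d"
  by (induction d arbitrary: f) auto

lemma lits_lift_abs [simp]: "lits (lift_abs k m d) = lits d"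
  by (simp add: lift_abs_def)

lemma lits_head_id [simp]: "lits (head_id n i) = {}"
  by (simp add: head_id_def)

lemma shift_idx_cases:
  obtains "m = n" "i = 0" | j where "i = shift_idx n m j"
  by (cases "m = n"; cases i) (auto simp: shift_idx_def)

lemma lits_dsubst: "lits (dsubst s t d) = lits d \<union> (\<Union>(n, i)\<in>dfhd d. lits (t n i))"
proof (induction d arbitrary: s t)
  have *: "(\<Union>(m, i)\<in>D. lits (upH n t m i)) = (\<Union>(m, i)\<in>{(m, i). (m, shift_idx n m i) \<in> D}. lits (t m i))"
    for D n t
  proof (intro equalityI subsetI)
    fix k assume "k \<in> (\<Union>(m, i)\<in>D. lits (upH n t m i))"
    then obtain m i where 1: "(m, i) \<in> D" "k \<in> lits (upH n t m i)" by auto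
    show "k \<in> (\<Union>(m, i)\<in>{(m, i). (m, shift_idx n m i) \<in> D}. lits (t m i))"
    proof (cases rule: shift_idx_cases[of m n i])
      case 1 with \<open>k \<in> lits (upH n t m i)\<close> show ?thesis by (simp add: upH_def)
    next
      case (2 j) with 1 show ?thesis by (auto simp: upH_shift_idx)
    qed
  next
    fix k assume "k \<in> (\<Union>(m, i)\<in>{(m, i). (m, shift_idx n m i) \<in> D}. lits (t m i))"
    then obtain m i where "(m, shift_idx n m i) \<in> D" "k \<in> lits (upH n t m (shift_idx n m i))" by (auto simp: upH_shift_idx)
    then show "k \<in> (\<Union>(m, i)\<in>D. lits (upH n t m i))" by blast
  qed
  { case (DAllP n d) then show ?case by (simp add: *) }
  { case (DMu d ts) then show ?case by (simp add: * liftH_def) }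
  { case (DAll d) then show ?case by (simp add: liftH_def) }
qed auto

text \<open>Allows a literal that does not occur in \<open>d\<close> to be given a new
  meaning.\<close>

lemma matches_cong: "matches K e r A d \<Longrightarrow> (\<And>k. k \<in> lits d \<Longrightarrow> K' k = K k) \<Longrightarrow> matches K' e r A d"
proof (induction d arbitrary: A e r)
  case (DImp a b)
  then obtain B C where *: "A = Imp B C" "matches K e r B a" "matches K e r C b" by auto
  have "matches K' e r B a" by (rule DImp.IH(1)[OF *(2)]) (use DImp.prems in auto)
  moreover have "matches K' e r C b" by (rule DImp.IH(2)[OF *(3)]) (use DImp.prems in auto)
  ultimately show ?case using * by simp
next
  case (DAll d)
  then obtain x B where *: "A = AllV x B" "matches K (up_env [x] e) r B d" "\<forall>k\<in>lits d. x \<notin> lit_fv (K k)" by auto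
  have "matches K' (up_env [x] e) r B d" by (rule DAll.IH[OF *(2)]) (use DAll.prems in auto)
  with * DAll.prems show ?case by simp
next
  case (DAllP n d)
  then obtain X B where *: "A = AllP X n B" "matches K e (up_head (PV X n) r) B d"
    "\<forall>k\<in>lits d. PV X n \<notin> lit_fhd (K k)" by auto
  have "matches K' e (up_head (PV X n) r) B d" by (rule DAllP.IH[OF *(2)]) (use DAllP.prems in auto)
  with * DAllP.prems show ?case by simp
next
  case (DMu d ts)
  then obtain c xs D us where *: "A = Mu c xs D us" "matches K (up_env xs e) (up_head (PS c (length xs)) r) D d"
    "length us = length xs" "ts = map (tsub (\<lambda>y. TV (e y))) us"
    "\<forall>k\<in>lits d. set xs \<inter> lit_fv (K k) = {} \<and> PS c (length xs) \<notin> lit_fhd (K k)" by auto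
  have "matches K' (up_env xs e) (up_head (PS c (length xs)) r) D d"
    by (rule DMu.IH[OF *(2)]) (use DMu.prems in auto)
  with * DMu.prems show ?case by simp
qed auto

text \<open>Here the named type stays the same and only the numbering of its free names changes. All
  relevant images are \<open>head_id\<close>, so no literal enters and the side conditions at
  binders persist.\<close>

lemma matches_env:
  "matches K e r A d \<Longrightarrow> (\<And>y. y \<in> fv A \<Longrightarrow> s (e y) = TV (e' y)) \<Longrightarrow>
   (\<And>h. h \<in> fhd A \<Longrightarrow> t (arity h) (r h) = head_id (arity h) (r' h)) \<Longrightarrow> matches K e' r' A (dsubst s t d)"
proof (induction d arbitrary: A e r e' r' s t)
  case (DAt i ts)
  then obtain h us where *: "A = At h us" "r h = i" "length us = arity h"
    "ts = map (tsub (\<lambda>y. TV (e y))) us" by auto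
  have "map (tsub s) ts = map (tsub (\<lambda>y. TV (e' y))) us"
    using DAt.prems(2) * by (force simp: tsub_tsub intro!: tsub_cong)
  with * DAt.prems(3)[of h] show ?case by (simp add: dsubT_consl_head_id)
next
  case (DImp a b)
  then show ?case by force
next
  case (DAll d)
  then obtain x B where *: "A = AllV x B" "matches K (up_env [x] e) r B d" "\<forall>k\<in>lits d. x \<notin> lit_fv (K k)" by auto
  have "lits (dsubst (upT 1 s) (liftH 1 t) d) = lits d"
    using matches_fh2[OF *(2)] DAll.prems * by (fastforce simp: lits_dsubst liftH_def)
  moreover have "matches K (up_env [x] e') r' B (dsubst (upT 1 s) (liftH 1 t) d)"
  proof (rule DAll.IH[OF *(2)])
    fix y assume "y \<in> fv B"
    then show "upT 1 s (up_env [x] e y) = TV (up_env [x] e' y)"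
      using DAll.prems(2)[of y] * by (cases "y = x") (auto simp: up_env_def upT_def)
  qed (use DAll.prems * in \<open>auto simp: liftH_def lift_abs_head_id\<close>)
  ultimately show ?case using * by simp
next
  case (DAllP n d)
  then obtain X B where *: "A = AllP X n B" "matches K e (up_head (PV X n) r) B d"
    "\<forall>k\<in>lits d. PV X n \<notin> lit_fhd (K k)" by auto
  have t: "upH n t (arity h) (up_head (PV X n) r h) = head_id (arity h) (up_head (PV X n) r' h)" if "h \<in> fhd B" for h
    using DAllP.prems that * by (cases "h = PV X n") (auto simp: up_head_simps upH_shift_idx hren_head_id, simp add: upH_def)
  have "lits (dsubst s (upH n t) d) = lits d"
    using matches_fh2[OF *(2)] t by (fastforce simp: lits_dsubst)
  moreover have "matches K e' (up_head (PV X n) r') B (dsubst s (upH n t) d)"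
    by (rule DAllP.IH[OF *(2)]) (use DAllP.prems * t in auto)
  ultimately show ?case using * by simp
next
  case (DMu d ts)
  then obtain c xs D us where *: "A = Mu c xs D us" "matches K (up_env xs e) (up_head (PS c (length xs)) r) D d"
    "length us = length xs" "ts = map (tsub (\<lambda>y. TV (e y))) us"
    "\<forall>k\<in>lits d. set xs \<inter> lit_fv (K k) = {} \<and> PS c (length xs) \<notin> lit_fhd (K k)" by auto
  let ?n = "length xs" let ?t = "upH ?n (liftH ?n t)"
  have t: "?t (arity h) (up_head (PS c ?n) r h) = head_id (arity h) (up_head (PS c ?n) r' h)" if "h \<in> fhd D" for h
    using DMu.prems that *
    by (cases "h = PS c ?n") (auto simp: up_head_simps upH_shift_idx hren_head_id liftH_def lift_abs_head_id, simp add: upH_def)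
  have "lits (dsubst (upT ?n s) ?t d) = lits d"
    using matches_fh2[OF *(2)] t by (fastforce simp: lits_dsubst)
  moreover have "matches K (up_env xs e') (up_head (PS c ?n) r') D (dsubst (upT ?n s) ?t d)"
  proof (rule DMu.IH[OF *(2)])
    fix y assume "y \<in> fv D"
    then show "upT ?n s (up_env xs e y) = TV (up_env xs e' y)"
      using DMu.prems(2)[of y] * by (cases "y \<in> set xs") (auto simp: up_env_def upT_def dest: pos_less)
  qed (use t in auto)
  moreover have "map (tsub s) ts = map (tsub (\<lambda>y. TV (e' y))) us"
    using DMu.prems * by (auto simp: tsub_tsub intro!: tsub_cong)
  ultimately show ?case using * by simp
next
  case (DLit k ts)
  then obtain c xs D us where *: "A = Mu c xs D us" "K k = (c, xs, D)" "length us = length xs"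
    "ts = map (tsub (\<lambda>y. TV (e y))) us" by auto
  have "s (e y) = TV (e' y)" if "u \<in> set us" "y \<in> fvt u" for u y
    by (rule DLit.prems(2)) (use that * in auto)
  then have "map (tsub s) ts = map (tsub (\<lambda>y. TV (e' y))) us"
    unfolding * by (auto simp: tsub_tsub intro!: tsub_cong)
  with * show ?case by simp
qed auto

text \<open>Compares an abstraction with a de Bruijn image. The condition on literals ensures that
  replacing the parameters \<open>ys\<close> by arguments leaves the literal fixed points inside the
  image untouched.\<close>

fun image_ok :: "(nat \<Rightarrow> lit) \<Rightarrow> (nat \<Rightarrow> nat) \<Rightarrow> (head \<Rightarrow> nat) \<Rightarrow> head \<Rightarrow> abstr option \<Rightarrow> dty \<Rightarrow> bool" where
  "image_ok K e r h None d = (d = head_id (arity h) (r h))"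
| "image_ok K e r h (Some (ys, F)) d = (length ys = arity h \<and> matches K (up_env ys e) r F d \<and>
     (\<forall>k\<in>lits d. set ys \<inter> lit_fv (K k) = {}))"

lemma image_ok_lits: "image_ok K e r h p d \<Longrightarrow> k \<in> lits d \<Longrightarrow> lit_fv (K k) \<subseteq> absfv p \<and> lit_fhd (K k) \<subseteq> absfh p"
  using matches_lits by (cases p) fastforce+

lemma image_ok_up_env:
  assumes "image_ok K e r h p d" "set xs \<inter> absfv p = {}"
  shows "image_ok K (up_env xs e) r h p (lift_abs (length xs) (arity h) d)"
proof (cases p)
  case None
  with assms show ?thesis by (simp add: lift_abs_head_id)
next
  case (Some q)
  then obtain ys F where p: "p = Some (ys, F)" by (cases q) auto
  have "matches K (up_env ys (up_env xs e)) r F (dsubst (upT (length ys) (\<lambda>i. TV (i + length xs))) head_id d)"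
  proof (rule matches_env[where e = "up_env ys e" and r = r])
    fix y assume "y \<in> fv F"
    with assms p show "upT (length ys) (\<lambda>i. TV (i + length xs)) (up_env ys e y) = TV (up_env ys (up_env xs e) y)"
      using pos_less[of y ys] by (cases "y \<in> set ys") (auto simp: up_env_def upT_def)
  qed (use assms p in auto)
  with assms p show ?thesis by (simp add: lift_abs_def dsubst_head_id)
qed

lemma image_ok_up_head:
  assumes "image_ok K e r h p d" "g \<notin> absfh p" "p = None \<longrightarrow> g \<noteq> h"
  shows "image_ok K e (up_head g r) h p (shift_head (arity g) d)"
proof (cases p)
  case None
  with assms show ?thesis by (auto simp: hren_head_id up_head_def)
next
  case (Some q)
  then obtain ys F where p: "p = Some (ys, F)" by (cases q) auto
  have "matches K (up_env ys e) (up_head g r) F (dsubst TV (\<lambda>m i. head_id m (shift_idx (arity g) m i)) d)"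
    by (rule matches_env[where e = "up_env ys e" and r = r]) (use assms p in \<open>auto simp: up_head_def\<close>)
  moreover have "dsubst TV (\<lambda>m i. head_id m (shift_idx (arity g) m i)) d = shift_head (arity g) d"
    using dsubst_hren[of TV head_id "shift_idx (arity g)" d] by simp
  ultimately show ?thesis using assms p by simp
qed

text \<open>Serves \<open>AllP\<close> and \<open>Mu\<close>, with and without renaming: whether
  \<open>g\<close> is kept or replaced by the eta-expanded new name \<open>g'\<close>, the bound
  head has index \<open>0\<close> on the de Bruijn side.\<close>

lemma image_ok_bind:
  fixes g g' :: head
  assumes "arity g = n" "arity g' = n" "g' \<notin> (\<Union>h\<in>H - {g}. absfh (\<rho> h))" "g' = g \<or> g' \<notin> H"
    and "\<forall>h\<in>H - {g}. image_ok K e r' h (\<rho> h) (t (arity h) (r h))"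
    and "h \<in> H"
  shows "image_ok K e (up_head g' r') h
     ((\<rho>(g := if g' = g then None else Some ([0..<n], At g' (map TV [0..<n])))) h)
     (upH n t (arity h) (up_head g r h))"
proof (cases "h = g")
  case True
  have "up_env [0..<n] e y = y" if "y < n" for y
    using that pos_nth[of "[0..<n]" y] by (simp add: up_env_def)
  with True assms show ?thesis by (auto simp: up_head_simps upH_def head_id_def)
next
  case False
  with assms have "image_ok K e (up_head g' r') h (\<rho> h) (shift_head (arity g') (t (arity h) (r h)))"
    by (intro image_ok_up_head) auto
  with False assms show ?thesis by (simp add: up_head_simps upH_shift_idx)
qed

text \<open>A list \<open>xs\<close> that is kept may contain repetitions, which \<open>pos\<close>
  resolves alike before and after the substitution; a list of new names comes from
  \<open>fresh_list\<close> and is distinct.\<close>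

lemma upT_bind:
  assumes "\<forall>y\<in>V - set xs. tsub (\<lambda>y. TV (e' y)) (\<theta> y) = s (e y)"
    and "xs' = xs \<or> distinct xs'" "length xs' = length xs"
    and "set xs' \<inter> (\<Union>y\<in>V - set xs. fvt (\<theta> y)) = {}" and "y \<in> V"
  shows "tsub (\<lambda>y. TV (up_env xs' e' y)) (updl \<theta> xs (map TV xs') y) = upT (length xs) s (up_env xs e y)"
proof (cases "y \<in> set xs")
  case True
  with assms(2,3) have "pos xs' (xs' ! pos xs y) = pos xs y"
    by (auto simp: pos_nth nth_pos pos_less)
  with True assms(3) show ?thesis
    by (auto simp: updl_pos up_env_def upT_def pos_less)
next
  case False
  have "tsub (\<lambda>y. TV (up_env xs' e' y)) (\<theta> y) = tsub (\<lambda>j. TV (j + length xs)) (tsub (\<lambda>y. TV (e' y)) (\<theta> y))"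
  proof -
    have "up_env xs' e' z = e' z + length xs" if "z \<in> fvt (\<theta> y)" for z
      using that assms(3,4,5) False by (auto simp: up_env_def)
    then show ?thesis by (auto simp: tsub_tsub intro!: tsub_cong)
  qed
  also have "tsub (\<lambda>y. TV (e' y)) (\<theta> y) = s (e y)"
    using False assms by auto
  finally show ?thesis
    using False assms(3) by (simp add: updl_pos upT_def up_env_def[of xs e])
qed

lemma updl_single: "updl \<theta> [x] [u] = \<theta>(x := u)"
  by (auto simp: updl_def fun_eq_iff)

lemma substT_subst: "substT \<theta> A = subst \<theta> (\<lambda>_. None) A"
proof -
  have [simp]: "(\<lambda>_. None)(x := None) = (\<lambda>_. None)" for x :: head by auto
  show ?thesis by (induction A arbitrary: \<theta>) (auto simp: Let_def)
qed

lemma subst_id: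
  "(\<And>y. y \<in> fv A \<Longrightarrow> \<theta> y = TV y) \<Longrightarrow> (\<And>h. h \<in> fhd A \<Longrightarrow> \<rho> h = None) \<Longrightarrow> subst \<theta> \<rho> A = A"
proof (induction A arbitrary: \<theta> \<rho>)
  case (At h ts)
  then have "map (tsub \<theta>) ts = map (tsub TV) ts" by (intro map_cong refl tsub_cong) auto
  with At show ?case by simp
next
  case (Imp A1 A2)
  have "subst \<theta> \<rho> A1 = A1" "subst \<theta> \<rho> A2 = A2"
    by (rule Imp.IH; use Imp.prems in auto)+
  then show ?case by simp
next
  case (AllV x A)
  have "subst (\<theta>(x := TV x)) \<rho> A = A"
    by (rule AllV.IH) (use AllV.prems in auto)
  moreover have "x \<notin> (\<Union>y\<in>fv A - {x}. fvt (\<theta> y)) \<union> (\<Union>h\<in>fhd A. absfv (\<rho> h))"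
    using AllV.prems by auto
  ultimately show ?case by (simp only: subst.simps Let_def if_False)
next
  case (AllP X n A)
  have "subst \<theta> (\<rho>(PV X n := None)) A = A"
    by (rule AllP.IH) (use AllP.prems in auto)
  moreover have "PV X n \<notin> (\<Union>h\<in>fhd A - {PV X n}. absfh (\<rho> h))"
    using AllP.prems by auto
  ultimately show ?case by (simp only: subst.simps Let_def if_False) simp
next
  case (Mu c xs D ts)
  let ?n = "length xs"
  have "subst (updl \<theta> xs (map TV xs)) (\<rho>(PS c ?n := None)) D = D"
    by (rule Mu.IH) (use Mu.prems in \<open>auto simp: updl_pos nth_pos pos_less\<close>)
  moreover have "PS c ?n \<notin> (\<Union>h\<in>fhd D - {PS c ?n}. absfh (\<rho> h))"
    and "set xs \<inter> ((\<Union>y\<in>fv D - set xs. fvt (\<theta> y)) \<union> (\<Union>h\<in>fhd D - {PS c ?n}. absfv (\<rho> h))) = {}"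
    using Mu.prems by auto
  moreover have "map (tsub \<theta>) ts = map (tsub TV) ts"
    using Mu.prems by (intro map_cong refl tsub_cong) auto
  ultimately show ?case by (simp only: subst.simps Let_def if_False if_True simp_thms) simp
qed auto

text \<open>A substitution that is trivial on the free names never triggers the test for capture, so
  neither \<open>xs\<close> nor \<open>c\<close> is renamed and the result is syntactically the same
  fixed point with new arguments.\<close>

lemma subst_mu_lit:
  assumes "\<And>y. y \<in> fv D - set xs \<Longrightarrow> \<theta> y = TV y"
    and "\<And>h. h \<in> fhd D - {PS c (length xs)} \<Longrightarrow> \<rho> h = None"
  shows "subst \<theta> \<rho> (Mu c xs D us) = Mu c xs D (map (tsub \<theta>) us)"
proof -
  let ?n = "length xs"
  have "subst (updl \<theta> xs (map TV xs)) (\<rho>(PS c ?n := None)) D = D"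
    by (rule subst_id) (use assms in \<open>auto simp: updl_pos nth_pos pos_less\<close>)
  moreover have "PS c ?n \<notin> (\<Union>h\<in>fhd D - {PS c ?n}. absfh (\<rho> h))"
    and "set xs \<inter> ((\<Union>y\<in>fv D - set xs. fvt (\<theta> y)) \<union> (\<Union>h\<in>fhd D - {PS c ?n}. absfv (\<rho> h))) = {}"
    using assms by auto
  ultimately show ?thesis
    by (simp only: subst.simps Let_def if_False if_True simp_thms)
qed

lemma map_tsub_env:
  assumes "\<forall>y\<in>V. tsub (\<lambda>y. TV (e' y)) (\<theta> y) = s (e y)" "\<Union> (set (map fvt us)) \<subseteq> V"
  shows "map (tsub s) (map (tsub (\<lambda>y. TV (e y))) us) = map (tsub (\<lambda>y. TV (e' y))) (map (tsub \<theta>) us)"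
proof -
  have "s (e y) = tsub (\<lambda>y. TV (e' y)) (\<theta> y)" if "u \<in> set us" "y \<in> fvt u" for u y
    using assms that by auto
  then show ?thesis by (auto simp: tsub_tsub intro!: tsub_cong)
qed

text \<open>The first premise lets one induction serve twice: for substitutions of terms alone, and then, with the result for
these as the second alternative, for all substitutions.\<close>

lemma matches_subst_aux:
  assumes "(\<forall>h. \<rho> h = None) \<or>
      (\<forall>F e r d \<theta> e' s. matches K e r F d \<longrightarrow> (\<forall>y\<in>fv F. tsub (\<lambda>y. TV (e' y)) (\<theta> y) = s (e y)) \<longrightarrow>
         (\<forall>k\<in>lits d. \<forall>y\<in>lit_fv (K k). \<theta> y = TV y) \<longrightarrow> matches K e' r (substT \<theta> F) (dsubT s d))"
    and "matches K e r A d"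
    and "\<forall>y\<in>fv A. tsub (\<lambda>y. TV (e' y)) (\<theta> y) = s (e y)"
    and "\<forall>h\<in>fhd A. image_ok K e' r' h (\<rho> h) (t (arity h) (r h))"
    and "\<forall>k\<in>lits d. (\<forall>y\<in>lit_fv (K k). \<theta> y = TV y) \<and> (\<forall>h\<in>lit_fhd (K k). \<rho> h = None)"
  shows "matches K e' r' (subst \<theta> \<rho> A) (dsubst s t d)"
  using assms
proof (induction d arbitrary: A e r e' r' \<theta> \<rho> s t)
  case DBot
  then show ?case by simp
next
  case (DAt i ts)
  then obtain h us where A: "A = At h us" "r h = i" "length us = arity h"
    "ts = map (tsub (\<lambda>y. TV (e y))) us" by auto
  have ts: "map (tsub s) ts = map (tsub (\<lambda>y. TV (e' y))) (map (tsub \<theta>) us)"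
    unfolding A(4) by (rule map_tsub_env[where V = "fv A"]) (use DAt.prems(3) in simp, simp add: A)
  show ?case
  proof (cases "\<rho> h")
    case None
    with DAt.prems A ts show ?thesis by (auto simp: dsubT_consl_head_id)
  next
    case (Some q)
    then obtain ys F where p: "\<rho> h = Some (ys, F)" by (cases q) auto
    with DAt.prems A have im: "length ys = arity h" "matches K (up_env ys e') r' F (t (arity h) i)"
      "\<forall>k\<in>lits (t (arity h) i). set ys \<inter> lit_fv (K k) = {}" by auto
    have "matches K e' r' (substT (updl TV ys (map (tsub \<theta>) us)) F)
        (dsubT (consl (map (tsub s) ts) TV) (t (arity h) i))"
    proof (rule DAt.prems(1)[THEN disjE])
      assume "\<forall>h. \<rho> h = None" with p show ?thesis by simp
    next
      assume *: "\<forall>F e r d \<theta> e' s. matches K e r F d \<longrightarrow> (\<forall>y\<in>fv F. tsub (\<lambda>y. TV (e' y)) (\<theta> y) = s (e y)) \<longrightarrow>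
         (\<forall>k\<in>lits d. \<forall>y\<in>lit_fv (K k). \<theta> y = TV y) \<longrightarrow> matches K e' r (substT \<theta> F) (dsubT s d)"
      show ?thesis
      proof (rule *[rule_format, OF im(2)])
        fix y
        show "tsub (\<lambda>y. TV (e' y)) (updl TV ys (map (tsub \<theta>) us) y) =
          consl (map (tsub s) ts) TV (up_env ys e' y)"
          unfolding ts using A im pos_less[of y ys] by (auto simp: updl_pos consl_up_env)
      next
        fix k y assume "k \<in> lits (t (arity h) i)" "y \<in> lit_fv (K k)"
        with im A show "updl TV ys (map (tsub \<theta>) us) y = TV y"
          by (auto simp: updl_pos)
      qed
    qed
    with A p show ?thesis by simp
  qed
next
  case (DImp a b)
  then obtain B C where *: "A = Imp B C" "matches K e r B a" "matches K e r C b" by auto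
  have "matches K e' r' (subst \<theta> \<rho> B) (dsubst s t a)"
    by (rule DImp.IH(1)[OF DImp.prems(1) *(2)]) (use DImp.prems * in auto)
  moreover have "matches K e' r' (subst \<theta> \<rho> C) (dsubst s t b)"
    by (rule DImp.IH(2)[OF DImp.prems(1) *(3)]) (use DImp.prems * in auto)
  ultimately show ?case using * by simp
next
  case (DAll d)
  then obtain x B where *: "A = AllV x B" "matches K (up_env [x] e) r B d" "\<forall>k\<in>lits d. x \<notin> lit_fv (K k)" by auto
  define S where "S = (\<Union>y\<in>fv B - {x}. fvt (\<theta> y)) \<union> (\<Union>h\<in>fhd B. absfv (\<rho> h))"
  define x' where "x' = (if x \<in> S then fresh (S \<union> fv B) else x)"
  have S: "finite S" by (simp add: S_def)
  then have x': "x' \<notin> S" using fresh_notin[of "S \<union> fv B"] by (auto simp: x'_def)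
  have 1: "matches K (up_env [x'] e') r' (subst (\<theta>(x := TV x')) \<rho> B) (dsubst (upT 1 s) (liftH 1 t) d)"
  proof (rule DAll.IH[OF DAll.prems(1) *(2)], goal_cases)
    case 1
    show ?case
    proof
      fix y assume y: "y \<in> fv B"
      show "tsub (\<lambda>y. TV (up_env [x'] e' y)) ((\<theta>(x := TV x')) y) = upT 1 s (up_env [x] e y)"
        using upT_bind[of "fv B" "[x]" e' \<theta> s e "[x']" y] DAll.prems(3) * x' y
        by (simp add: updl_single S_def)
    qed
  next
    case 2
    show ?case
    proof
      fix h assume h: "h \<in> fhd B"
      with x' DAll.prems(4) * show "image_ok K (up_env [x'] e') r' h (\<rho> h) (liftH 1 t (arity h) (r h))"
        using image_ok_up_env[of K e' r' h "\<rho> h" "t (arity h) (r h)" "[x']"] by (simp add: liftH_def S_def)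
    qed
  next
    case 3
    from DAll.prems(5) * show ?case by auto
  qed
  \<comment> \<open>A literal of the result comes from \<open>d\<close> or from the image of a head.
    Either way its free variables lie in \<open>S\<close>, which \<open>x'\<close> avoids.\<close>
  have 2: "x' \<notin> lit_fv (K k)" if k: "k \<in> lits (dsubst (upT 1 s) (liftH 1 t) d)" for k
  proof -
    consider "k \<in> lits d" | n i where "(n, i) \<in> dfhd d" "k \<in> lits (t n i)"
      using k by (auto simp: lits_dsubst liftH_def)
    then have "lit_fv (K k) \<subseteq> S"
    proof cases
      case 1
      show ?thesis
      proof
        fix y assume y: "y \<in> lit_fv (K k)"
        with matches_lits[OF *(2) 1] *(3) 1 have "y \<in> fv B - {x}" by auto
        moreover have "\<theta> y = TV y" using DAll.prems(5) 1 y by auto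
        ultimately show "y \<in> S" unfolding S_def by force
      qed
    next
      case 2
      from matches_fh2[OF *(2) 2(1)] obtain h where h: "h \<in> fhd B" "arity h = n" "r h = i" by auto
      then have "absfv (\<rho> h) \<subseteq> S" by (auto simp: S_def)
      moreover have "image_ok K e' r' h (\<rho> h) (t n i)" using h DAll.prems(4) * by auto
      ultimately show ?thesis using image_ok_lits[of K e' r' h "\<rho> h" "t n i" k] 2 by blast
    qed
    with x' show ?thesis by auto
  qed
  from 1 2 * show ?case by (simp add: Let_def S_def[symmetric] x'_def[symmetric])
next
  case (DAllP n d)
  then obtain X B where *: "A = AllP X n B" "matches K e (up_head (PV X n) r) B d"
    "\<forall>k\<in>lits d. PV X n \<notin> lit_fhd (K k)" by auto
  define R where "R = (\<Union>h\<in>fhd B - {PV X n}. absfh (\<rho> h))"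
  define X' where "X' = (if PV X n \<in> R then fresh (pvnames (R \<union> fhd B)) else X)"
  define \<rho>' where "\<rho>' = \<rho>(PV X n := (if X' = X then None
                             else Some ([0..<n], At (PV X' n) (map TV [0..<n]))))"
  have R: "finite R" by (simp add: R_def)
  then have X': "PV X' n \<notin> R" "X' = X \<or> PV X' n \<notin> fhd B"
    using PV_fresh[of "R \<union> fhd B" n] by (auto simp: X'_def)
  have im: "image_ok K e' (up_head (PV X' n) r') h (\<rho>' h) (upH n t (arity h) (up_head (PV X n) r h))" if "h \<in> fhd B" for h
    using image_ok_bind[of "PV X n" n "PV X' n" \<rho> "fhd B" K e' r' t r h] X' that DAllP.prems(4) *
    by (auto simp: R_def \<rho>'_def)
  have 1: "matches K e' (up_head (PV X' n) r') (subst \<theta> \<rho>' B) (dsubst s (upH n t) d)"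
  proof (rule DAllP.IH[OF _ *(2)], goal_cases)
    case 1
    show ?case
    proof (rule DAllP.prems(1)[THEN disjE])
      \<comment> \<open>Without images there is nothing to capture, so \<open>X\<close> is not
        renamed and the first alternative also holds for the body.\<close>
      assume "\<forall>h. \<rho> h = None"
      then have "R = {}" by (simp add: R_def)
      then have "X' = X" by (simp add: X'_def)
      with \<open>\<forall>h. \<rho> h = None\<close> show ?thesis by (auto simp: \<rho>'_def)
    qed blast
  next
    case 2
    from DAllP.prems(3) * show ?case by simp
  next
    case 3
    with im show ?case by blast
  next
    case 4
    from DAllP.prems(5) * show ?case by (auto simp: \<rho>'_def)
  qed
  have 2: "PV X' n \<notin> lit_fhd (K k)" if k: "k \<in> lits (dsubst s (upH n t) d)" for k
  proof -
    consider "k \<in> lits d" | m i where "(m, i) \<in> dfhd d" "k \<in> lits (upH n t m i)"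
      using k by (auto simp: lits_dsubst)
    then show ?thesis
    proof cases
      case 1
      with matches_lits[OF *(2)] * X' show ?thesis by (cases "X' = X") auto
    next
      case 2
      from matches_fh2[OF *(2) 2(1)] obtain h where h: "h \<in> fhd B" "arity h = m" "up_head (PV X n) r h = i" by auto
      have "h \<noteq> PV X n" using 2(2) h by (auto simp: up_head_simps upH_def)
      with h 2 have "k \<in> lits (t (arity h) (r h))"
        by (auto simp: up_head_simps upH_shift_idx)
      with image_ok_lits[of K e' r' h "\<rho> h" "t (arity h) (r h)" k] DAllP.prems(4) * h \<open>h \<noteq> PV X n\<close>
      have "lit_fhd (K k) \<subseteq> R" unfolding R_def by auto
      with X' show ?thesis by auto
    qed
  qed
  have "subst \<theta> \<rho> A = AllP X' n (subst \<theta> \<rho>' B)"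
    by (simp only: * subst.simps Let_def R_def X'_def \<rho>'_def)
  with 1 2 show ?case by simp
next
  case (DMu d ts)
  then obtain c xs D us where *: "A = Mu c xs D us" "matches K (up_env xs e) (up_head (PS c (length xs)) r) D d"
    "length us = length xs" "ts = map (tsub (\<lambda>y. TV (e y))) us"
    "\<forall>k\<in>lits d. set xs \<inter> lit_fv (K k) = {} \<and> PS c (length xs) \<notin> lit_fhd (K k)" by auto
  define n where "n = length xs"
  define S where "S = (\<Union>y\<in>fv D - set xs. fvt (\<theta> y)) \<union> (\<Union>h\<in>fhd D - {PS c n}. absfv (\<rho> h))"
  define xs' where "xs' = (if set xs \<inter> S = {} then xs else fresh_list (S \<union> fv D) n)"
  define R where "R = (\<Union>h\<in>fhd D - {PS c n}. absfh (\<rho> h))"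
  define c' where "c' = (if PS c n \<in> R then fresh (psnames (R \<union> fhd D)) else c)"
  define \<rho>' where "\<rho>' = \<rho>(PS c n := (if c' = c then None
                             else Some ([0..<n], At (PS c' n) (map TV [0..<n]))))"
  have S: "finite S" by (simp add: S_def)
  then have xs': "set xs' \<inter> S = {}" "xs' = xs \<or> distinct xs'" "length xs' = n"
    using fresh_list_props[of "S \<union> fv D" n] by (auto simp: xs'_def n_def)
  have R: "finite R" by (simp add: R_def)
  then have c': "PS c' n \<notin> R" "c' = c \<or> PS c' n \<notin> fhd D"
    using PS_fresh[of "R \<union> fhd D" n] by (auto simp: c'_def)
  have im0: "image_ok K (up_env xs' e') r' h (\<rho> h) (liftH n t (arity h) (r h))" if "h \<in> fhd D - {PS c n}" for h
    using image_ok_up_env[of K e' r' h "\<rho> h" "t (arity h) (r h)" xs'] xs' DMu.prems(4) * that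
    by (force simp: liftH_def S_def n_def)
  have im: "image_ok K (up_env xs' e') (up_head (PS c' n) r') h (\<rho>' h) (upH n (liftH n t) (arity h) (up_head (PS c n) r h))"
    if "h \<in> fhd D" for h
    using image_ok_bind[of "PS c n" n "PS c' n" \<rho> "fhd D" K "up_env xs' e'" r' "liftH n t" r h] c' that im0
    by (auto simp: R_def \<rho>'_def)
  have 1: "matches K (up_env xs' e') (up_head (PS c' n) r') (subst (updl \<theta> xs (map TV xs')) \<rho>' D)
     (dsubst (upT n s) (upH n (liftH n t)) d)"
  proof (rule DMu.IH[OF _ *(2)], goal_cases)
    case 1
    show ?case
    proof (rule DMu.prems(1)[THEN disjE])
      assume "\<forall>h. \<rho> h = None"
      then have "R = {}" by (simp add: R_def)
      then have "c' = c" by (simp add: c'_def)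
      with \<open>\<forall>h. \<rho> h = None\<close> show ?thesis by (auto simp: \<rho>'_def)
    qed blast
  next
    case 2
    show ?case
    proof
      fix y assume y: "y \<in> fv D"
      show "tsub (\<lambda>y. TV (up_env xs' e' y)) (updl \<theta> xs (map TV xs') y) = upT n s (up_env xs e y)"
        unfolding n_def
        by (rule upT_bind[of "fv D"]) (use DMu.prems(3) * xs' y in \<open>auto simp: S_def n_def\<close>)
    qed
  next
    case 3
    with im show ?case by (simp add: n_def)
  next
    case 4
    have "updl \<theta> xs (map TV xs') y = TV y" if "k \<in> lits d" "y \<in> lit_fv (K k)" for k y
      using that DMu.prems(5) * xs'(3) by (auto simp: updl_pos n_def)
    with DMu.prems(5) * show ?case by (auto simp: \<rho>'_def n_def)
  qed
  have 2: "set xs' \<inter> lit_fv (K k) = {} \<and> PS c' n \<notin> lit_fhd (K k)"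
    if k: "k \<in> lits (dsubst (upT n s) (upH n (liftH n t)) d)" for k
  proof -
    consider "k \<in> lits d" | m i where "(m, i) \<in> dfhd d" "k \<in> lits (upH n (liftH n t) m i)"
      using k by (auto simp: lits_dsubst)
    then show ?thesis
    proof cases
      case 1
      \<comment> \<open>The substitution maps such a variable to itself, so the variable is among
        those collected in \<open>S\<close>.\<close>
      have "lit_fv (K k) \<subseteq> S"
      proof
        fix y assume y: "y \<in> lit_fv (K k)"
        with matches_lits[OF *(2) 1] *(5) 1 have "y \<in> fv D - set xs" by auto
        moreover have "\<theta> y = TV y" using DMu.prems(5) 1 y by auto
        ultimately show "y \<in> S" unfolding S_def by force
      qed
      moreover have "PS c' n \<notin> lit_fhd (K k)"
        using matches_lits[OF *(2) 1] *(5) c' 1 by (cases "c' = c") (auto simp: n_def)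
      ultimately show ?thesis using xs' by auto
    next
      case 2
      from matches_fh2[OF *(2) 2(1)] obtain h where h: "h \<in> fhd D" "arity h = m"
        "up_head (PS c n) r h = i" by (auto simp: n_def)
      have hc: "h \<noteq> PS c n" using 2(2) h by (auto simp: up_head_simps upH_def)
      with h 2 have "k \<in> lits (t (arity h) (r h))"
        by (auto simp: up_head_simps upH_shift_idx liftH_def)
      moreover have "image_ok K e' r' h (\<rho> h) (t (arity h) (r h))"
        using h hc DMu.prems(4) * by (auto simp: n_def)
      moreover have "absfh (\<rho> h) \<subseteq> R" "absfv (\<rho> h) \<subseteq> S"
        using h hc by (auto simp: R_def S_def)
      ultimately have "lit_fhd (K k) \<subseteq> R" "lit_fv (K k) \<subseteq> S"
        using image_ok_lits[of K e' r' h "\<rho> h" "t (arity h) (r h)" k] by blast+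
      with c' xs' show ?thesis by auto
    qed
  qed
  have 3: "map (tsub s) ts = map (tsub (\<lambda>y. TV (e' y))) (map (tsub \<theta>) us)"
    unfolding *(4) by (rule map_tsub_env[where V = "fv A"]) (use DMu.prems(3) in simp, simp add: *)
  have "subst \<theta> \<rho> A = Mu c' xs' (subst (updl \<theta> xs (map TV xs')) \<rho>' D) (map (tsub \<theta>) us)"
    by (simp only: * subst.simps Let_def n_def S_def xs'_def R_def c'_def \<rho>'_def)
  with 1 2 3 * xs' show ?case by (simp add: n_def)
next
  case (DLit k ts)
  then obtain c xs D us where *: "A = Mu c xs D us" "K k = (c, xs, D)" "length us = length xs"
    "ts = map (tsub (\<lambda>y. TV (e y))) us" by auto
  have "subst \<theta> \<rho> A = Mu c xs D (map (tsub \<theta>) us)"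
    unfolding *(1) by (rule subst_mu_lit) (use DLit.prems * in auto)
  moreover have "map (tsub s) ts = map (tsub (\<lambda>y. TV (e' y))) (map (tsub \<theta>) us)"
    unfolding *(4) by (rule map_tsub_env[where V = "fv A"]) (use DLit.prems(3) in simp, simp add: *)
  ultimately show ?case using * by simp
qed

lemma matches_substT:
  assumes "matches K e r A d" "\<forall>y\<in>fv A. tsub (\<lambda>y. TV (e' y)) (\<theta> y) = s (e y)"
    and "\<forall>k\<in>lits d. \<forall>y\<in>lit_fv (K k). \<theta> y = TV y"
  shows "matches K e' r (substT \<theta> A) (dsubT s d)"
proof -
  have "matches K e' r (subst \<theta> (\<lambda>_. None) A) (dsubst s head_id d)"
    by (rule matches_subst_aux[where e = e and r = r]) (use assms in auto)
  then show ?thesis by (simp add: substT_subst dsubst_head_id)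
qed

lemma matches_subst:
  assumes "matches K e r A d"
    and "\<forall>y\<in>fv A. tsub (\<lambda>y. TV (e' y)) (\<theta> y) = s (e y)"
    and "\<forall>h\<in>fhd A. image_ok K e' r' h (\<rho> h) (t (arity h) (r h))"
    and "\<forall>k\<in>lits d. (\<forall>y\<in>lit_fv (K k). \<theta> y = TV y) \<and> (\<forall>h\<in>lit_fhd (K k). \<rho> h = None)"
  shows "matches K e' r' (subst \<theta> \<rho> A) (dsubst s t d)"
  by (rule matches_subst_aux[OF _ assms]) (use matches_substT in blast)

subsection \<open>Polarity and well-formedness\<close>

fun arity_ok :: "ty \<Rightarrow> bool" where
  "arity_ok Bot = True"
| "arity_ok (At h ts) = (length ts = arity h)"
| "arity_ok (Imp A B) = (arity_ok A \<and> arity_ok B)"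
| "arity_ok (AllV x A) = arity_ok A"
| "arity_ok (AllP X n A) = arity_ok A"
| "arity_ok (Mu c xs D ts) = (arity_ok D \<and> length ts = length xs)"

text \<open>Kept separate from \<open>arity_ok\<close>: the rule for equations can derive types whose \<open>\<mu>\<close> binds repeated variables, because
substitution may rename such a list to a distinct one.\<close>

fun dist_mu :: "ty \<Rightarrow> bool" where
  "dist_mu Bot = True"
| "dist_mu (At h ts) = True"
| "dist_mu (Imp A B) = (dist_mu A \<and> dist_mu B)"
| "dist_mu (AllV x A) = dist_mu A"
| "dist_mu (AllP X n A) = dist_mu A"
| "dist_mu (Mu c xs D ts) = (dist_mu D \<and> distinct xs)"

fun to_db :: "(nat \<Rightarrow> nat) \<Rightarrow> (head \<Rightarrow> nat) \<Rightarrow> ty \<Rightarrow> dty" where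
  "to_db e r Bot = DBot"
| "to_db e r (At h us) = DAt (r h) (map (tsub (\<lambda>y. TV (e y))) us)"
| "to_db e r (Imp A B) = DImp (to_db e r A) (to_db e r B)"
| "to_db e r (AllV x A) = DAll (to_db (up_env [x] e) r A)"
| "to_db e r (AllP X n A) = DAllP n (to_db e (up_head (PV X n) r) A)"
| "to_db e r (Mu c xs D us) =
     DMu (to_db (up_env xs e) (up_head (PS c (length xs)) r) D) (map (tsub (\<lambda>y. TV (e y))) us)"

lemma lits_to_db [simp]: "lits (to_db e r A) = {}"
  by (induction A arbitrary: e r) auto

lemma matches_to_db: "arity_ok A \<Longrightarrow> matches K e r A (to_db e r A)"
  by (induction A arbitrary: e r) auto

lemma matches_to_dbD: "matches K e r A d \<Longrightarrow> lits d = {} \<Longrightarrow> d = to_db e r A \<and> arity_ok A"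
proof (induction d arbitrary: A e r)
  case (DImp a b)
  then obtain B C where *: "A = Imp B C" "matches K e r B a" "matches K e r C b" by auto
  with DImp.IH(1)[OF *(2)] DImp.IH(2)[OF *(3)] DImp.prems show ?case by simp
next
  case (DAll d)
  then obtain x B where *: "A = AllV x B" "matches K (up_env [x] e) r B d" by auto
  with DAll.IH[OF *(2)] DAll.prems show ?case by simp
next
  case (DAllP n d)
  then obtain X B where *: "A = AllP X n B" "matches K e (up_head (PV X n) r) B d" by auto
  with DAllP.IH[OF *(2)] DAllP.prems show ?case by simp
next
  case (DMu d ts)
  then obtain c xs D us where *: "A = Mu c xs D us" "matches K (up_env xs e) (up_head (PS c (length xs)) r) D d"
    "length us = length xs" "ts = map (tsub (\<lambda>y. TV (e y))) us" by auto
  with DMu.IH[OF *(2)] DMu.prems show ?case by simp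
qed auto

lemma finite_dfv [simp]: "finite (dfv d)"
proof (induction d)
  have *: "finite {i. i + n \<in> D}" if "finite D" for D :: "nat set" and n
    using finite_vimageI[OF that, of "\<lambda>i. i + n"] by (simp add: vimage_def)
  { case (DAll d) then show ?case using *[of "dfv d" 1] by simp }
  { case (DMu d ts) then show ?case using *[of "dfv d"] by simp }
qed auto

lemma finite_dfhd [simp]: "finite (dfhd d)"
proof (induction d)
  have *: "finite {(m, i). (m, shift_idx n m i) \<in> D}" if "finite D" for D :: "(nat \<times> nat) set" and n
    using finite_vimageI[OF that, of "\<lambda>(m, i). (m, shift_idx n m i)"]
    by (auto simp: vimage_def inj_on_def case_prod_unfold)
  { case (DAllP n d) then show ?case by (simp add: *) }
  { case (DMu d ts) then show ?case by (simp add: *) }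
qed auto

lemma finite_lits [simp]: "finite (lits d)"
  by (induction d) auto

text \<open>With \<open>b\<close> true this is the de Bruijn form of \<open>nonneg\<close>, with
  \<open>b\<close> false that of \<open>nonpos\<close>.\<close>

primrec polar :: "bool \<Rightarrow> nat \<Rightarrow> nat \<Rightarrow> dty \<Rightarrow> bool" where
  "polar b n i DBot = True"
| "polar b n i (DAt j ts) = (b \<or> length ts \<noteq> n \<or> j \<noteq> i)"
| "polar b n i (DImp a c) = (polar (\<not> b) n i a \<and> polar b n i c)"
| "polar b n i (DAll a) = polar b n i a"
| "polar b n i (DAllP m a) = polar b n (shift_idx m n i) a"
| "polar b n i (DMu a ts) = polar b n (shift_idx (length ts) n i) a"
| "polar b n i (DLit k ts) = True"

primrec wfd :: "dty \<Rightarrow> bool" where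
  "wfd DBot = True"
| "wfd (DAt j ts) = True"
| "wfd (DImp a c) = (wfd a \<and> wfd c)"
| "wfd (DAll a) = wfd a"
| "wfd (DAllP m a) = wfd a"
| "wfd (DMu a ts) = (wfd a \<and> polar True (length ts) 0 a \<and> (length ts, 0) \<in> dfhd a)"
| "wfd (DLit k ts) = True"

lemma polar_notin: "(n, i) \<notin> dfhd d \<Longrightarrow> polar b n i d"
  by (induction d arbitrary: n i b) auto

lemma dfhd_dsubT [simp]: "dfhd (dsubT s d) = dfhd d"
  by (induction d arbitrary: s) auto

lemma polar_dsubT [simp]: "polar b n i (dsubT s d) = polar b n i d"
  by (induction d arbitrary: s b i) auto

lemma wfd_dsubT [simp]: "wfd (dsubT s d) = wfd d"
  by (induction d arbitrary: s) auto

lemma dfhd_hren: "dfhd (hren f d) = (\<lambda>(n, i). (n, f n i)) ` dfhd d"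
proof (induction d arbitrary: f)
  have *: "{(m, i). (m, shift_idx n m i) \<in> (\<lambda>(m, i). (m, up_ren n f m i)) ` D}
     = (\<lambda>(m, i). (m, f m i)) ` {(m, i). (m, shift_idx n m i) \<in> D}" for D f n
  proof -
    have "shift_idx n m i = up_ren n f m j \<Longrightarrow> \<exists>j'. j = shift_idx n m j' \<and> i = f m j'" for m i j
      by (auto simp: shift_idx_def up_ren_def split: if_splits nat.splits)
    then have "(m, i) \<in> {(m, i). (m, shift_idx n m i) \<in> (\<lambda>(m, i). (m, up_ren n f m i)) ` D} \<longleftrightarrow>
      (\<exists>j. i = f m j \<and> (m, shift_idx n m j) \<in> D)" for m i
      by (force simp: up_ren_shift_idx[symmetric] image_iff)
    then show ?thesis by auto
  qed
  { case (DAllP n d) then show ?case by (simp add: *) }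
  { case (DMu d ts) then show ?case by (simp add: *) }
qed auto

lemma dfhd_head_id [simp]: "dfhd (head_id n i) = {(n, i)}"
  by (simp add: head_id_def)

lemma wfd_head_id [simp]: "wfd (head_id n i)"
  by (simp add: head_id_def)

lemma polar_head_id [simp]: "polar True m j (head_id n i)"
  by (simp add: head_id_def)

lemma up_ren_inj: "(\<And>m i j. f m i = f m j \<longleftrightarrow> i = j) \<Longrightarrow> up_ren n f m i = up_ren n f m j \<longleftrightarrow> i = j"
  by (auto simp: up_ren_def split: nat.splits)

lemma polar_hren: "(\<And>m i j. f m i = f m j \<longleftrightarrow> i = j) \<Longrightarrow> polar b m (f m j) (hren f d) = polar b m j d"
proof (induction d arbitrary: f b j)
  case (DAllP n d)
  from DAllP.IH[of "up_ren n f" b "shift_idx n m j"] show ?case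
    using DAllP.prems up_ren_inj[of f] by (simp add: up_ren_shift_idx)
next
  case (DMu d ts)
  from DMu.IH[of "up_ren (length ts) f" b "shift_idx (length ts) m j"] show ?case
    using DMu.prems up_ren_inj[of f] by (simp add: up_ren_shift_idx)
qed auto

lemma dfhd_hren_iff:
  assumes "\<And>m i j. f m i = f m j \<longleftrightarrow> i = j"
  shows "(m, f m j) \<in> dfhd (hren f d) \<longleftrightarrow> (m, j) \<in> dfhd d"
proof
  assume "(m, f m j) \<in> dfhd (hren f d)"
  with assms show "(m, j) \<in> dfhd d" by (auto simp: dfhd_hren)
next
  assume "(m, j) \<in> dfhd d"
  then show "(m, f m j) \<in> dfhd (hren f d)" unfolding dfhd_hren by (rule rev_image_eqI) simp
qed

lemma up_ren_0: "up_ren n f n 0 = 0"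
  by (simp add: up_ren_def)

lemma wfd_hren: "(\<And>m i j. f m i = f m j \<longleftrightarrow> i = j) \<Longrightarrow> wfd (hren f d) = wfd d"
proof (induction d arbitrary: f)
  case (DAllP n d)
  then show ?case using up_ren_inj[of f] by simp
next
  case (DMu d ts)
  let ?n = "length ts"
  have inj: "up_ren ?n f m i = up_ren ?n f m j \<longleftrightarrow> i = j" for m i j
    by (rule up_ren_inj) (use DMu.prems in simp)
  have "polar True ?n (up_ren ?n f ?n 0) (hren (up_ren ?n f) d) = polar True ?n 0 d"
    by (rule polar_hren) (rule inj)
  moreover have "(?n, 0) \<in> dfhd (hren (up_ren ?n f) d) \<longleftrightarrow> (?n, 0) \<in> dfhd d"
    using dfhd_hren_iff[of "up_ren ?n f" ?n 0 d] inj by (simp add: up_ren_0)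
  ultimately show ?case using DMu.IH[of "up_ren ?n f"] inj by (simp add: up_ren_0)
qed auto

lemma polar_shift_head [simp]: "polar b m (shift_idx n m j) (shift_head n d) = polar b m j d"
  by (rule polar_hren) simp

lemma wfd_shift_head [simp]: "wfd (shift_head n d) = wfd d"
  by (rule wfd_hren) simp

lemma dfhd_shift_head: "(m, shift_idx n m j) \<in> dfhd (shift_head n d) \<longleftrightarrow> (m, j) \<in> dfhd d"
  by (rule dfhd_hren_iff) simp

lemma dfhd_shift_head_0: "(n, 0) \<notin> dfhd (shift_head n d)"
  by (auto simp: dfhd_hren)

lemma dfhd_lift_abs [simp]: "dfhd (lift_abs k m d) = dfhd d"
  and polar_lift_abs [simp]: "polar b n i (lift_abs k m d) = polar b n i d"
  and wfd_lift_abs [simp]: "wfd (lift_abs k m d) = wfd d"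
  by (simp_all add: lift_abs_def)

lemma upH_0: "upH n t n 0 = head_id n 0"
  by (simp add: upH_def)

lemma dfhd_dsubst: "dfhd (dsubst s t d) = (\<Union>(n, i)\<in>dfhd d. dfhd (t n i))"
proof (induction d arbitrary: s t)
  have *: "{(m, j). (m, shift_idx k m j) \<in> (\<Union>(n, i)\<in>D. dfhd (upH k t n i))}
     = (\<Union>(n, i)\<in>{(n, i). (n, shift_idx k n i) \<in> D}. dfhd (t n i))" (is "?L = ?R") for D k t
  proof (intro equalityI subsetI)
    fix x assume "x \<in> ?L"
    then obtain m j n i where x: "x = (m, j)" "(n, i) \<in> D" "(m, shift_idx k m j) \<in> dfhd (upH k t n i)" by auto
    show "x \<in> ?R"
    proof (cases rule: shift_idx_cases[of n k i])
      case 1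
      with x show ?thesis by (auto simp: upH_0 shift_idx_def split: if_splits)
    next
      case (2 i')
      with x show ?thesis by (auto simp: upH_shift_idx dfhd_shift_head)
    qed
  next
    fix x assume "x \<in> ?R"
    then obtain m j n i where x: "x = (m, j)" "(n, shift_idx k n i) \<in> D" "(m, j) \<in> dfhd (t n i)"
      by (cases x) auto
    then have "(m, shift_idx k m j) \<in> dfhd (upH k t n (shift_idx k n i))" by (simp add: upH_shift_idx dfhd_shift_head)
    with x show "x \<in> ?L" by blast
  qed
  { case (DAllP n d) show ?case by (simp only: dsubst.simps dfhd.simps DAllP.IH *) }
  { case (DMu d ts) show ?case by (simp only: dsubst.simps dfhd.simps DMu.IH * liftH_def dfhd_lift_abs length_map) }
  { case (DAll d) then show ?case by (simp add: liftH_def) }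
qed auto

text \<open>The rule of signs: the sign of an occurrence of \<open>(m, j)\<close> in a substituted
  type is its sign in the image \<open>F\<close> times the sign in \<open>d\<close> of the head that
  \<open>F\<close> replaces.\<close>

definition polar_ok_at :: "bool \<Rightarrow> nat \<Rightarrow> nat \<Rightarrow> nat \<Rightarrow> nat \<Rightarrow> dty \<Rightarrow> dty \<Rightarrow> bool" where
  "polar_ok_at b m j n i F d \<longleftrightarrow> (m, j) \<notin> dfhd F \<or>
     (polar True m j F \<and> polar b n i d) \<or> (polar False m j F \<and> polar (\<not> b) n i d)"

definition polar_ok :: "bool \<Rightarrow> nat \<Rightarrow> nat \<Rightarrow> (nat \<Rightarrow> nat \<Rightarrow> dty) \<Rightarrow> dty \<Rightarrow> bool" where
  "polar_ok b m j t d \<longleftrightarrow> (\<forall>n i. (n, i) \<in> dfhd d \<longrightarrow> polar_ok_at b m j n i (t n i) d)"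

lemma polar_okI: "(\<And>n i. (n, i) \<in> dfhd d \<Longrightarrow> polar_ok_at b m j n i (t n i) d) \<Longrightarrow> polar_ok b m j t d"
  by (simp add: polar_ok_def)

lemma polar_ok_upH:
  assumes "\<And>n i. (n, shift_idx k n i) \<in> dfhd d \<Longrightarrow> polar_ok_at b m j n (shift_idx k n i) (t n i) d"
  shows "polar_ok b m (shift_idx k m j) (upH k t) d"
proof (rule polar_okI)
  fix n i assume ni: "(n, i) \<in> dfhd d"
  show "polar_ok_at b m (shift_idx k m j) n i (upH k t n i) d"
  proof (cases rule: shift_idx_cases[of n k i])
    case 1
    then show ?thesis by (auto simp: polar_ok_at_def upH_0 shift_idx_def)
  next
    case (2 i')
    with ni assms[of n i'] show ?thesis by (simp add: polar_ok_at_def upH_shift_idx dfhd_shift_head)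
  qed
qed

lemma polar_dsubst: "polar_ok b m j t d \<Longrightarrow> polar b m j (dsubst s t d)"
proof (induction d arbitrary: b j s t)
  case (DAt i ts)
  then show ?case using polar_notin[of m j "t (length ts) i" b] by (cases b) (auto simp: polar_ok_def polar_ok_at_def)
next
  case (DImp a c)
  have "polar_ok (\<not> b) m j t a" "polar_ok b m j t c"
    using DImp.prems by (auto simp: polar_ok_def polar_ok_at_def)
  with DImp.IH show ?case by simp
next
  case (DAll d)
  then have "polar_ok b m j (liftH 1 t) d" by (simp add: polar_ok_def polar_ok_at_def liftH_def)
  with DAll.IH show ?case by simp
next
  case (DAllP k d)
  have "polar_ok b m (shift_idx k m j) (upH k t) d"
    by (rule polar_ok_upH) (use DAllP.prems in \<open>auto simp: polar_ok_def polar_ok_at_def\<close>)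
  with DAllP.IH show ?case by simp
next
  case (DMu d ts)
  have "polar_ok b m (shift_idx (length ts) m j) (upH (length ts) (liftH (length ts) t)) d"
    by (rule polar_ok_upH) (use DMu.prems in \<open>auto simp: polar_ok_def polar_ok_at_def liftH_def\<close>)
  with DMu.IH show ?case by simp
qed auto

lemma wfd_upH: "(\<And>i. (m, shift_idx n m i) \<in> D \<Longrightarrow> wfd (t m i)) \<Longrightarrow> (m, i) \<in> D \<Longrightarrow> wfd (upH n t m i)"
  by (cases rule: shift_idx_cases[of m n i]) (auto simp: upH_0 upH_shift_idx)

text \<open>Images taken under a fixed point are shifted and cannot contain its bound head, so the
  occurrence and the positivity of that head carry over from the original body.\<close>

lemma wfd_dsubst: "wfd d \<Longrightarrow> (\<And>n i. (n, i) \<in> dfhd d \<Longrightarrow> wfd (t n i)) \<Longrightarrow> wfd (dsubst s t d)"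
proof (induction d arbitrary: s t)
  case (DImp a b)
  then show ?case by simp
next
  case (DAll d)
  then show ?case by (simp add: liftH_def)
next
  case (DAllP n d)
  have "wfd (dsubst s (upH n t) d)"
    by (rule DAllP.IH) (use DAllP.prems in \<open>auto intro: wfd_upH[where D = "dfhd d"]\<close>)
  then show ?case by simp
next
  case (DMu d ts)
  let ?n = "length ts" let ?t = "upH ?n (liftH ?n t)"
  have "wfd (dsubst (upT ?n s) ?t d)"
    by (rule DMu.IH) (use DMu.prems in \<open>auto intro!: wfd_upH[where D = "dfhd d"] simp: liftH_def\<close>)
  moreover have "polar_ok True ?n 0 ?t d"
  proof (rule polar_okI)
    fix m i assume "(m, i) \<in> dfhd d"
    show "polar_ok_at True ?n 0 m i (?t m i) d"
      by (cases rule: shift_idx_cases[of m ?n i])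
        (use DMu.prems in \<open>auto simp: polar_ok_at_def upH_0 upH_shift_idx dfhd_shift_head_0\<close>)
  qed
  moreover have "(?n, 0) \<in> dfhd (?t ?n 0)" by (simp add: upH_0)
  ultimately show ?case using DMu.prems by (auto simp: polar_dsubst dfhd_dsubst)
qed auto

text \<open>The last premise keeps other heads of the same arity from sharing the index of
  \<open>h\<close>. Under a binder of \<open>h\<close> itself the shifted outer index is the index
  of no named head, so it does not occur and both polarities hold.\<close>

lemma matches_polar:
  assumes "matches K e r A d" "\<forall>k\<in>lits d. h \<notin> lit_fhd (K k)"
    "\<forall>g. arity g = arity h \<longrightarrow> r g = r h \<longrightarrow> g = h"
  shows "polar b (arity h) (r h) d \<longleftrightarrow> (if b then nonneg h A else nonpos h A)"
  using assms
proof (induction d arbitrary: A e r b)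
  have *: "polar b (arity h) (shift_idx (arity g) (arity h) (r h)) d \<longleftrightarrow>
      (if b then h = g \<or> nonneg h B else h = g \<or> nonpos h B)"
    if IH: "\<forall>g'. arity g' = arity h \<longrightarrow> up_head g r g' = up_head g r h \<longrightarrow> g' = h \<Longrightarrow>
           polar b (arity h) (up_head g r h) d = (if b then nonneg h B else nonpos h B)"
      and B: "matches K e (up_head g r) B d" "\<forall>k\<in>lits d. h \<notin> lit_fhd (K k)"
      "\<forall>g. arity g = arity h \<longrightarrow> r g = r h \<longrightarrow> g = h" for b e r g B d
  proof (cases "h = g")
    case True
    have "(arity h, shift_idx (arity g) (arity h) (r h)) \<notin> dfhd d"
    proof
      assume "(arity h, shift_idx (arity g) (arity h) (r h)) \<in> dfhd d"
      from matches_fh2[OF B(1) this] obtain h' where "arity h' = arity h"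
        "up_head g r h' = shift_idx (arity g) (arity h) (r h)" by auto
      with True B(3) show False by (auto simp: up_head_def split: if_splits)
    qed
    with True show ?thesis by (simp add: polar_notin)
  next
    case False
    have "\<forall>g'. arity g' = arity h \<longrightarrow> up_head g r g' = up_head g r h \<longrightarrow> g' = h"
      using B(3) False by (auto simp: up_head_def shift_idx_def)
    from IH[OF this] False show ?thesis by (simp add: up_head_simps)
  qed
  { case (DAllP n d)
    then obtain X B where B: "A = AllP X n B" "matches K e (up_head (PV X n) r) B d"
      "\<forall>k\<in>lits d. h \<notin> lit_fhd (K k)" by auto
    from *[OF DAllP.IH[OF B(2,3)] B(2,3)] B DAllP.prems show ?case by simp }
  { case (DMu d ts)
    then obtain c xs D us where B: "A = Mu c xs D us" "matches K (up_env xs e) (up_head (PS c (length xs)) r) D d"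
      "\<forall>k\<in>lits d. h \<notin> lit_fhd (K k)" "length ts = length xs" by auto
    from *[OF DMu.IH[OF B(2,3)] B(2,3)] B DMu.prems show ?case by simp }
  { case (DAt i ts) then show ?case by auto }
  { case (DImp a c)
    then obtain B C where *: "A = Imp B C" "matches K e r B a" "matches K e r C c" by auto
    with DImp.IH(1)[OF *(2), of "\<not> b"] DImp.IH(2)[OF *(3), of b] DImp.prems show ?case by auto }
  { case (DAll d)
    then obtain x B where *: "A = AllV x B" "matches K (up_env [x] e) r B d" by auto
    with DAll.IH[OF *(2), of b] DAll.prems show ?case by auto }
  { case (DLit k ts)
    then obtain c xs D us where *: "A = Mu c xs D us" "K k = (c, xs, D)" by auto
    have notin: "h \<notin> fhd D \<Longrightarrow> nonneg h D \<and> nonpos h D" for D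
      by (induction D) auto
    from * notin[of D] DLit show ?case by auto }
qed auto

fun lit_wf :: "lit \<Rightarrow> bool" where
  "lit_wf (c, xs, D) = wf_ty (Mu c xs D (map TV xs))"

lemma up_head_polar:
  assumes "matches K e (up_head g r) D d" "\<forall>k\<in>lits d. g \<notin> lit_fhd (K k)"
  shows "polar True (arity g) 0 d \<longleftrightarrow> nonneg g D" "(arity g, 0) \<in> dfhd d \<longleftrightarrow> g \<in> fhd D"
proof -
  have "\<forall>g'. arity g' = arity g \<longrightarrow> up_head g r g' = up_head g r g \<longrightarrow> g' = g"
    by (auto simp: up_head_def)
  from matches_polar[OF assms this, of True] show "polar True (arity g) 0 d \<longleftrightarrow> nonneg g D"
    by (simp add: up_head_simps)
  show "(arity g, 0) \<in> dfhd d \<longleftrightarrow> g \<in> fhd D"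
  proof
    assume "(arity g, 0) \<in> dfhd d"
    from matches_fh2[OF assms(1) this] show "g \<in> fhd D" by (auto simp: up_head_def split: if_splits)
  next
    assume "g \<in> fhd D"
    from matches_fh1[OF assms(1) this] assms(2) show "(arity g, 0) \<in> dfhd d" by (auto simp: up_head_simps)
  qed
qed

lemma matches_wf: "matches K e r A d \<Longrightarrow> dist_mu A \<Longrightarrow> wfd d \<Longrightarrow> \<forall>k\<in>lits d. lit_wf (K k) \<Longrightarrow> wf_ty A"
proof (induction d arbitrary: A e r)
  case (DMu d ts)
  then obtain c xs D us where *: "A = Mu c xs D us" "matches K (up_env xs e) (up_head (PS c (length xs)) r) D d"
    "length us = length xs" "length ts = length xs" "\<forall>k\<in>lits d. PS c (length xs) \<notin> lit_fhd (K k)" by auto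
  with up_head_polar[OF *(2,5)] DMu.prems DMu.IH[OF *(2)] show ?case by simp
qed auto

text \<open>Positivity and occurrence of the bound symbol survive the translation, but repetitions
  among bound variables become invisible; hence the conjunct \<open>dist_mu\<close>.\<close>

lemma wf_to_db: "wf_ty A \<longleftrightarrow> arity_ok A \<and> dist_mu A \<and> wfd (to_db e r A)"
proof
  assume "wf_ty A"
  then have ad: "arity_ok A \<and> dist_mu A" by (induction A) auto
  with \<open>wf_ty A\<close> have "wfd (to_db e r A)"
  proof (induction A arbitrary: e r)
    case (Mu c xs D ts)
    then have "matches (\<lambda>_. undefined) (up_env xs e) (up_head (PS c (length xs)) r) D
        (to_db (up_env xs e) (up_head (PS c (length xs)) r) D)" by (intro matches_to_db) auto
    from up_head_polar[OF this] Mu show ?case by simp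
  qed auto
  with ad show "arity_ok A \<and> dist_mu A \<and> wfd (to_db e r A)" by simp
next
  assume "arity_ok A \<and> dist_mu A \<and> wfd (to_db e r A)"
  with matches_wf[OF matches_to_db[where A = A and e = e and r = r]] show "wf_ty A" by simp
qed

lemma dist_mu_substT: "dist_mu A \<Longrightarrow> dist_mu (substT \<theta> A)"
  by (induction A arbitrary: \<theta>) (auto simp: Let_def fresh_list_props(3))

lemma dist_mu_subst: "dist_mu A \<Longrightarrow> (\<And>h ys F. \<rho> h = Some (ys, F) \<Longrightarrow> dist_mu F) \<Longrightarrow> dist_mu (subst \<theta> \<rho> A)"
proof (induction A arbitrary: \<theta> \<rho>)
  case (At h ts)
  then show ?case by (auto split: option.splits intro: dist_mu_substT)
next
  case (AllV x A)
  then show ?case by (simp add: Let_def)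
next
  case (AllP X n A)
  show ?case unfolding subst.simps Let_def dist_mu.simps
    by (rule AllP.IH) (use AllP.prems in \<open>auto split: if_splits\<close>)
next
  case (Mu c xs D ts)
  show ?case unfolding subst.simps Let_def dist_mu.simps
    by (intro conjI Mu.IH) (use Mu.prems in \<open>auto split: if_splits simp: fresh_list_props(3)\<close>)
qed auto

subsection \<open>Alpha-equivalent types are mutual subtypes\<close>

primrec dsize :: "dty \<Rightarrow> nat" where
  "dsize DBot = 1"
| "dsize (DAt i ts) = 1"
| "dsize (DImp a b) = dsize a + dsize b + 1"
| "dsize (DAll a) = dsize a + 1"
| "dsize (DAllP n a) = dsize a + 1"
| "dsize (DMu a ts) = dsize a + 1"
| "dsize (DLit k ts) = 1"

lemma dsize_dsubT [simp]: "dsize (dsubT s d) = dsize d"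
  by (induction d arbitrary: s) auto

lemma dsize_hren [simp]: "dsize (hren f d) = dsize d"
  by (induction d arbitrary: f) auto

lemma dsize_dsubst: "(\<And>n i. dsize (t n i) = 1) \<Longrightarrow> dsize (dsubst s t d) = dsize d"
  by (induction d arbitrary: s t) (auto simp: liftH_def lift_abs_def upH_def head_id_def split: nat.split)

definition hcons :: "nat \<Rightarrow> dty \<Rightarrow> nat \<Rightarrow> nat \<Rightarrow> dty" where
  "hcons n F m i = (if m = n then (case i of 0 \<Rightarrow> F | Suc j \<Rightarrow> head_id n j) else head_id m i)"

lemma hcons_0 [simp]: "hcons n F n 0 = F"
  by (simp add: hcons_def)

lemma hcons_shift_idx [simp]: "hcons n F m (shift_idx n m i) = head_id m i"
  by (auto simp: hcons_def shift_idx_def)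

lemma hcons_cases: "hcons n F m i = F \<or> (\<exists>j. hcons n F m i = head_id m j)"
  by (auto simp: hcons_def split: nat.split)

lemma map_pos_distinct: "distinct xs \<Longrightarrow> map (pos xs) xs = [0..<length xs]"
  by (rule nth_equalityI) (auto simp: pos_nth)

lemma matches_atom_params:
  "arity h = n \<Longrightarrow> matches K (up_env [0..<n] e) r (At h (map TV [0..<n])) (head_id n (r h))"
  using pos_nth[of "[0..<n]"] by (auto simp: head_id_def up_env_def)

abbreviation gmatches :: "(nat \<Rightarrow> lit) \<Rightarrow> ty \<Rightarrow> dty \<Rightarrow> bool" where
  "gmatches K \<equiv> matches K (\<lambda>y. y) head_idx"

lemma gmatches_fv: "gmatches K A d \<Longrightarrow> gmatches K B d \<Longrightarrow> y \<in> fv A \<Longrightarrow> y \<in> fv B \<or> (\<exists>k\<in>lits d. y \<in> lit_fv (K k))"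
  using matches_fv1[of K "\<lambda>y. y" head_idx A d y] matches_fv2[of K "\<lambda>y. y" head_idx B d y] by auto

lemma gmatches_fhd: "gmatches K A d \<Longrightarrow> gmatches K B d \<Longrightarrow> h \<in> fhd A \<Longrightarrow> h \<in> fhd B \<or> (\<exists>k\<in>lits d. h \<in> lit_fhd (K k))"
  using matches_fh1[of K "\<lambda>y. y" head_idx A d h] matches_fh2[of K "\<lambda>y. y" head_idx B d "arity h" "head_idx h"]
  by (metis idx_head_head_idx)

lemma gmatches_inst_var:
  assumes "matches K (up_env [x] (\<lambda>y. y)) head_idx A d" "\<forall>k\<in>lits d. x \<notin> lit_fv (K k)"
  shows "gmatches K (substT (TV(x := u)) A) (dsubT (consl [u] TV) d)"
  by (rule matches_substT[OF assms(1)]) (use assms in \<open>auto simp: consl_up_env\<close>)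

lemma gmatches_inst_pred:
  assumes "matches K (\<lambda>y. y) (up_head (PV X n) head_idx) A d" "\<forall>k\<in>lits d. PV X n \<notin> lit_fhd (K k)"
    and "length ys = n" "matches K (up_env ys (\<lambda>y. y)) head_idx F G" "lits G = {}"
  shows "gmatches K (subst TV ((\<lambda>_. None)(PV X n := Some (ys, F))) A) (dsubst TV (hcons n G) d)"
  by (rule matches_subst[OF assms(1)]) (use assms in \<open>auto simp: up_head_def\<close>)

text \<open>In the case of \<open>\<mu>\<close>, the induction rule for \<open>\<mu>\<close> leads to the unfoldings of both sides, which are larger than the types
themselves. Unfolding both bodies with the same literal copy of the right-hand fixed point, seen as an opaque
constant, keeps the size of the de Bruijn type unchanged.\<close>

lemma alpha_subty:
  "gmatches K A d \<Longrightarrow> gmatches K B d \<Longrightarrow> dist_mu A \<Longrightarrow> dist_mu B \<Longrightarrow> wfd d \<Longrightarrow> \<forall>k\<in>lits d. lit_wf (K k) \<Longrightarrow> subty E A B"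
proof (induction "dsize d" arbitrary: K A B d rule: less_induct)
  case less
  have wfA: "wf_ty A" and wfB: "wf_ty B"
    using matches_wf less.prems by blast+
  show ?case
  proof (cases d)
    case DBot
    with less.prems show ?thesis by (auto intro: subty.refl)
  next
    case (DAt i ts)
    with less.prems obtain h us h' us' where *: "A = At h us" "B = At h' us'" "head_idx h = head_idx h'"
      "us = us'" "length us = arity h" "length us' = arity h'" by auto
    have "h = h'" using * idx_head_head_idx[of h] idx_head_head_idx[of h'] by metis
    with * wfA show ?thesis by (auto intro: subty.refl)
  next
    case (DLit k ts)
    with less.prems have "A = B" by auto
    then show ?thesis using subty.refl[OF wfA] by simp
  next
    case (DImp a b)
    with less.prems obtain A1 A2 B1 B2 where *: "A = Imp A1 A2" "B = Imp B1 B2"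
      "gmatches K A1 a" "gmatches K A2 b" "gmatches K B1 a" "gmatches K B2 b" by auto
    have "subty E B1 A1" by (rule less.hyps[of a K]) (use * DImp less.prems in auto)
    moreover have "subty E A2 B2" by (rule less.hyps[of b K]) (use * DImp less.prems in auto)
    ultimately show ?thesis using * by (auto intro: subty.arr)
  next
    case (DAll a)
    with less.prems obtain x A' y B' where *: "A = AllV x A'" "B = AllV y B'"
      "matches K (up_env [x] (\<lambda>y. y)) head_idx A' a" "matches K (up_env [y] (\<lambda>y. y)) head_idx B' a"
      "\<forall>k\<in>lits a. x \<notin> lit_fv (K k)" "\<forall>k\<in>lits a. y \<notin> lit_fv (K k)" by auto
    \<comment> \<open>The bound name \<open>y\<close> of the right-hand side is used as the instance
      on the left, so that both bodies match the same de Bruijn type. Since \<open>y\<close> is not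
      free in \<open>A\<close>, it may then be generalised.\<close>
    let ?a = "dsubT (consl [TV y] TV) a"
    have "gmatches K (substT (TV(x := TV y)) A') ?a" by (rule gmatches_inst_var[OF *(3,5)])
    moreover have "gmatches K B' ?a"
    proof -
      have "gmatches K (substT (TV(y := TV y)) B') ?a" by (rule gmatches_inst_var[OF *(4,6)])
      then show ?thesis by (simp add: substT_subst subst_id)
    qed
    ultimately have "subty E (substT (TV(x := TV y)) A') B'"
      by (rule less.hyps[rotated]) (use * DAll less.prems in \<open>auto intro: dist_mu_substT\<close>)
    then have "subty E A B'" unfolding *(1) by (rule subty.allV_l) (use wfA * in simp)
    moreover have "y \<notin> fv A"
    proof
      assume "y \<in> fv A"
      from gmatches_fv[OF less.prems(1,2) this] * DAll show False by auto
    qed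
    ultimately show ?thesis unfolding *(2) by (rule subty.allV_r)
  next
    case (DAllP n a)
    with less.prems obtain X A' Y B' where *: "A = AllP X n A'" "B = AllP Y n B'"
      "matches K (\<lambda>y. y) (up_head (PV X n) head_idx) A' a" "matches K (\<lambda>y. y) (up_head (PV Y n) head_idx) B' a"
      "\<forall>k\<in>lits a. PV X n \<notin> lit_fhd (K k)" "\<forall>k\<in>lits a. PV Y n \<notin> lit_fhd (K k)" by auto
    let ?F = "At (PV Y n) (map TV [0..<n])" let ?G = "head_id n (head_idx (PV Y n))"
    let ?a = "dsubst TV (hcons n ?G) a"
    let ?A = "subst TV ((\<lambda>_. None)(PV X n := Some ([0..<n], ?F))) A'"
    have "gmatches K ?A ?a"
      by (rule gmatches_inst_pred[OF *(3,5)]) (use matches_atom_params[of "PV Y n" n K "\<lambda>y. y" head_idx] in \<open>auto simp del: matches.simps\<close>)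
    moreover have "gmatches K B' ?a"
      by (rule matches_env[OF *(4)]) (auto simp: up_head_def)
    moreover have "dist_mu ?A" using * less.prems by (auto intro!: dist_mu_subst split: if_splits)
    moreover have "dsize ?a = dsize a"
      using hcons_cases[of n ?G] by (intro dsize_dsubst) (metis dsize.simps(2) head_id_def)
    moreover have "wfd ?a" 
      using hcons_cases[of n ?G] less.prems DAllP by (intro wfd_dsubst) (simp, metis wfd_head_id)
    moreover have "\<forall>k\<in>lits ?a. lit_wf (K k)"
      using less.prems DAllP hcons_cases[of n ?G] by (auto simp: lits_dsubst) (metis empty_iff lits_head_id)
    ultimately have "subty E ?A B'"
      by (intro less.hyps[of ?a K]) (use * DAllP less.prems in auto)
    then have "subty E A B'" unfolding *(1) by (rule subty.allP_l) (use wfA * in auto)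
    moreover have "PV Y n \<notin> fhd A"
    proof
      assume "PV Y n \<in> fhd A"
      from gmatches_fhd[OF less.prems(1,2) this] * DAllP show False by auto
    qed
    ultimately show ?thesis unfolding *(2) by (rule subty.allP_r)
  next
    case (DMu a ts)
    let ?i = "\<lambda>y::nat. y"
    from less.prems DMu obtain c1 xs1 D1 us c2 xs2 D2 us' where
      *: "A = Mu c1 xs1 D1 us" "B = Mu c2 xs2 D2 us'" "us = ts" "us' = ts"
      "length ts = length xs1" "length ts = length xs2"
      "matches K (up_env xs1 ?i) (up_head (PS c1 (length ts)) head_idx) D1 a"
      "matches K (up_env xs2 ?i) (up_head (PS c2 (length ts)) head_idx) D2 a"
      "\<forall>k\<in>lits a. set xs1 \<inter> lit_fv (K k) = {} \<and> PS c1 (length ts) \<notin> lit_fhd (K k)"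
      "\<forall>k\<in>lits a. set xs2 \<inter> lit_fv (K k) = {} \<and> PS c2 (length ts) \<notin> lit_fhd (K k)"
      by auto
    define n where "n = length ts"
    have n: "length xs1 = n" "length xs2 = n" "length us = n" using * by (auto simp: n_def)
    have dist_mu: "distinct xs1" "distinct xs2" "dist_mu D1" "dist_mu D2" using * less.prems by auto
    \<comment> \<open>The new constant stands for the fixed point on the right; being new, it does
      not disturb the literals already in \<open>a\<close>.\<close>
    obtain k where k: "k \<notin> lits a" using ex_new_if_finite[OF _ finite_lits] by auto
    define K' where "K' = K(k := (c2, xs2, D2))"
    have K'k: "K' k = (c2, xs2, D2)" by (simp add: K'_def)
    have K'K: "K' j = K j" if "j \<in> lits a" for j using that k by (auto simp: K'_def)
    let ?L = "DLit k (map TV [0..<n])"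
    let ?M = "\<lambda>us. Mu c2 xs2 D2 us"
    let ?d = "dsubst (consl (map TV xs1) TV) (hcons n ?L) a"
    have D1: "matches K' (up_env xs1 ?i) (up_head (PS c1 n) head_idx) D1 a"
      using matches_cong[OF *(7) K'K] by (simp add: n_def)
    have D2: "matches K' (up_env xs2 ?i) (up_head (PS c2 n) head_idx) D2 a"
      using matches_cong[OF *(8) K'K] by (simp add: n_def)
    have L: "matches K' (up_env ys e) head_idx (?M (map TV ys)) ?L" if "distinct ys" "length ys = n" for ys e
    proof -
      have "map (tsub (\<lambda>y. TV (up_env ys e y))) (map TV ys) = map TV (map (pos ys) ys)"
        by (simp add: up_env_def)
      also have "\<dots> = map TV [0..<n]" using that by (simp add: map_pos_distinct)
      finally show ?thesis using that n K'k by simp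
    qed
    \<comment> \<open>The names \<open>xs1\<close> become the parameters of the invariant
      \<open>?M (map TV xs1)\<close>, so they must not be free in the fixed point itself. Such a
      name would have an index above the parameters in \<open>a\<close>, hence would be free in
      \<open>D1\<close> outside \<open>xs1\<close>, or it would be free in a literal.\<close>
    have disj: "set xs1 \<inter> (fv D2 - set xs2) = {}"
    proof (rule ccontr)
      assume "set xs1 \<inter> (fv D2 - set xs2) \<noteq> {}"
      then obtain y where y: "y \<in> set xs1" "y \<in> fv D2" "y \<notin> set xs2" by auto
      from matches_fv1[OF *(8) y(2)] show False
      proof
        assume "up_env xs2 ?i y \<in> dfv a"
        with matches_fv2[OF *(7)] obtain z where "z \<in> fv D1" "up_env xs1 ?i z = y + n"
          using y n by (auto simp: up_env_def)
        with y n pos_less[of z xs1] show False by (auto simp: up_env_def split: if_splits)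
      next
        assume "\<exists>k\<in>lits a. y \<in> lit_fv (K k)"
        with y *(9) show False by auto
      qed
    qed
    let ?A = "subst TV ((\<lambda>_. None)(PS c1 n := Some (xs1, ?M (map TV xs1)))) D1"
    have A: "gmatches K' ?A ?d"
      by (rule matches_subst[OF D1])
        (use * K'K L dist_mu n disj in \<open>auto simp: consl_up_env nth_pos pos_less up_head_def n_def[symmetric] K'k\<close>)
    let ?B1 = "subst TV ((\<lambda>_. None)(PS c2 n := Some (xs2, ?M (map TV xs2)))) D2"
    have B1: "matches K' (up_env xs2 ?i) head_idx ?B1 (dsubst TV (hcons n ?L) a)"
      by (rule matches_subst[OF D2]) (use * K'K L dist_mu n in \<open>auto simp: up_head_def n_def[symmetric] K'k\<close>)
    have lits: "lits (dsubst s (hcons n ?L) a) \<subseteq> insert k (lits a)" for s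
    proof -
      have "lits (hcons n ?L m i) \<subseteq> {k}" for m i
        using hcons_cases[of n ?L m i] by auto
      then show ?thesis by (auto simp: lits_dsubst)
    qed
    let ?B = "substT (updl TV xs2 (map TV xs1)) ?B1"
    have "gmatches K' ?B (dsubT (consl (map TV xs1) TV) (dsubst TV (hcons n ?L) a))"
    proof (rule matches_substT[OF B1])
      show "\<forall>y\<in>fv ?B1. tsub (\<lambda>y. TV y) (updl TV xs2 (map TV xs1) y) = consl (map TV xs1) TV (up_env xs2 ?i y)"
        using n by (auto simp: consl_up_env updl_pos)
      show "\<forall>j\<in>lits (dsubst TV (hcons n ?L) a). \<forall>y\<in>lit_fv (K' j). updl TV xs2 (map TV xs1) y = TV y"
      proof (intro ballI)
        fix j y assume "j \<in> lits (dsubst TV (hcons n ?L) a)" "y \<in> lit_fv (K' j)"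
        with lits[of TV] consider "j = k" | "j \<in> lits a" by blast
        then have "y \<notin> set xs2"
        proof cases
          case 1 with \<open>y \<in> lit_fv (K' j)\<close> K'k show ?thesis by simp
        next
          case 2 with \<open>y \<in> lit_fv (K' j)\<close> K'K *(10) show ?thesis by auto
        qed
        then show "updl TV xs2 (map TV xs1) y = TV y" using n by (simp add: updl_pos)
      qed
    qed
    moreover have "dsubT (consl (map TV xs1) TV) (dsubst TV (hcons n ?L) a) = ?d"
    proof -
      have "(\<lambda>m i. dsubT (upT m (consl (map TV xs1) TV)) (hcons n ?L m i)) = hcons n ?L"
        by (auto simp: fun_eq_iff hcons_def dsubT_upT_head_id upT_def split: nat.split)
      then show ?thesis by (simp add: dsubT_dsubst)
    qed
    ultimately have B: "gmatches K' ?B ?d" by simp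
    have "lit_wf (K' k)" using wfB * n by (simp add: K'k)
    then have lit_wf: "\<forall>j\<in>lits ?d. lit_wf (K' j)"
      using lits[of "consl (map TV xs1) TV"] less.prems(6) K'K DMu by fastforce
    have size: "dsize ?d = dsize a"
      using hcons_cases[of n ?L] by (intro dsize_dsubst) (metis dsize.simps(2,7) head_id_def)
    have wf: "wfd ?d"
      using hcons_cases[of n ?L] less.prems DMu by (intro wfd_dsubst) (simp, metis wfd.simps(7) wfd_head_id)
    have "subty E ?A ?B"
      by (rule less.hyps[OF _ A B _ _ wf lit_wf])
        (use size DMu dist_mu in \<open>auto intro!: dist_mu_subst dist_mu_substT split: if_splits\<close>)
    moreover have "wf_ty (?M (map TV xs1))" using wfB * n by simp
    then have "subty E ?B (?M (map TV xs1))"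
      using subty.fold[of c2 xs2 D2 "map TV xs1" E] n by (simp add: unfold_mu_def)
    ultimately have "subty E ?A (?M (map TV xs1))" by (rule subty.trans)
    \<comment> \<open>The rule \<open>ind\<close> with the right-hand fixed point, at the arguments
      \<open>xs1\<close>, as invariant.\<close>
    then have "subty E A (substT (updl TV xs1 us) (?M (map TV xs1)))"
      unfolding *(1) by (intro subty.ind) (use wfA wfB * n in auto)
    moreover have "substT (updl TV xs1 us) (?M (map TV xs1)) = ?M us"
    proof -
      have "map (tsub (updl TV xs1 us)) (map TV xs1) = us"
        using n dist_mu by (intro nth_equalityI) (auto simp: updl_pos pos_nth)
      then show ?thesis
        unfolding substT_subst using disj n by (subst subst_mu_lit) (auto simp: updl_pos)
    qed
    ultimately show ?thesis using * by simp
  qed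
qed

abbreviation db :: "ty \<Rightarrow> dty" where
  "db \<equiv> to_db (\<lambda>y. y) head_idx"

lemma db_eq_subty:
  assumes "wf_ty A" "wf_ty B" "db A = db B"
  shows "subty E A B"
proof -
  have "gmatches (\<lambda>_. undefined) A (db A)" "gmatches (\<lambda>_. undefined) B (db B)"
    using assms(1,2) wf_to_db by (auto intro: matches_to_db)
  then have "gmatches (\<lambda>_. undefined) A (db A)" "gmatches (\<lambda>_. undefined) B (db A)"
    using assms by auto
  then show ?thesis
    by (rule alpha_subty) (use assms wf_to_db in auto)
qed

text \<open>Names are chosen from the outside inwards. At each binder the new names avoid the ones
  that represent the free indices, so that the extended environments still reach every index of the
  body.\<close>

lemma ex_rep:
  assumes "lits d = {}" "\<forall>i\<in>dfv d. \<exists>y. e y = i" "\<forall>(n, i)\<in>dfhd d. \<exists>h. arity h = n \<and> r h = i"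
  shows "\<exists>A. arity_ok A \<and> dist_mu A \<and> to_db e r A = d"
proof -
  have fresh_var: "\<exists>xs. length xs = n \<and> distinct xs \<and> (\<forall>i\<in>V. \<exists>y. y \<notin> set xs \<and> e y = i)"
    if "finite V" "\<forall>i\<in>V. \<exists>y. e y = i" for V n and e :: "nat \<Rightarrow> nat"
  proof -
    from that(2) obtain f where f: "\<forall>i\<in>V. e (f i) = i" by metis
    have "set (fresh_list (f ` V) n) \<inter> f ` V = {}" using that by (intro fresh_list_props) auto
    with f fresh_list_props(2,3)[of "f ` V" n] show ?thesis using that by (intro exI[of _ "fresh_list (f ` V) n"]) blast
  qed
  \<comment> \<open>Both heads named \<open>x\<close> are avoided, so that the same statement serves
    predicate quantifiers and fixed points.\<close>
  have fresh_head: "\<exists>x. \<forall>(n, i)\<in>H. \<exists>h. h \<noteq> PV x m \<and> h \<noteq> PS x m \<and> arity h = n \<and> r h = i"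
    if H: "finite H" "\<forall>(n, i)\<in>H. \<exists>h. arity h = n \<and> r h = i" for H :: "(nat \<times> nat) set" and m r
  proof -
    from H(2) have "\<forall>p\<in>H. \<exists>h. arity h = fst p \<and> r h = snd p" by auto
    then obtain f where f: "\<forall>p\<in>H. arity (f p) = fst p \<and> r (f p) = snd p" by metis
    obtain x where x: "x \<notin> pvnames (f ` H) \<union> psnames (f ` H)"
      using ex_new_if_finite[of "pvnames (f ` H) \<union> psnames (f ` H)"] H
      by (auto simp: finite_pvnames finite_psnames)
    have fp: "f p \<noteq> PV x m \<and> f p \<noteq> PS x m" if "p \<in> H" for p
    proof -
      have "PV x m \<notin> f ` H" "PS x m \<notin> f ` H" using x unfolding pvnames_def psnames_def by blast+
      with that show ?thesis by (metis imageI)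
    qed
    have "\<exists>h. h \<noteq> PV x m \<and> h \<noteq> PS x m \<and> arity h = n \<and> r h = i" if "(n, i) \<in> H" for n i
      using that f fp by (intro exI[of _ "f (n, i)"]) auto
    then show ?thesis by blast
  qed
  have up_var: "\<forall>i\<in>V. \<exists>y. up_env xs e y = i"
    if "\<forall>i\<in>{i. i + length xs \<in> V}. \<exists>y. y \<notin> set xs \<and> e y = i" "distinct xs" for V xs e
  proof
    fix i assume "i \<in> V"
    show "\<exists>y. up_env xs e y = i"
    proof (cases "i < length xs")
      case True
      with that(2) show ?thesis by (intro exI[of _ "xs ! i"]) (simp add: up_env_def pos_nth)
    next
      case False
      with that(1) \<open>i \<in> V\<close> have "\<exists>y. y \<notin> set xs \<and> e y = i - length xs" by auto
      with False show ?thesis by (auto simp: up_env_def)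
    qed
  qed
  have up_head: "\<forall>(n, i)\<in>H. \<exists>h. arity h = n \<and> up_head g r h = i"
    if "\<forall>(n, i)\<in>{(n, i). (n, shift_idx (arity g) n i) \<in> H}. \<exists>h. h \<noteq> g \<and> arity h = n \<and> r h = i" for H g r
  proof (intro ballI, clarify)
    fix n i assume ni: "(n, i) \<in> H"
    show "\<exists>h. arity h = n \<and> up_head g r h = i"
    proof (cases rule: shift_idx_cases[of n "arity g" i])
      case 1
      then show ?thesis by (intro exI[of _ g]) (simp add: up_head_simps)
    next
      case (2 j)
      with that ni have "\<exists>h. h \<noteq> g \<and> arity h = n \<and> r h = j" by auto
      with 2 show ?thesis by (auto simp: up_head_def)
    qed
  qed
  show ?thesis using assms
  proof (induction d arbitrary: e r)
    case DBot
    show ?case by (intro exI[of _ Bot]) simp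
  next
    case (DAt i ts)
    then obtain f where f: "\<forall>i\<in>dfv (DAt i ts). e (f i) = i" by metis
    from DAt obtain h where h: "arity h = length ts" "r h = i" by auto
    have "map (tsub (\<lambda>y. TV (e y))) (map (tsub (\<lambda>y. TV (f y))) ts) = map (tsub TV) ts"
      unfolding map_tsub_tsub using f by (intro map_cong refl tsub_cong) auto
    then show ?case
      using h by (intro exI[of _ "At h (map (tsub (\<lambda>y. TV (f y))) ts)"]) simp
  next
    case (DImp a b)
    have "\<exists>A. arity_ok A \<and> dist_mu A \<and> to_db e r A = a" "\<exists>A. arity_ok A \<and> dist_mu A \<and> to_db e r A = b"
      by (rule DImp.IH; use DImp.prems in auto)+
    then obtain A B where "arity_ok A" "dist_mu A" "to_db e r A = a" "arity_ok B" "dist_mu B" "to_db e r B = b" by auto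
    then show ?case by (intro exI[of _ "Imp A B"]) simp
  next
    case (DAll d)
    obtain xs where xs: "length xs = 1" "distinct xs" "\<forall>i\<in>dfv (DAll d). \<exists>y. y \<notin> set xs \<and> e y = i"
      using fresh_var[OF finite_dfv DAll.prems(2)] by blast
    then obtain x where x: "xs = [x]" by (cases xs) auto
    have "\<exists>A. arity_ok A \<and> dist_mu A \<and> to_db (up_env [x] e) r A = d"
      by (rule DAll.IH) (use DAll.prems xs x up_var[of "[x]" "dfv d" e] in auto)
    then obtain A where "arity_ok A" "dist_mu A" "to_db (up_env [x] e) r A = d" by auto
    then show ?case by (intro exI[of _ "AllV x A"]) simp
  next
    case (DAllP n d)
    obtain X where X: "\<forall>(m, i)\<in>dfhd (DAllP n d). \<exists>h. h \<noteq> PV X n \<and> h \<noteq> PS X n \<and> arity h = m \<and> r h = i"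
      using fresh_head[OF finite_dfhd DAllP.prems(3)] by blast
    have "\<exists>A. arity_ok A \<and> dist_mu A \<and> to_db e (up_head (PV X n) r) A = d"
      by (rule DAllP.IH) (use DAllP.prems X up_head[of "PV X n" "dfhd d" r] in fastforce)+
    then obtain A where "arity_ok A" "dist_mu A" "to_db e (up_head (PV X n) r) A = d" by auto
    then show ?case by (intro exI[of _ "AllP X n A"]) simp
  next
    case (DMu d ts)
    let ?n = "length ts"
    obtain xs where xs: "length xs = ?n" "distinct xs" "\<forall>i\<in>dfv (DMu d ts). \<exists>y. y \<notin> set xs \<and> e y = i"
      using fresh_var[OF finite_dfv DMu.prems(2)] by blast
    obtain c where c: "\<forall>(m, i)\<in>dfhd (DMu d ts). \<exists>h. h \<noteq> PV c ?n \<and> h \<noteq> PS c ?n \<and> arity h = m \<and> r h = i"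
      using fresh_head[OF finite_dfhd DMu.prems(3)] by blast
    have "\<exists>A. arity_ok A \<and> dist_mu A \<and> to_db (up_env xs e) (up_head (PS c ?n) r) A = d"
    proof (rule DMu.IH)
      show "\<forall>i\<in>dfv d. \<exists>y. up_env xs e y = i"
        by (rule up_var) (use xs in auto)
      show "\<forall>(n, i)\<in>dfhd d. \<exists>h. arity h = n \<and> up_head (PS c ?n) r h = i"
        by (rule up_head) (use c in fastforce)
    qed (use DMu.prems in auto)
    then obtain D where D: "arity_ok D" "dist_mu D" "to_db (up_env xs e) (up_head (PS c ?n) r) D = d" by auto
    from DMu.prems(2) obtain f where f: "\<forall>i\<in>dfv (DMu d ts). e (f i) = i" by metis
    have "map (tsub (\<lambda>y. TV (e y))) (map (tsub (\<lambda>y. TV (f y))) ts) = map (tsub TV) ts"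
      unfolding map_tsub_tsub using f by (intro map_cong refl tsub_cong) auto
    with D xs show ?case
      by (intro exI[of _ "Mu c xs D (map (tsub (\<lambda>y. TV (f y))) ts)"]) simp
  qed auto
qed

lemma ex_db: "lits d = {} \<Longrightarrow> wfd d \<Longrightarrow> \<exists>A. wf_ty A \<and> db A = d"
proof -
  assume d: "lits d = {}" "wfd d"
  have "\<exists>A. arity_ok A \<and> dist_mu A \<and> db A = d"
    by (rule ex_rep) (use d head_idx_idx_head in \<open>auto, blast\<close>)
  with d show ?thesis using wf_to_db by blast
qed

subsection \<open>Evaluation of named types\<close>

lemma arity_ok_substT [simp]: "arity_ok (substT \<theta> A) = arity_ok A"
  by (induction A arbitrary: \<theta>) (auto simp: Let_def fresh_list_props(2))

lemma dsubst_cong: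
  "(\<And>i. i \<in> dfv d \<Longrightarrow> s i = s' i) \<Longrightarrow> (\<And>n i. (n, i) \<in> dfhd d \<Longrightarrow> t n i = t' n i) \<Longrightarrow>
    dsubst s t d = dsubst s' t' d"
proof (induction d arbitrary: s s' t t')
  case (DAt i ts)
  have "map (tsub s) ts = map (tsub s') ts"
    using DAt.prems(1) by (intro map_cong refl tsub_cong) auto
  with DAt.prems(2) show ?case by (simp only: dsubst.simps dfhd.simps singletonI)
next
  case (DImp a b)
  have "dsubst s t a = dsubst s' t' a" "dsubst s t b = dsubst s' t' b"
    by (rule DImp.IH; use DImp.prems in auto)+
  then show ?case by simp
next
  case (DAll d)
  have "dsubst (upT 1 s) (liftH 1 t) d = dsubst (upT 1 s') (liftH 1 t') d"
  proof (rule DAll.IH)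
    fix i assume "i \<in> dfv d"
    then show "upT 1 s i = upT 1 s' i"
      using DAll.prems(1)[of "i - 1"] by (cases i) (auto intro!: upT_cong)
  qed (use DAll.prems(2) in \<open>auto simp: liftH_def\<close>)
  then show ?case by simp
next
  case (DAllP n d)
  have "dsubst s (upH n t) d = dsubst s' (upH n t') d"
  proof (rule DAllP.IH)
    fix m i assume "(m, i) \<in> dfhd d"
    then show "upH n t m i = upH n t' m i"
      by (cases rule: shift_idx_cases[of m n i]) (use DAllP.prems(2) in \<open>auto simp: upH_0 upH_shift_idx\<close>)
  qed (use DAllP.prems(1) in auto)
  then show ?case by simp
next
  case (DMu d ts)
  let ?n = "length ts"
  have "dsubst (upT ?n s) (upH ?n (liftH ?n t)) d = dsubst (upT ?n s') (upH ?n (liftH ?n t')) d"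
  proof (rule DMu.IH)
    fix i assume "i \<in> dfv d"
    then show "upT ?n s i = upT ?n s' i"
      using DMu.prems(1)[of "i - ?n"] by (cases "i < ?n") (auto intro!: upT_cong)
  next
    fix m i assume "(m, i) \<in> dfhd d"
    then show "upH ?n (liftH ?n t) m i = upH ?n (liftH ?n t') m i"
      by (cases rule: shift_idx_cases[of m ?n i]) (use DMu.prems(2) in \<open>auto simp: upH_0 upH_shift_idx liftH_def\<close>)
  qed
  moreover have "map (tsub s) ts = map (tsub s') ts"
    using DMu.prems(1) by (intro map_cong refl tsub_cong) auto
  ultimately show ?case by simp
next
  case (DLit k ts)
  have "map (tsub s) ts = map (tsub s') ts"
    using DLit.prems(1) by (intro map_cong refl tsub_cong) auto
  then show ?case by simp
qed auto

lemma compH_head_id: "dsubst (upT m s) (liftH m t) (head_id m i) = t m i"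
proof -
  have "(\<lambda>i. tsub (consl (map TV [0..<m]) TV) (upT m (\<lambda>i. TV (i + m)) i)) = TV"
    by (auto simp: upT_def consl_def fun_eq_iff)
  then show ?thesis
    by (simp only: head_id_def dsubst.simps upT_params liftH_def lift_abs_def dsubT_dsubT) simp
qed

definition hcons_env :: "nat \<Rightarrow> dty \<Rightarrow> (nat \<Rightarrow> nat \<Rightarrow> dty) \<Rightarrow> nat \<Rightarrow> nat \<Rightarrow> dty" where
  "hcons_env n F t m i = (if m = n then (case i of 0 \<Rightarrow> F | Suc j \<Rightarrow> t n j) else t m i)"

lemma hcons_env_0 [simp]: "hcons_env n F t n 0 = F"
  by (simp add: hcons_env_def)

lemma hcons_env_shift_idx [simp]: "hcons_env n F t m (shift_idx n m i) = t m i"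
  by (auto simp: hcons_env_def shift_idx_def)

lemma hfun_eqI:
  assumes "f n 0 = g n 0" "\<And>m i. f m (shift_idx n m i) = g m (shift_idx n m i)"
  shows "f = (g :: nat \<Rightarrow> nat \<Rightarrow> 'a)"
proof (intro ext)
  fix m i show "f m i = g m i"
    by (cases rule: shift_idx_cases[of m n i]) (use assms in auto)
qed

lemma compH_hcons_upH_liftH:
  assumes "length us = n"
  shows "compH (consl us TV) (hcons n F) (upH n (liftH n t)) = hcons_env n F t"
proof (rule hfun_eqI[of _ n])
  show "compH (consl us TV) (hcons n F) (upH n (liftH n t)) n 0 = hcons_env n F t n 0"
    by (simp add: compH_def upH_0 compH_head_id)
next
  fix m i
  have "(\<lambda>m' i'. liftH m (hcons n F) m' (shift_idx n m' i')) = head_id"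
    by (auto simp: liftH_def lift_abs_head_id fun_eq_iff)
  moreover have "(\<lambda>i. tsub (upT m (consl us TV)) (upT m (\<lambda>i. TV (i + n)) i)) = TV"
    using assms by (auto simp: tsub_upT_upT consl_def fun_eq_iff)
  ultimately show "compH (consl us TV) (hcons n F) (upH n (liftH n t)) m (shift_idx n m i) = hcons_env n F t m (shift_idx n m i)"
    by (simp add: compH_def upH_shift_idx dsubst_hren liftH_def[of n t] lift_abs_def dsubst_head_id dsubT_dsubT)
qed

lemma compH_hcons_upH: "compH TV (hcons n F) (upH n t) = hcons_env n F t"
proof (rule hfun_eqI[of _ n])
  show "compH TV (hcons n F) (upH n t) n 0 = hcons_env n F t n 0"
    using compH_head_id[of n TV] by (simp add: compH_def upH_0)
next
  fix m i
  have "(\<lambda>m' i'. liftH m (hcons n F) m' (shift_idx n m' i')) = head_id"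
    by (auto simp: liftH_def lift_abs_head_id fun_eq_iff)
  then show "compH TV (hcons n F) (upH n t) m (shift_idx n m i) = hcons_env n F t m (shift_idx n m i)"
    by (simp add: compH_def upH_shift_idx dsubst_hren)
qed

text \<open>The lift made for passing the binder is cancelled by the instantiation, and what remains
  is a single substitution in an extended environment.\<close>

lemma dsubst_inst_mu:
  "length us = n \<Longrightarrow> dsubst (consl us TV) (hcons n F) (dsubst (upT n s) (upH n (liftH n t)) d) =
     dsubst (consl us s) (hcons_env n F t) d"
  by (simp add: dsubst_dsubst compH_hcons_upH_liftH tsub_consl_upT')

lemma dsubst_inst_pred:
  "dsubst TV (hcons n F) (dsubst s (upH n t) d) = dsubst s (hcons_env n F t) d"
  by (simp add: dsubst_dsubst compH_hcons_upH)

lemma dsubst_inst_var: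
  assumes "length us = n"
  shows "dsubT (consl us TV) (dsubst (upT n s) (liftH n t) d) = dsubst (consl us s) t d"
proof -
  have "(\<lambda>m i. dsubT (upT m (consl us TV)) (liftH n t m i)) = t"
    using assms by (auto simp: liftH_def lift_abs_def dsubT_dsubT tsub_upT_upT consl_def fun_eq_iff)
  with assms show ?thesis by (simp add: dsubT_dsubst tsub_consl_upT')
qed

text \<open>Environments do nothing but renumber free names, so facts about \<open>db\<close>
  transfer to the bodies of binders, which are translated in larger environments.\<close>

lemma to_db_env:
  assumes "arity_ok A"
  shows "to_db e r A = dsubst (\<lambda>y. TV (e y)) (\<lambda>n i. head_id n (r (idx_head n i))) (db A)"
proof -
  have "matches (\<lambda>_. undefined) e r A (dsubst (\<lambda>y. TV (e y)) (\<lambda>n i. head_id n (r (idx_head n i))) (db A))"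
    by (rule matches_env[OF matches_to_db[OF assms]]) auto
  from matches_to_dbD[OF this] show ?thesis by (auto simp: lits_dsubst)
qed

lemma to_db_matches_eq: "matches K e r A d \<Longrightarrow> lits d = {} \<Longrightarrow> to_db e r A = d"
  using matches_to_dbD by blast

text \<open>The value of a named type under a valuation of its free names. Statements about all
  valuations include all substitution instances, and by \<open>sem_cong\<close> a freshness
  condition becomes the freedom to change the valuation at one name.\<close>

definition sem :: "(nat \<Rightarrow> trm) \<Rightarrow> (head \<Rightarrow> dty) \<Rightarrow> ty \<Rightarrow> dty" where
  "sem \<sigma> \<tau> A = dsubst \<sigma> (\<lambda>n i. \<tau> (idx_head n i)) (db A)"

definition head_env :: "head \<Rightarrow> dty" where
  "head_env h = head_id (arity h) (head_idx h)"

lemma sem_id [simp]: "sem TV head_env A = db A"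
  by (simp add: sem_def head_env_def)

text \<open>The head image denoted by the abstraction \<open>(ys, F)\<close>: the names
  \<open>ys\<close> become its parameters, whatever \<open>\<sigma>\<close> says about them, and all
  other values are lifted past these.\<close>

definition sem_abs :: "(nat \<Rightarrow> trm) \<Rightarrow> (head \<Rightarrow> dty) \<Rightarrow> nat list \<Rightarrow> ty \<Rightarrow> dty" where
  "sem_abs \<sigma> \<tau> ys F = sem
     (\<lambda>y. if y \<in> set ys then TV (pos ys y) else tsub (\<lambda>j. TV (j + length ys)) (\<sigma> y))
     (\<lambda>h. lift_abs (length ys) (arity h) (\<tau> h)) F"

lemma sem_abs_cong: "(\<And>y. y \<notin> set ys \<Longrightarrow> \<sigma> y = \<sigma>' y) \<Longrightarrow> sem_abs \<sigma> \<tau> ys F = sem_abs \<sigma>' \<tau> ys F"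
  by (simp add: sem_abs_def cong: if_cong)

lemma compH_to_db_env: "compH s t (\<lambda>n i. head_id n (f n i)) = (\<lambda>n i. t n (f n i))"
  by (auto simp: compH_def compH_head_id fun_eq_iff)

lemma dsubst_to_db:
  "arity_ok A \<Longrightarrow> dsubst s t (to_db e r A) = sem (\<lambda>y. s (e y)) (\<lambda>h. t (arity h) (r h)) A"
  by (subst to_db_env) (simp_all add: dsubst_dsubst compH_to_db_env sem_def)

lemma sem_abs_to_db:
  assumes "arity_ok F" "length ys = n"
  shows "sem_abs \<sigma> \<tau> ys F = dsubst (upT n \<sigma>) (liftH n (\<lambda>n i. \<tau> (idx_head n i))) (to_db (up_env ys (\<lambda>y. y)) head_idx F)"
proof -
  have "(\<lambda>y. upT n \<sigma> (up_env ys (\<lambda>y. y) y)) =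
    (\<lambda>y. if y \<in> set ys then TV (pos ys y) else tsub (\<lambda>j. TV (j + length ys)) (\<sigma> y))"
    using assms by (auto simp: up_env_def upT_def pos_less fun_eq_iff)
  with assms show ?thesis by (simp add: dsubst_to_db sem_abs_def liftH_def)
qed

lemma sem_abs_id: "arity_ok F \<Longrightarrow> sem_abs TV head_env ys F = to_db (up_env ys (\<lambda>y. y)) head_idx F"
  by (simp add: sem_abs_to_db head_env_def)

lemma updl_consl_up_env: "length us = length xs \<Longrightarrow> (\<lambda>y. consl us \<sigma> (up_env xs (\<lambda>y. y) y)) = updl \<sigma> xs us"
  by (auto simp: consl_up_env updl_pos fun_eq_iff)

lemma sem_abs_inst:
  assumes "arity_ok F" "length us = length ys"
  shows "dsubT (consl us TV) (sem_abs \<sigma> \<tau> ys F) = sem (updl \<sigma> ys us) \<tau> F"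
  unfolding sem_abs_to_db[OF assms(1) HOL.refl] dsubst_inst_var[OF assms(2)]
  using assms by (simp add: dsubst_to_db updl_consl_up_env)

lemma sem_AllV: "arity_ok A \<Longrightarrow> sem \<sigma> \<tau> (AllV x A) = DAll (sem_abs \<sigma> \<tau> [x] A)"
  by (simp add: sem_abs_to_db[where n = 1]) (simp add: sem_def)

definition sem_pred :: "(nat \<Rightarrow> trm) \<Rightarrow> (head \<Rightarrow> dty) \<Rightarrow> nat \<Rightarrow> nat \<Rightarrow> ty \<Rightarrow> dty" where
  "sem_pred \<sigma> \<tau> X n A = dsubst \<sigma> (upH n (\<lambda>n i. \<tau> (idx_head n i))) (to_db (\<lambda>y. y) (up_head (PV X n) head_idx) A)"

lemma sem_AllP: "sem \<sigma> \<tau> (AllP X n A) = DAllP n (sem_pred \<sigma> \<tau> X n A)"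
  by (simp add: sem_pred_def sem_def)

lemma hcons_env_up_head: "hcons_env (arity g) F (\<lambda>n i. \<tau> (idx_head n i)) (arity h) (up_head g head_idx h) = (\<tau>(g := F)) h"
  by (cases "h = g") (simp_all add: up_head_simps)

lemma sem_pred_inst:
  assumes "arity_ok A"
  shows "dsubst TV (hcons n F) (sem_pred \<sigma> \<tau> X n A) = sem \<sigma> (\<tau>(PV X n := F)) A"
  using assms hcons_env_up_head[of "PV X n" F \<tau>]
  unfolding sem_pred_def dsubst_inst_pred by (simp add: dsubst_to_db fun_upd_def)

definition sem_mu :: "(nat \<Rightarrow> trm) \<Rightarrow> (head \<Rightarrow> dty) \<Rightarrow> nat \<Rightarrow> nat list \<Rightarrow> ty \<Rightarrow> dty" where
  "sem_mu \<sigma> \<tau> c xs D = dsubst (upT (length xs) \<sigma>) (upH (length xs) (liftH (length xs) (\<lambda>n i. \<tau> (idx_head n i))))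
     (to_db (up_env xs (\<lambda>y. y)) (up_head (PS c (length xs)) head_idx) D)"

lemma sem_Mu: "length ts = length xs \<Longrightarrow> sem \<sigma> \<tau> (Mu c xs D ts) = DMu (sem_mu \<sigma> \<tau> c xs D) (map (tsub \<sigma>) ts)"
  by (simp add: sem_mu_def sem_def)

lemma sem_mu_inst:
  assumes "arity_ok D" "length us = length xs"
  shows "dsubst (consl us TV) (hcons (length xs) F) (sem_mu \<sigma> \<tau> c xs D) =
    sem (updl \<sigma> xs us) (\<tau>(PS c (length xs) := F)) D"
  using assms hcons_env_up_head[of "PS c (length xs)" F \<tau>]
  unfolding sem_mu_def dsubst_inst_mu[OF assms(2)] by (simp add: dsubst_to_db updl_consl_up_env fun_upd_def)

lemma sem_cong:
  assumes "\<And>y. y \<in> fv A \<Longrightarrow> \<sigma> y = \<sigma>' y" "\<And>h. h \<in> fhd A \<Longrightarrow> \<tau> h = \<tau>' h" "arity_ok A"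
  shows "sem \<sigma> \<tau> A = sem \<sigma>' \<tau>' A"
  unfolding sem_def
proof (rule dsubst_cong)
  have matches: "gmatches (\<lambda>_. undefined) A (db A)" by (rule matches_to_db) fact
  show "\<sigma> i = \<sigma>' i" if "i \<in> dfv (db A)" for i
    using matches_fv2[OF matches that] assms(1) by auto
  show "\<tau> (idx_head n i) = \<tau>' (idx_head n i)" if "(n, i) \<in> dfhd (db A)" for n i
    using matches_fh2[OF matches that] assms(2) by auto
qed

definition abstrs_ok :: "(head \<Rightarrow> abstr option) \<Rightarrow> bool" where
  "abstrs_ok \<rho> \<longleftrightarrow> (\<forall>h ys F. \<rho> h = Some (ys, F) \<longrightarrow> length ys = arity h \<and> arity_ok F)"

definition to_db_abstr :: "(head \<Rightarrow> abstr option) \<Rightarrow> nat \<Rightarrow> nat \<Rightarrow> dty" where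
  "to_db_abstr \<rho> n i = (case \<rho> (idx_head n i) of None \<Rightarrow> head_id n i | Some (ys, F) \<Rightarrow> to_db (up_env ys (\<lambda>y. y)) head_idx F)"

lemma to_db_subst:
  assumes "arity_ok A" "abstrs_ok \<rho>"
  shows "db (subst \<theta> \<rho> A) = dsubst \<theta> (to_db_abstr \<rho>) (db A)" "arity_ok (subst \<theta> \<rho> A)"
proof -
  have "lits (to_db_abstr \<rho> n i) = {}" for n i
    by (auto simp: to_db_abstr_def split: option.splits)
  then have lits: "lits (dsubst \<theta> (to_db_abstr \<rho>) (db A)) = {}"
    by (auto simp: lits_dsubst)
  have "gmatches (\<lambda>_. undefined) (subst \<theta> \<rho> A) (dsubst \<theta> (to_db_abstr \<rho>) (db A))"
  proof (rule matches_subst[OF matches_to_db[OF assms(1)]])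
    show "\<forall>h\<in>fhd A. image_ok (\<lambda>_. undefined) (\<lambda>y. y) head_idx h (\<rho> h) (to_db_abstr \<rho> (arity h) (head_idx h))"
    proof
      fix h
      show "image_ok (\<lambda>_. undefined) (\<lambda>y. y) head_idx h (\<rho> h) (to_db_abstr \<rho> (arity h) (head_idx h))"
      proof (cases "\<rho> h")
        case (Some q)
        then obtain ys F where "\<rho> h = Some (ys, F)" by (cases q) auto
        moreover from this assms(2) have "length ys = arity h" "arity_ok F" by (auto simp: abstrs_ok_def)
        ultimately show ?thesis using matches_to_db by (simp add: to_db_abstr_def)
      qed (simp add: to_db_abstr_def)
    qed
  qed auto
  from matches_to_dbD[OF this lits] show "db (subst \<theta> \<rho> A) = dsubst \<theta> (to_db_abstr \<rho>) (db A)" "arity_ok (subst \<theta> \<rho> A)"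
    by simp_all
qed

text \<open>A strict equation although \<open>subst\<close> may rename bound names, because the
  values are de Bruijn types.\<close>

lemma sem_subst:
  assumes "arity_ok A" "abstrs_ok \<rho>"
  shows "sem \<sigma> \<tau> (subst \<theta> \<rho> A) = sem (\<lambda>y. tsub \<sigma> (\<theta> y))
    (\<lambda>h. case \<rho> h of None \<Rightarrow> \<tau> h | Some (ys, F) \<Rightarrow> sem_abs \<sigma> \<tau> ys F) A"
proof -
  have "compH \<sigma> (\<lambda>n i. \<tau> (idx_head n i)) (to_db_abstr \<rho>) =
    (\<lambda>n i. case \<rho> (idx_head n i) of None \<Rightarrow> \<tau> (idx_head n i) | Some (ys, F) \<Rightarrow> sem_abs \<sigma> \<tau> ys F)"
  proof (intro ext)
    fix n i
    show "compH \<sigma> (\<lambda>n i. \<tau> (idx_head n i)) (to_db_abstr \<rho>) n i =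
      (case \<rho> (idx_head n i) of None \<Rightarrow> \<tau> (idx_head n i) | Some (ys, F) \<Rightarrow> sem_abs \<sigma> \<tau> ys F)"
    proof (cases "\<rho> (idx_head n i)")
      case None
      then show ?thesis by (simp add: compH_def to_db_abstr_def compH_head_id)
    next
      case (Some q)
      then obtain ys F where q: "\<rho> (idx_head n i) = Some (ys, F)" by (cases q) auto
      with assms(2) have "length ys = n" "arity_ok F" unfolding abstrs_ok_def by force+
      with q show ?thesis by (simp add: compH_def to_db_abstr_def sem_abs_to_db)
    qed
  qed
  with assms show ?thesis by (simp add: sem_def to_db_subst dsubst_dsubst)
qed

lemma abstrs_ok_None [simp]: "abstrs_ok (\<lambda>_. None)"
  by (simp add: abstrs_ok_def)

lemma abstrs_ok_upd [simp]: "length ys = arity h \<Longrightarrow> arity_ok F \<Longrightarrow> abstrs_ok ((\<lambda>_. None)(h := Some (ys, F)))"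
  by (auto simp: abstrs_ok_def)

lemma sem_substT: "arity_ok A \<Longrightarrow> sem \<sigma> \<tau> (substT \<theta> A) = sem (\<lambda>y. tsub \<sigma> (\<theta> y)) \<tau> A"
  by (simp add: substT_subst sem_subst)

lemma sem_subst1:
  assumes "arity_ok A" "length ys = arity h" "arity_ok F"
  shows "sem \<sigma> \<tau> (subst TV ((\<lambda>_. None)(h := Some (ys, F))) A) = sem \<sigma> (\<tau>(h := sem_abs \<sigma> \<tau> ys F)) A"
proof -
  have "(\<lambda>g. case ((\<lambda>_. None)(h := Some (ys, F))) g of None \<Rightarrow> \<tau> g | Some (ys, F) \<Rightarrow> sem_abs \<sigma> \<tau> ys F)
    = \<tau>(h := sem_abs \<sigma> \<tau> ys F)" by (auto simp: fun_eq_iff)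
  with sem_subst[of A "(\<lambda>_. None)(h := Some (ys, F))" \<sigma> \<tau> TV] assms show ?thesis by simp
qed

subsection \<open>Subtyping on de Bruijn types\<close>

text \<open>These are exactly the translations of well-formed named types, by \<open>wf_good\<close>
  and \<open>ex_good\<close>.\<close>

definition good :: "dty \<Rightarrow> bool" where
  "good d \<longleftrightarrow> wfd d \<and> lits d = {}"

lemma good_simps [simp]:
  "good DBot" "good (DAt i ts)" "good (DImp a b) \<longleftrightarrow> good a \<and> good b" "good (DAll a) \<longleftrightarrow> good a"
  "good (DAllP n a) \<longleftrightarrow> good a" "good (dsubT s d) \<longleftrightarrow> good d" "good (shift_head n d) \<longleftrightarrow> good d" "good (lift_abs k m d) \<longleftrightarrow> good d"
  "good (head_id n i)"
  "good (DMu a ts) \<longleftrightarrow> good a \<and> polar True (length ts) 0 a \<and> (length ts, 0) \<in> dfhd a"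
  by (auto simp: good_def)

lemma good_dsubst: "good d \<Longrightarrow> (\<And>n i. (n, i) \<in> dfhd d \<Longrightarrow> good (t n i)) \<Longrightarrow> good (dsubst s t d)"
  by (auto simp: good_def lits_dsubst wfd_dsubst)

lemma good_to_db: "good (to_db e r A) \<longleftrightarrow> wfd (to_db e r A)"
  by (simp add: good_def)

lemma good_sem: "good (db A) \<Longrightarrow> (\<And>h. good (\<tau> h)) \<Longrightarrow> good (sem \<sigma> \<tau> A)"
  by (simp add: sem_def good_dsubst)

lemma wf_good: "wf_ty A \<longleftrightarrow> arity_ok A \<and> dist_mu A \<and> good (to_db e r A)"
  using wf_to_db[of A e r] by (simp add: good_to_db)

text \<open>Which well-formed representatives are taken does not matter: any two with the same
  translation are mutual subtypes (\<open>db_eq_subty\<close>), and \<open>dle_subty\<close> passes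
  between them.\<close>

definition dle :: "(trm \<times> trm) set \<Rightarrow> dty \<Rightarrow> dty \<Rightarrow> bool" where
  "dle E d1 d2 \<longleftrightarrow> (\<exists>A B. wf_ty A \<and> wf_ty B \<and> db A = d1 \<and> db B = d2 \<and> subty E A B)"

lemma dle_subty:
  assumes "dle E (db A) (db B)" "wf_ty A" "wf_ty B"
  shows "subty E A B"
proof -
  from assms(1) obtain A' B' where "wf_ty A'" "wf_ty B'" "db A' = db A" "db B' = db B" "subty E A' B'"
    unfolding dle_def by auto
  with assms show ?thesis using db_eq_subty subty.trans by metis
qed

lemma subty_dle: "subty E A B \<Longrightarrow> wf_ty A \<Longrightarrow> wf_ty B \<Longrightarrow> dle E (db A) (db B)"
  unfolding dle_def by blast

lemma dle_good: assumes "dle E a b" shows "good a" "good b"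
  using assms wf_good unfolding dle_def by auto

lemma ex_good: "good d \<Longrightarrow> \<exists>A. wf_ty A \<and> db A = d"
  using ex_db by (simp add: good_def)

lemma dle_refl: "good d \<Longrightarrow> dle E d d"
proof -
  assume "good d"
  then obtain A where "wf_ty A" "db A = d" using ex_good by blast
  with subty_dle[OF subty.refl] show ?thesis by blast
qed

lemma dle_trans: "dle E a b \<Longrightarrow> dle E b c \<Longrightarrow> dle E a c"
proof -
  assume "dle E a b" "dle E b c"
  then obtain A B C where *: "wf_ty A" "wf_ty B" "wf_ty C" "db A = a" "db B = b" "db C = c"
    "subty E A B" unfolding dle_def by blast
  with \<open>dle E b c\<close> have "subty E B C" by (intro dle_subty) simp_all
  with * have "subty E A C" by (blast intro: subty.trans)
  from subty_dle[OF this] * show ?thesis by simp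
qed

lemma dle_imp:
  assumes "dle E a a'" "dle E b b'"
  shows "dle E (DImp a' b) (DImp a b')"
proof -
  from assms obtain A A' B B' where "wf_ty A" "wf_ty A'" "wf_ty B" "wf_ty B'"
    "db A = a" "db A' = a'" "db B = b" "db B' = b'" "subty E A A'" "subty E B B'"
    unfolding dle_def by blast
  then show ?thesis
    using subty_dle[OF subty.arr[of E A A' B B']] by simp
qed

lemma fresh_names: "finite (V :: nat set) \<Longrightarrow> \<exists>xs. length xs = n \<and> distinct xs \<and> set xs \<inter> V = {}"
  using fresh_list_props[of V n] by (intro exI[of _ "fresh_list V n"]) simp

lemma up_env_cover:
  assumes "distinct xs" "set xs \<inter> {y. y + length xs \<in> V} = {}" "i \<in> V"
  shows "\<exists>y. up_env xs (\<lambda>y. y) y = i"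
proof (cases "i < length xs")
  case True
  with assms show ?thesis by (intro exI[of _ "xs ! i"]) (simp add: up_env_def pos_nth)
next
  case False
  with assms have "i - length xs \<notin> set xs" by auto
  with False show ?thesis by (intro exI[of _ "i - length xs"]) (simp add: up_env_def)
qed

lemma ex_rep_open:
  assumes "good d" "distinct xs" "set xs \<inter> {y. y + length xs \<in> dfv d} = {}"
  shows "\<exists>A. arity_ok A \<and> dist_mu A \<and> to_db (up_env xs (\<lambda>y. y)) head_idx A = d"
proof (rule ex_rep)
  show "\<forall>i\<in>dfv d. \<exists>y. up_env xs (\<lambda>y. y) y = i"
    using up_env_cover[OF assms(2,3)] by blast
qed (use assms head_idx_idx_head in \<open>auto simp: good_def, blast\<close>)

lemma finite_shift: "finite {y. y + n \<in> dfv d}"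
  using finite_vimageI[OF finite_dfv[of d], of "\<lambda>y. y + n"] by (simp add: vimage_def)

lemma to_db_open_inst:
  assumes "arity_ok A" "length us = length xs"
  shows "db (substT (updl TV xs us) A) = dsubT (consl us TV) (to_db (up_env xs (\<lambda>y. y)) head_idx A)"
  using sem_abs_inst[OF assms, of TV head_env] sem_substT[OF assms(1), of TV head_env "updl TV xs us"] assms
  by (simp add: sem_abs_id)

lemma wf_substT: "wf_ty A \<Longrightarrow> wf_ty (substT \<theta> A)"
proof -
  assume A: "wf_ty A"
  then have "arity_ok A" "dist_mu A" "good (db A)" using wf_good by auto
  moreover from this have "db (substT \<theta> A) = dsubT \<theta> (db A)"
    using sem_substT[of A TV head_env \<theta>] by (simp add: sem_def head_env_def dsubst_head_id)
  ultimately show ?thesis using dist_mu_substT wf_good[of "substT \<theta> A" "\<lambda>y. y" head_idx] by simp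
qed

lemma wf_subst1:
  assumes "wf_ty A" "wf_ty F" "length ys = arity h"
  shows "wf_ty (subst TV ((\<lambda>_. None)(h := Some (ys, F))) A)"
proof -
  have A: "arity_ok A" "dist_mu A" "good (db A)" and F: "arity_ok F" "dist_mu F" "\<And>e r. good (to_db e r F)"
    using assms wf_good by blast+
  let ?\<rho> = "(\<lambda>_. None)(h := Some (ys, F))"
  have "abstrs_ok ?\<rho>" using assms F by simp
  from to_db_subst[OF A(1) this, of TV] have "arity_ok (subst TV ?\<rho> A)"
    "db (subst TV ?\<rho> A) = dsubst TV (to_db_abstr ?\<rho>) (db A)" by simp_all
  moreover have "good (to_db_abstr ?\<rho> n i)" for n i
    using F by (auto simp: to_db_abstr_def)
  moreover have "dist_mu (subst TV ?\<rho> A)"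
    by (rule dist_mu_subst) (use A F in \<open>auto split: if_splits\<close>)
  ultimately show ?thesis using A wf_good[of "subst TV ?\<rho> A" "\<lambda>y. y" head_idx] by (simp add: good_dsubst)
qed

lemma ex_open_var:
  assumes "good d" "finite V"
  obtains x A where "x \<notin> V" "wf_ty A" "to_db (up_env [x] (\<lambda>y. y)) head_idx A = d"
    "\<And>u. db (substT (TV(x := u)) A) = dsubT (consl [u] TV) d"
proof -
  have "finite (V \<union> {y. y + 1 \<in> dfv d})" using assms finite_shift[of 1 d] by simp
  from fresh_names[OF this] obtain xs where xs: "length xs = 1" "distinct xs"
    "set xs \<inter> (V \<union> {y. y + 1 \<in> dfv d}) = {}" by metis
  then obtain x where x: "xs = [x]" by (cases xs) auto
  with ex_rep_open[OF assms(1), of xs] xs obtain A where A: "arity_ok A" "dist_mu A"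
    "to_db (up_env [x] (\<lambda>y. y)) head_idx A = d" by auto
  show ?thesis
  proof (rule that)
    show "wf_ty A" using A assms(1) wf_good by blast
    show "db (substT (TV(x := u)) A) = dsubT (consl [u] TV) d" for u
      using to_db_open_inst[OF A(1), of "[u]" "[x]"] A by (simp add: updl_single)
  qed (use A xs x in auto)
qed

lemma dle_allV_l:
  assumes "dle E (dsubT (consl [u] TV) d) b"
  shows "dle E (DAll d) b"
proof -
  have "good d" using dle_good[OF assms] by simp
  from ex_open_var[OF this finite.emptyI] obtain x A where A: "wf_ty A" "to_db (up_env [x] (\<lambda>y. y)) head_idx A = d"
    "db (substT (TV(x := u)) A) = dsubT (consl [u] TV) d" by metis
  then have wf: "wf_ty (AllV x A)" by simp
  from dle_good[OF assms] obtain B where B: "wf_ty B" "db B = b" using ex_good by blast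
  with assms A have "subty E (substT (TV(x := u)) A) B"
    by (intro dle_subty wf_substT) simp_all
  then have "subty E (AllV x A) B" by (rule subty.allV_l) (rule wf)
  from subty_dle[OF this wf B(1)] B A show ?thesis by simp
qed

text \<open>Since all instances are available, the bound variable may be given a name that is not
  free in the representative of \<open>a\<close>; the instance at that name is the premise of the
  named rule.\<close>

lemma dle_allV_r:
  assumes "\<And>u. dle E a (dsubT (consl [u] TV) d)"
  shows "dle E a (DAll d)"
proof -
  have "good d" "good a" using dle_good[OF assms] by simp_all
  then obtain A where A: "wf_ty A" "db A = a" using ex_good by blast
  obtain x B where x: "x \<notin> fv A" and wf: "wf_ty B" and B: "to_db (up_env [x] (\<lambda>y. y)) head_idx B = d"
    "\<And>u. db (substT (TV(x := u)) B) = dsubT (consl [u] TV) d"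
    using ex_open_var[OF \<open>good d\<close> finite_fv] by metis
  have "db B = dsubT (consl [TV x] TV) d"
    using B(2)[of "TV x"] by (simp add: substT_subst subst_id)
  with assms[of "TV x"] A wf have "subty E A B" by (intro dle_subty) simp_all
  then have "subty E A (AllV x B)" by (rule subty.allV_r) (rule x)
  from subty_dle[OF this] A B wf show ?thesis by simp
qed

lemma eq_inst_tsub: "eq_inst E v w \<Longrightarrow> eq_inst E (tsub s v) (tsub s w)"
  unfolding eq_inst_def by (fastforce simp: tsub_tsub)

lemma dle_eq:
  assumes "dle E a (dsubT (consl [v] TV) d)" "eq_inst E v w"
  shows "dle E a (dsubT (consl [w] TV) d)"
proof -
  have "good d" "good a" using dle_good[OF assms(1)] by simp_all
  then obtain A where A: "wf_ty A" "db A = a" using ex_good by blast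
  from ex_open_var[OF \<open>good d\<close> finite.emptyI] obtain x B where wf: "wf_ty B"
    and db: "\<And>u. db (substT (TV(x := u)) B) = dsubT (consl [u] TV) d" by metis
  with assms A wf have "subty E A (substT (TV(x := v)) B)"
    by (intro dle_subty wf_substT) simp_all
  then have "subty E A (substT (TV(x := w)) B)" using assms(2) by (rule subty.eq)
  from subty_dle[OF this] A wf db wf_substT show ?thesis by simp
qed

text \<open>Turns a head image into an abstraction over distinct variables, the form that
  \<open>allP_l\<close> and \<open>fits\<close> require.\<close>

lemma ex_abs:
  assumes "good F"
  shows "\<exists>ys G. length ys = n \<and> distinct ys \<and> wf_ty G \<and> to_db (up_env ys (\<lambda>y. y)) head_idx G = F"
proof -
  from fresh_names[OF finite_shift] obtain ys where "length ys = n" "distinct ys"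
    "set ys \<inter> {y. y + n \<in> dfv F} = {}" by metis
  with ex_rep_open[OF assms, of ys] show ?thesis using assms wf_good by blast
qed

lemma dle_allP_l:
  assumes "dle E (dsubst TV (hcons n F) d) b" "good F" "good d"
  shows "dle E (DAllP n d) b"
proof -
  from ex_good[of "DAllP n d"] assms obtain C where C: "wf_ty C" "db C = DAllP n d" by auto
  then obtain X A where A: "C = AllP X n A" by (cases C) auto
  from C A have wfA: "wf_ty A" "arity_ok A" using wf_good[of A] by auto
  from ex_abs[OF assms(2), of n] obtain ys G where G: "length ys = n" "distinct ys" "wf_ty G"
    "to_db (up_env ys (\<lambda>y. y)) head_idx G = F" by auto
  then have "arity_ok G" using wf_good by blast
  from dle_good[OF assms(1)] obtain B where B: "wf_ty B" "db B = b" using ex_good by blast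
  let ?A = "subst TV ((\<lambda>_. None)(PV X n := Some (ys, G))) A"
  have d: "sem_pred TV head_env X n A = d" using C A sem_AllP[of TV head_env X n A] by simp
  have "db ?A = sem TV (head_env(PV X n := F)) A"
    using sem_subst1[OF wfA(2), of ys "PV X n" G TV head_env] G \<open>arity_ok G\<close> by (simp add: sem_abs_id)
  also have "\<dots> = dsubst TV (hcons n F) d"
    using sem_pred_inst[OF wfA(2), of n F TV head_env X] d by simp
  finally have "subty E ?A B"
    using assms(1) B wfA G by (intro dle_subty wf_subst1) simp_all
  then have "subty E C B" unfolding A
    by (rule subty.allP_l) (use G C A in simp_all)
  from subty_dle[OF this] C B show ?thesis by simp
qed

text \<open>After the renaming \<open>Z\<close> has the index \<open>0\<close> that \<open>X\<close>
  had before, and no other head is confused with it because \<open>Z\<close> is not free.\<close>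

lemma to_db_open_pred:
  assumes "arity_ok B" "PV Z n \<notin> fhd (AllP X n B)"
  shows "db (AllP Z n (subst TV ((\<lambda>_. None)(PV X n := Some ([0..<n], At (PV Z n) (map TV [0..<n])))) B)) =
    db (AllP X n B)"
proof -
  let ?\<rho> = "(\<lambda>_. None)(PV X n := Some ([0..<n], At (PV Z n) (map TV [0..<n])))"
  let ?K = "\<lambda>_. undefined" let ?d = "to_db (\<lambda>y. y) (up_head (PV X n) head_idx) B"
  have "matches ?K (\<lambda>y. y) (up_head (PV Z n) head_idx) (subst TV ?\<rho> B) (dsubst TV head_id ?d)"
  proof (rule matches_subst[OF matches_to_db[OF assms(1)]])
    show "\<forall>h\<in>fhd B. image_ok ?K (\<lambda>y. y) (up_head (PV Z n) head_idx) h (?\<rho> h) (head_id (arity h) (up_head (PV X n) head_idx h))"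
    proof
      fix h assume h: "h \<in> fhd B"
      show "image_ok ?K (\<lambda>y. y) (up_head (PV Z n) head_idx) h (?\<rho> h) (head_id (arity h) (up_head (PV X n) head_idx h))"
      proof (cases "h = PV X n")
        case True
        with matches_atom_params[of "PV Z n" n ?K "\<lambda>y. y" "up_head (PV Z n) head_idx"] show ?thesis
          by (simp add: up_head_simps del: matches.simps)
      next
        case False
        with h assms(2) have "h \<noteq> PV Z n" by auto
        with False show ?thesis by (simp add: up_head_simps)
      qed
    qed
  qed auto
  from to_db_matches_eq[OF this] show ?thesis by simp
qed

lemma dle_allP_r:
  assumes "\<And>F. good F \<Longrightarrow> dle E a (dsubst TV (hcons n F) d)" "good d"
  shows "dle E a (DAllP n d)"
proof -
  \<comment> \<open>The instance at \<open>DBot\<close> serves only to see that \<open>a\<close> is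
    \<open>good\<close>.\<close>
  have "good a" using dle_good[OF assms(1)[of DBot]] by simp
  then obtain A where A: "wf_ty A" "db A = a" using ex_good by blast
  from ex_good[of "DAllP n d"] assms obtain C where C: "wf_ty C" "db C = DAllP n d" by auto
  then obtain X B where B: "C = AllP X n B" by (cases C) auto
  from C B have wfB: "wf_ty B" "arity_ok B" using wf_good[of B] by auto
  have d: "sem_pred TV head_env X n B = d" using C B sem_AllP[of TV head_env X n B] by simp
  obtain Z where "Z \<notin> pvnames (fhd A \<union> fhd C)"
    using ex_new_if_finite[OF _ finite_pvnames[of "fhd A \<union> fhd C"]] by auto
  then have Z: "PV Z n \<notin> fhd A" "PV Z n \<notin> fhd C" by (auto simp: pvnames_def)
  let ?F = "At (PV Z n) (map TV [0..<n])"
  let ?B = "subst TV ((\<lambda>_. None)(PV X n := Some ([0..<n], ?F))) B"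
  have "wf_ty ?B" using wfB by (intro wf_subst1) auto
  have "to_db (up_env [0..<n] (\<lambda>y. y)) head_idx ?F = head_id n (head_idx (PV Z n))"
    using to_db_matches_eq[OF matches_atom_params[of "PV Z n" n _ "\<lambda>y. y" head_idx]] by simp
  then have "db ?B = sem TV (head_env(PV X n := head_id n (head_idx (PV Z n)))) B"
    using sem_subst1[OF wfB(2), of "[0..<n]" "PV X n" ?F TV head_env] by (simp add: sem_abs_id del: to_db.simps)
  also have "\<dots> = dsubst TV (hcons n (head_id n (head_idx (PV Z n)))) d"
    using sem_pred_inst[OF wfB(2), of n _ TV head_env X] d by simp
  finally have "subty E A ?B"
    using assms(1)[of "head_id n (head_idx (PV Z n))"] A \<open>wf_ty ?B\<close> by (intro dle_subty) simp_all
  then have "subty E A (AllP Z n ?B)" by (rule subty.allP_r) (rule Z)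
  from subty_dle[OF this] A \<open>wf_ty ?B\<close> show ?thesis
    using to_db_open_pred[OF wfB(2), of Z n X] Z C B by (simp del: to_db.simps)
qed

subsection \<open>Closure under substitution and monotonicity\<close>

text \<open>The fixed point as an image for its own bound head: it is applied to its parameters, and
  its body is lifted past them.\<close>

definition mu_abs :: "nat \<Rightarrow> dty \<Rightarrow> dty" where
  "mu_abs n d = DMu (lift_abs n n d) (map TV [0..<n])"

definition db_unfold :: "dty \<Rightarrow> trm list \<Rightarrow> dty" where
  "db_unfold d ts = dsubst (consl ts TV) (hcons (length ts) (mu_abs (length ts) d)) d"

lemma good_hcons: "good F \<Longrightarrow> good (hcons n F m i)"
  using hcons_cases[of n F m i] by auto

lemma good_mu_abs: "good (DMu d ts) \<Longrightarrow> length ts = n \<Longrightarrow> good (mu_abs n d)"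
  by (simp add: mu_abs_def)

lemma mu_abs_inst:
  assumes "length us = n"
  shows "dsubT (consl us TV) (mu_abs n d) = DMu d us"
proof -
  have "(\<lambda>i. tsub (upT n (consl us TV)) (upT n (\<lambda>i. TV (i + n)) i)) = TV"
    using assms by (auto simp: tsub_upT_upT consl_def fun_eq_iff)
  moreover have "map (tsub (consl us TV)) (map TV [0..<n]) = us"
    using map_nth_consl[OF assms, of TV] by (simp add: comp_def)
  ultimately show ?thesis by (simp add: mu_abs_def lift_abs_def dsubT_dsubT del: map_map)
qed

lemma good_to_db_env: "arity_ok A \<Longrightarrow> good (db A) \<Longrightarrow> good (to_db e r A)"
  by (subst to_db_env) (auto intro: good_dsubst)

lemma sem_abs_Mu:
  assumes "arity_ok D" "distinct xs"
  shows "sem_abs \<sigma> \<tau> xs (Mu c xs D (map TV xs)) = mu_abs (length xs) (sem_mu \<sigma> \<tau> c xs D)"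
proof -
  let ?n = "length xs" let ?t = "\<lambda>n i. \<tau> (idx_head n i)"
  let ?s = "\<lambda>y. if y \<in> set xs then TV (pos xs y) else tsub (\<lambda>j. TV (j + ?n)) (\<sigma> y)"
  let ?d = "to_db (up_env xs (\<lambda>y. y)) (up_head (PS c ?n) head_idx) D"
  have "sem_abs \<sigma> \<tau> xs (Mu c xs D (map TV xs)) =
      DMu (sem_mu ?s (\<lambda>h. lift_abs ?n (arity h) (\<tau> h)) c xs D) (map (tsub ?s) (map TV xs))"
    unfolding sem_abs_def by (rule sem_Mu) simp
  also have "map (tsub ?s) (map TV xs) = map TV (map (pos xs) xs)" by simp
  also have "\<dots> = map TV [0..<?n]" using assms(2) by (simp add: map_pos_distinct)
  also have "sem_mu ?s (\<lambda>h. lift_abs ?n (arity h) (\<tau> h)) c xs D = dsubst (upT ?n ?s) (upH ?n (liftH ?n (liftH ?n ?t))) ?d"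
    by (simp add: sem_mu_def liftH_def[of _ ?t, abs_def])
  also have "\<dots> = dsubst (\<lambda>i. tsub (upT ?n (\<lambda>i. TV (i + ?n))) (upT ?n \<sigma> i)) (upH ?n (liftH ?n (liftH ?n ?t))) ?d"
  proof (rule dsubst_cong)
    fix i assume "i \<in> dfv ?d"
    with matches_fv2[OF matches_to_db[OF assms(1)]] obtain y where "up_env xs (\<lambda>y. y) y = i" by blast
    then show "upT ?n ?s i = tsub (upT ?n (\<lambda>i. TV (i + ?n))) (upT ?n \<sigma> i)"
      unfolding tsub_upT_upT by (auto simp: up_env_def upT_def pos_less split: if_splits)
  qed simp
  also have "\<dots> = lift_abs ?n ?n (sem_mu \<sigma> \<tau> c xs D)"
    unfolding sem_mu_def lift_abs_def dsubT_dsubst by (simp only: upH_dsubT[symmetric] liftH_liftH_swap)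
  finally show ?thesis by (simp add: mu_abs_def)
qed

text \<open>The type \<open>A\<close> in which the fixed point is substituted is kept apart from its
  body \<open>D\<close>: \<open>A = D\<close> gives the unfolding, \<open>A = rep_ty D\<close> the
  representative.\<close>

lemma db_unfold_at:
  assumes "wf_ty (Mu c xs D us)" "db (Mu c xs D us) = DMu d ts" "arity_ok A"
  shows "db (substT (updl TV xs us)
      (subst TV ((\<lambda>_. None)(PS c (length xs) := Some (xs, Mu c xs D (map TV xs)))) A)) =
    dsubst (consl ts TV) (hcons (length ts) (mu_abs (length ts) d))
      (to_db (up_env xs (\<lambda>y. y)) (up_head (PS c (length xs)) head_idx) A)"
proof -
  let ?n = "length xs" let ?M = "Mu c xs D (map TV xs)"
  have D: "arity_ok D" "distinct xs" "length us = ?n" and M: "arity_ok ?M"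
    using assms(1) wf_good[of D] by auto
  have ts: "ts = us" using assms(2) by simp
  have d: "sem_mu TV head_env c xs D = d"
    using sem_Mu[OF D(3), of TV head_env c D] assms(2) by simp
  have "sem_abs (updl TV xs us) head_env xs ?M = sem_abs TV head_env xs ?M"
    by (rule sem_abs_cong) (use D in \<open>simp add: updl_pos\<close>)
  moreover have "sem_mu TV head_env c xs A = to_db (up_env xs (\<lambda>y. y)) (up_head (PS c ?n) head_idx) A"
    by (simp add: sem_mu_def head_env_def)
  moreover have "arity_ok (subst TV ((\<lambda>_. None)(PS c ?n := Some (xs, ?M))) A)"
    using to_db_subst(2)[OF assms(3) abstrs_ok_upd[of xs "PS c ?n" ?M]] M by simp
  ultimately show ?thesis
    using sem_mu_inst[OF assms(3) D(3), of "mu_abs ?n d" TV head_env c] assms(3) M D d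
      sem_substT[of "subst TV ((\<lambda>_. None)(PS c ?n := Some (xs, ?M))) A" TV head_env "updl TV xs us"]
      sem_subst1[OF assms(3), of xs "PS c ?n" ?M "updl TV xs us" head_env]
    by (simp add: sem_abs_Mu ts)
qed

lemma db_unfold_mu:
  assumes "wf_ty (Mu c xs D us)" "db (Mu c xs D us) = DMu d ts"
  shows "db (unfold_mu c xs D us) = db_unfold d ts" "wf_ty (unfold_mu c xs D us)"
proof -
  have D: "wf_ty D" "arity_ok D" "wf_ty (Mu c xs D (map TV xs))"
    using assms(1) wf_good[of D] by auto
  show "db (unfold_mu c xs D us) = db_unfold d ts"
    using db_unfold_at[OF assms D(2)] assms(2) by (simp add: unfold_mu_def db_unfold_def)
  show "wf_ty (unfold_mu c xs D us)"
    unfolding unfold_mu_def by (intro wf_substT wf_subst1) (use D in auto)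
qed

lemma dle_fold: "good (DMu d ts) \<Longrightarrow> dle E (db_unfold d ts) (DMu d ts)"
  and dle_unfold: "good (DMu d ts) \<Longrightarrow> dle E (DMu d ts) (db_unfold d ts)"
proof -
  assume "good (DMu d ts)"
  from ex_good[OF this] obtain C where C: "wf_ty C" "db C = DMu d ts" by auto
  then obtain c xs D us where "C = Mu c xs D us" by (cases C) auto
  with C db_unfold_mu[of c xs D us d ts] subty.fold[of c xs D us E] subty.unfold[of c xs D us E]
  show "dle E (db_unfold d ts) (DMu d ts)" "dle E (DMu d ts) (db_unfold d ts)"
    unfolding dle_def by metis+
qed

text \<open>The instance of the premise at a list of names \<open>xs\<close> is the premise of the
  named rule. Both \<open>xs\<close> and \<open>c\<close> are chosen fresh, so that \<open>d\<close>
  and \<open>F\<close> can be named over the same parameters.\<close>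

lemma dle_ind:
  assumes "\<And>us. length us = n \<Longrightarrow> dle E (dsubst (consl us TV) (hcons n F) d) (dsubT (consl us TV) F)"
    and "good (DMu d ts)" "length ts = n" "good F"
  shows "dle E (DMu d ts) (dsubT (consl ts TV) F)"
proof -
  have "good d" using assms by simp
  have "finite ({y. y + n \<in> dfv d} \<union> {y. y + n \<in> dfv F})" using finite_shift by simp
  from fresh_names[OF this, of n] obtain xs where xs: "length xs = n" "distinct xs"
    "set xs \<inter> {y. y + length xs \<in> dfv d} = {}" "set xs \<inter> {y. y + length xs \<in> dfv F} = {}" by blast
  from ex_rep_open[OF assms(4) xs(2,4)] obtain G where G: "arity_ok G" "dist_mu G" "to_db (up_env xs (\<lambda>y. y)) head_idx G = F"
    by auto
  let ?H = "(\<lambda>(m, i). idx_head m i) ` dfhd (DMu d ts)"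
  have "finite ?H" by (intro finite_imageI finite_dfhd)
  from ex_new_if_finite[OF infinite_UNIV_nat finite_psnames[OF this]]
  obtain c where "c \<notin> psnames ?H" by blast
  then have c: "PS c n \<notin> ?H" by (auto simp: psnames_def)
  have "\<exists>D. arity_ok D \<and> dist_mu D \<and> to_db (up_env xs (\<lambda>y. y)) (up_head (PS c n) head_idx) D = d"
  proof (rule ex_rep)
    show "\<forall>i\<in>dfv d. \<exists>y. up_env xs (\<lambda>y. y) y = i"
      using up_env_cover[OF xs(2,3)] by blast
    show "\<forall>(m, i)\<in>dfhd d. \<exists>h. arity h = m \<and> up_head (PS c n) head_idx h = i"
    proof clarify
      fix m i assume mi: "(m, i) \<in> dfhd d"
      show "\<exists>h. arity h = m \<and> up_head (PS c n) head_idx h = i"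
      proof (cases rule: shift_idx_cases[of m n i])
        case 1
        then show ?thesis by (intro exI[of _ "PS c n"]) (simp add: up_head_simps)
      next
        case (2 j)
        with mi assms(3) have "(m, j) \<in> dfhd (DMu d ts)" by simp
        then have "idx_head m j \<in> ?H" by force
        with c have "idx_head m j \<noteq> PS c n" by metis
        with 2 show ?thesis by (intro exI[of _ "idx_head m j"]) (simp add: up_head_simps)
      qed
    qed
  qed (use \<open>good d\<close> in \<open>simp add: good_def\<close>)
  then obtain D where D: "arity_ok D" "dist_mu D" "to_db (up_env xs (\<lambda>y. y)) (up_head (PS c n) head_idx) D = d" by auto
  have wfG: "wf_ty G" using G assms(4) wf_good by blast
  have wfD: "wf_ty D" using D \<open>good d\<close> wf_good by blast
  let ?M = "Mu c xs D ts"
  have TM: "db ?M = DMu d ts" using D xs by simp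
  have wfM: "wf_ty ?M"
    using wf_good[of ?M "\<lambda>y. y" head_idx] assms D xs TM by simp
  let ?A = "subst TV ((\<lambda>_. None)(PS c n := Some (xs, G))) D"
  have d: "sem_mu TV head_env c xs D = d"
    using sem_Mu[of ts xs TV head_env c D] assms(3) xs TM by simp
  have upd: "updl TV xs (map TV xs) = TV"
    by (auto simp: fun_eq_iff updl_pos nth_pos pos_less)
  have "db ?A = sem TV (head_env(PS c n := F)) D"
    using sem_subst1[OF D(1), of xs "PS c n" G TV head_env] G xs by (simp add: sem_abs_id)
  also have "\<dots> = dsubst (consl (map TV xs) TV) (hcons n F) d"
    using sem_mu_inst[OF D(1), of "map TV xs" xs F TV head_env c] xs d by (simp add: upd)
  finally have TA: "db ?A = dsubst (consl (map TV xs) TV) (hcons n F) d" .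
  have "substT TV G = G" by (simp add: substT_subst subst_id)
  then have TG: "db G = dsubT (consl (map TV xs) TV) F"
    using to_db_open_inst[OF G(1), of "map TV xs" xs] G by (simp add: upd)
  have "subty E ?A G"
    by (rule dle_subty) (use TA TG assms(1)[of "map TV xs"] xs wfD wfG in \<open>simp_all add: wf_subst1\<close>)
  then have "subty E ?M (substT (updl TV xs ts) G)"
    using subty.ind[OF wfM wfG, of E] xs by simp
  from subty_dle[OF this wfM wf_substT[OF wfG]] show ?thesis
    using TM to_db_open_inst[OF G(1), of ts xs] G assms(3) xs by simp
qed

lemma updl_tsub: "length us = length xs \<Longrightarrow> (\<lambda>y. tsub \<sigma> (updl TV xs us y)) = updl \<sigma> xs (map (tsub \<sigma>) us)"
  by (auto simp: fun_eq_iff updl_pos pos_less)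

text \<open>Lifting the body past the parameters commutes with substituting underneath them, by the
  same exchange of lifts as in \<open>sem_abs_Mu\<close>.\<close>

lemma dsubst_mu_abs:
  assumes "n = length ts" "DMu d' ts' = dsubst s t (DMu d ts)"
  shows "dsubst (upT n s) (liftH n t) (mu_abs n d) = mu_abs n d'"
proof -
  have d': "d' = dsubst (upT n s) (upH n (liftH n t)) d" using assms by simp
  have "lift_abs n n d' = dsubst (\<lambda>i. tsub (upT n (\<lambda>i. TV (i + n))) (upT n s i))
      (\<lambda>m i. dsubT (upT m (upT n (\<lambda>i. TV (i + n)))) (upH n (liftH n t) m i)) d"
    unfolding d' lift_abs_def dsubT_dsubst ..
  also have "(\<lambda>m i. dsubT (upT m (upT n (\<lambda>i. TV (i + n)))) (upH n (liftH n t) m i)) = upH n (liftH n (liftH n t))"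
    by (simp only: upH_dsubT[symmetric] liftH_liftH_swap)
  finally have "dsubst (upT n (upT n s)) (upH n (liftH n (liftH n t))) (lift_abs n n d) = lift_abs n n d'"
    unfolding lift_abs_def dsubst_dsubT upT_k_shift by simp
  moreover have "map (tsub (upT n s)) (map TV [0..<n]) = map TV [0..<n]" by (rule upT_params)
  ultimately show ?thesis by (simp only: mu_abs_def dsubst.simps length_map length_upt) simp
qed

text \<open>The type \<open>a\<close> is arbitrary to cover unfoldings, with \<open>a = d\<close>,
  as well as representatives, with \<open>a = drep d\<close>.\<close>

lemma dsubst_db_unfold_at:
  assumes "DMu d' ts' = dsubst s t (DMu d ts)" "length ts = n"
  shows "dsubst s t (dsubst (consl ts TV) (hcons n (mu_abs n d)) a) =
    dsubst (consl ts' TV) (hcons n (mu_abs n d')) (dsubst (upT n s) (upH n (liftH n t)) a)"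
proof -
  have ts': "ts' = map (tsub s) ts" using assms by simp
  have "compH s t (hcons n (mu_abs n d)) = hcons_env n (mu_abs n d') t"
    by (rule hfun_eqI[of _ n])
      (use assms(2) in \<open>simp_all add: compH_def compH_head_id dsubst_mu_abs[OF _ assms(1)]\<close>)
  with assms(2) show ?thesis by (simp add: ts' dsubst_dsubst[of s] tsub_consl' dsubst_inst_mu)
qed

lemma dsubst_db_unfold:
  assumes "DMu d' ts' = dsubst s t (DMu d ts)"
  shows "dsubst s t (db_unfold d ts) = db_unfold d' ts'"
  using dsubst_db_unfold_at[OF assms HOL.refl] assms by (simp add: db_unfold_def)

lemma good_sem_abs: "arity_ok F \<Longrightarrow> good (db F) \<Longrightarrow> (\<And>h. good (\<tau> h)) \<Longrightarrow> good (sem_abs \<sigma> \<tau> ys F)"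
  by (simp add: sem_abs_def good_sem)

lemma sem_unfold:
  assumes "wf_ty (Mu c xs D ts)"
  shows "(\<And>h. good (\<tau> h)) \<Longrightarrow> \<exists>d us. good (DMu d us) \<and> sem \<sigma> \<tau> (Mu c xs D ts) = DMu d us \<and>
      sem \<sigma> \<tau> (unfold_mu c xs D ts) = db_unfold d us"
    and "arity_ok (unfold_mu c xs D ts)" "arity_ok (Mu c xs D ts)"
proof -
  obtain d us where db: "db (Mu c xs D ts) = DMu d us" by simp
  note db_unfold = db_unfold_mu[OF assms db]
  show "arity_ok (unfold_mu c xs D ts)" "arity_ok (Mu c xs D ts)"
    using db_unfold(2) assms wf_good by blast+
  have "good (db (Mu c xs D ts))" using assms wf_good by blast
  then have good: "(\<And>h. good (\<tau> h)) \<Longrightarrow> good (sem \<sigma> \<tau> (Mu c xs D ts))" by (rule good_sem)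
  obtain d' us' where e: "sem \<sigma> \<tau> (Mu c xs D ts) = DMu d' us'" unfolding sem_def db by simp
  then have "sem \<sigma> \<tau> (unfold_mu c xs D ts) = db_unfold d' us'"
    using dsubst_db_unfold[of d' us' \<sigma> "\<lambda>n i. \<tau> (idx_head n i)" d us]
    by (simp add: sem_def db_unfold db del: to_db.simps dsubst.simps)
  with e good show "(\<And>h. good (\<tau> h)) \<Longrightarrow> \<exists>d us. good (DMu d us) \<and> sem \<sigma> \<tau> (Mu c xs D ts) = DMu d us \<and>
      sem \<sigma> \<tau> (unfold_mu c xs D ts) = db_unfold d us" by metis
qed

text \<open>With all valuations inside the induction, closure of \<open>dle\<close> under
  substitution is just a reading of the result. The conjuncts \<open>arity_ok\<close> are carried
  along because the laws of \<open>sem\<close> need them and the types in a derivation are not known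
  to be well-formed.\<close>

lemma subty_sem:
  "subty E A B \<Longrightarrow> arity_ok A \<and> arity_ok B \<and> (\<forall>\<sigma> \<tau>. (\<forall>h. good (\<tau> h)) \<longrightarrow> dle E (sem \<sigma> \<tau> A) (sem \<sigma> \<tau> B))"
proof (induction rule: subty.induct)
  case (refl A)
  then have "arity_ok A" "good (db A)" using wf_good by auto
  then show ?case by (auto intro!: dle_refl good_sem)
next
  case (arr A A' B B')
  then show ?case by (auto simp: sem_def intro: dle_imp)
next
  case (allV_l x t A B)
  then have A: "arity_ok A" by simp
  show ?case
  proof (intro conjI allI impI)
    fix \<sigma> \<tau> assume "\<forall>h. good ((\<tau> :: head \<Rightarrow> dty) h)"
    with allV_l have "dle E (sem \<sigma> \<tau> (substT (TV(x := t)) A)) (sem \<sigma> \<tau> B)" by blast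
    moreover have "(\<lambda>y. tsub \<sigma> ((TV(x := t)) y)) = updl \<sigma> [x] [tsub \<sigma> t]"
      by (auto simp: updl_single fun_eq_iff)
    ultimately show "dle E (sem \<sigma> \<tau> (AllV x A)) (sem \<sigma> \<tau> B)"
      using A sem_abs_inst[OF A, of "[tsub \<sigma> t]" "[x]" \<sigma> \<tau>]
      by (simp add: sem_substT sem_AllV) (metis dle_allV_l)
  qed (use allV_l in simp_all)
next
  case (allP_l X n ys F A B)
  then have A: "arity_ok A" "good (db A)" and F: "arity_ok F" "good (db F)" using wf_good[of A] wf_good[of F] by auto
  show ?case
  proof (intro conjI allI impI)
    fix \<sigma> \<tau> assume good: "\<forall>h. good ((\<tau> :: head \<Rightarrow> dty) h)"
    with allP_l have dle: "dle E (sem \<sigma> \<tau> (subst TV ((\<lambda>_. None)(PV X n := Some (ys, F))) A)) (sem \<sigma> \<tau> B)" by blast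
    have "good (sem \<sigma> \<tau> (AllP X n A))" using good good_to_db_env[OF A] by (intro good_sem) auto
    then have "good (sem_pred \<sigma> \<tau> X n A)" by (simp add: sem_AllP)
    moreover have "good (sem_abs \<sigma> \<tau> ys F)" using good F by (intro good_sem_abs) auto
    ultimately show "dle E (sem \<sigma> \<tau> (AllP X n A)) (sem \<sigma> \<tau> B)"
      unfolding sem_AllP using dle A F allP_l
      by (intro dle_allP_l[of E n "sem_abs \<sigma> \<tau> ys F"]) (simp_all add: sem_pred_inst sem_subst1)
  qed (use allP_l A in simp_all)
next
  case (allV_r A B x)
  then have B: "arity_ok B" and A: "arity_ok A" by auto
  show ?case
  proof (intro conjI allI impI)
    fix \<sigma> \<tau> assume good: "\<forall>h. good ((\<tau> :: head \<Rightarrow> dty) h)"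
    show "dle E (sem \<sigma> \<tau> A) (sem \<sigma> \<tau> (AllV x B))"
      unfolding sem_AllV[OF B]
    proof (rule dle_allV_r)
      fix u
      have "dle E (sem (updl \<sigma> [x] [u]) \<tau> A) (sem (updl \<sigma> [x] [u]) \<tau> B)" using good allV_r by blast
      moreover have "sem (updl \<sigma> [x] [u]) \<tau> A = sem \<sigma> \<tau> A"
        by (rule sem_cong) (use allV_r A in \<open>auto simp: updl_single\<close>)
      ultimately show "dle E (sem \<sigma> \<tau> A) (dsubT (consl [u] TV) (sem_abs \<sigma> \<tau> [x] B))"
        by (simp add: sem_abs_inst[OF B])
    qed
  qed (use A B in simp_all)
next
  case (allP_r A B X n)
  then have B: "arity_ok B" and A: "arity_ok A" by auto
  \<comment> \<open>\<open>dle_allP_r\<close> asks for \<open>good\<close> bodies; that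
    \<open>B\<close> has one is read off the induction hypothesis at the identity valuation.\<close>
  have "dle E (sem TV head_env A) (sem TV head_env B)" using allP_r by (simp add: head_env_def del: sem_id)
  then have "good (db B)" using dle_good by simp
  show ?case
  proof (intro conjI allI impI)
    fix \<sigma> \<tau> assume good: "\<forall>h. good ((\<tau> :: head \<Rightarrow> dty) h)"
    show "dle E (sem \<sigma> \<tau> A) (sem \<sigma> \<tau> (AllP X n B))"
      unfolding sem_AllP
    proof (rule dle_allP_r)
      fix F assume "good F"
      with good allP_r have "dle E (sem \<sigma> (\<tau>(PV X n := F)) A) (sem \<sigma> (\<tau>(PV X n := F)) B)" by simp
      moreover have "sem \<sigma> (\<tau>(PV X n := F)) A = sem \<sigma> \<tau> A"
        by (rule sem_cong) (use allP_r A in auto)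
      ultimately show "dle E (sem \<sigma> \<tau> A) (dsubst TV (hcons n F) (sem_pred \<sigma> \<tau> X n B))"
        by (simp add: sem_pred_inst[OF B])
    next
      have "good (sem \<sigma> \<tau> (AllP X n B))"
        using good good_to_db_env[OF B \<open>good (db B)\<close>] by (intro good_sem) auto
      then show "good (sem_pred \<sigma> \<tau> X n B)" by (simp add: sem_AllP)
    qed
  qed (use A B in simp_all)
next
  case (eq A y v B w)
  then have A: "arity_ok A" and B: "arity_ok B" by auto
  have s: "(\<lambda>z. tsub \<sigma> (if z = y then u else TV z)) = updl \<sigma> [y] [tsub \<sigma> u]" for \<sigma> u
    by (auto simp: updl_single fun_eq_iff)
  show ?case
  proof (intro conjI allI impI)
    fix \<sigma> \<tau> assume good: "\<forall>h. good ((\<tau> :: head \<Rightarrow> dty) h)"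
    with eq have "dle E (sem \<sigma> \<tau> A) (sem \<sigma> \<tau> (substT (TV(y := v)) B))" by blast
    then have "dle E (sem \<sigma> \<tau> A) (dsubT (consl [tsub \<sigma> v] TV) (sem_abs \<sigma> \<tau> [y] B))"
      by (simp add: sem_substT[OF B] sem_abs_inst[OF B] s)
    then have "dle E (sem \<sigma> \<tau> A) (dsubT (consl [tsub \<sigma> w] TV) (sem_abs \<sigma> \<tau> [y] B))"
      using eq_inst_tsub[OF eq.hyps(2)] by (rule dle_eq)
    then show "dle E (sem \<sigma> \<tau> A) (sem \<sigma> \<tau> (substT (TV(y := w)) B))"
      by (simp add: sem_substT[OF B] sem_abs_inst[OF B] s)
  qed (use A B in simp_all)
next
  case (trans A B C)
  then show ?case by (blast intro: dle_trans)
next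
  case (fold c xs D ts)
  then show ?case using sem_unfold(2,3)[OF fold] by (metis dle_fold sem_unfold(1))
next
  case (unfold c xs D ts)
  then show ?case using sem_unfold(2,3)[OF unfold] by (metis dle_unfold sem_unfold(1))
next
  case (ind c xs D ts F)
  let ?n = "length xs"
  have D: "arity_ok D" "length ts = ?n" and F: "arity_ok F" "good (db F)" and gdM: "good (db (Mu c xs D ts))"
    using ind(1,2) wf_good[of D] wf_good[of F] wf_good[of "Mu c xs D ts"] by auto
  have "dle E (sem \<sigma> \<tau> (Mu c xs D ts)) (sem \<sigma> \<tau> (substT (updl TV xs ts) F))" if good: "\<forall>h. good (\<tau> h)" for \<sigma> \<tau>
  proof -
    let ?F = "sem_abs \<sigma> \<tau> xs F"
    have "good (sem \<sigma> \<tau> (Mu c xs D ts))" using gdM good by (intro good_sem) auto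
    then have gdM': "good (DMu (sem_mu \<sigma> \<tau> c xs D) (map (tsub \<sigma>) ts))" by (simp add: sem_Mu[OF D(2)])
    have "dle E (DMu (sem_mu \<sigma> \<tau> c xs D) (map (tsub \<sigma>) ts)) (dsubT (consl (map (tsub \<sigma>) ts) TV) ?F)"
    proof (rule dle_ind[OF _ gdM'])
      fix us :: "trm list" assume us: "length us = ?n"
      \<comment> \<open>The induction hypothesis is used at the valuation that sends the parameters
        to \<open>us\<close>; the abstraction \<open>?F\<close> does not depend on these
        values.\<close>
      let ?\<sigma> = "updl \<sigma> xs us"
      have "dle E (sem ?\<sigma> \<tau> (subst TV ((\<lambda>_. None)(PS c ?n := Some (xs, F))) D)) (sem ?\<sigma> \<tau> F)"
        using ind.IH good by blast
      moreover have "sem_abs ?\<sigma> \<tau> xs F = ?F"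
        by (rule sem_abs_cong) (use us in \<open>simp add: updl_pos\<close>)
      ultimately show "dle E (dsubst (consl us TV) (hcons ?n ?F) (sem_mu \<sigma> \<tau> c xs D)) (dsubT (consl us TV) ?F)"
        using us D F by (simp add: sem_subst1 sem_mu_inst sem_abs_inst)
    next
      show "good ?F" using F good by (intro good_sem_abs) auto
    qed (use D in simp)
    moreover have "sem \<sigma> \<tau> (substT (updl TV xs ts) F) = dsubT (consl (map (tsub \<sigma>) ts) TV) ?F"
      using D F by (simp add: sem_substT sem_abs_inst updl_tsub)
    ultimately show ?thesis by (simp add: sem_Mu[OF D(2)])
  qed
  with D F show ?case by simp
qed

lemma dle_dsubst:
  assumes "dle E a b" "\<And>n i. good (t n i)"
  shows "dle E (dsubst s t a) (dsubst s t b)"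
proof -
  from assms(1) obtain A B where "db A = a" "db B = b" "subty E A B" unfolding dle_def by blast
  moreover have "sem s (\<lambda>h. t (arity h) (head_idx h)) A = dsubst s t (db A)" for A by (simp add: sem_def)
  ultimately show ?thesis using subty_sem[of E A B] assms(2) by metis
qed

lemma dle_dsubT: "dle E a b \<Longrightarrow> dle E (dsubT s a) (dsubT s b)"
  using dle_dsubst[of E a b head_id s] by (simp add: dsubst_head_id)

lemma dle_shift_head: "dle E a b \<Longrightarrow> dle E (shift_head n a) (shift_head n b)"
proof -
  have "shift_head n d = dsubst TV (\<lambda>m i. head_id m (shift_idx n m i)) d" for d
    using dsubst_hren[of TV head_id "shift_idx n" d] by simp
  then show "dle E a b \<Longrightarrow> dle E (shift_head n a) (shift_head n b)" using dle_dsubst[of E a b] by simp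
qed

lemma dle_DAll: "dle E a b \<Longrightarrow> dle E (DAll a) (DAll b)"
  by (rule dle_allV_r, rule dle_allV_l) (rule dle_dsubT)

lemma dle_DAllP: "dle E a b \<Longrightarrow> dle E (DAllP n a) (DAllP n b)"
  by (rule dle_allP_r, rule dle_allP_l) (auto dest: dle_good intro: dle_dsubst good_hcons)

text \<open>Induction with the larger fixed point as invariant: substituting it in
  \<open>a \<le> b\<close> bounds the unfolded left body by the unfolding of the right fixed point,
  which folds back.\<close>

lemma dle_DMu:
  assumes "dle E a b" "good (DMu a ts)" "good (DMu b ts)"
  shows "dle E (DMu a ts) (DMu b ts)"
proof -
  let ?n = "length ts"
  have "dle E (DMu a ts) (dsubT (consl ts TV) (mu_abs ?n b))"
  proof (rule dle_ind)
    fix us :: "trm list" assume us: "length us = ?n"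
    have gdb: "good (mu_abs ?n b)" using good_mu_abs[OF assms(3)] by simp
    have "dle E (dsubst (consl us TV) (hcons ?n (mu_abs ?n b)) a) (db_unfold b us)"
      unfolding db_unfold_def us using assms(1) gdb by (intro dle_dsubst good_hcons)
    moreover have "dle E (db_unfold b us) (DMu b us)" using assms(3) us by (intro dle_fold) simp
    ultimately show "dle E (dsubst (consl us TV) (hcons ?n (mu_abs ?n b)) a) (dsubT (consl us TV) (mu_abs ?n b))"
      unfolding mu_abs_inst[OF us] by (rule dle_trans)
  qed (use assms good_mu_abs[OF assms(3)] in simp_all)
  then show ?thesis by (simp add: mu_abs_inst)
qed

section \<open>Monotonicity in positive heads\<close>

definition mono_rel_at :: "(trm \<times> trm) set \<Rightarrow> nat \<Rightarrow> nat \<Rightarrow> dty \<Rightarrow> dty \<Rightarrow> dty \<Rightarrow> bool" where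
  "mono_rel_at E n i F1 F2 d \<longleftrightarrow> (dle E F1 F2 \<and> dle E F2 F1) \<or>
     (polar True n i d \<and> dle E F1 F2) \<or> (polar False n i d \<and> dle E F2 F1)"

text \<open>The alternative of mutual subtyping in \<open>mono_rel_at\<close> covers heads of mixed
  polarity; in particular, the heads bound inside \<open>d\<close> keep equal images on both
  sides.\<close>

definition mono_rel :: "(trm \<times> trm) set \<Rightarrow> (nat \<Rightarrow> nat \<Rightarrow> dty) \<Rightarrow> (nat \<Rightarrow> nat \<Rightarrow> dty) \<Rightarrow> dty \<Rightarrow> bool" where
  "mono_rel E t1 t2 d \<longleftrightarrow> (\<forall>n i. (n, i) \<in> dfhd d \<longrightarrow> mono_rel_at E n i (t1 n i) (t2 n i) d)"

lemma mono_relI: "(\<And>n i. (n, i) \<in> dfhd d \<Longrightarrow> mono_rel_at E n i (t1 n i) (t2 n i) d) \<Longrightarrow> mono_rel E t1 t2 d"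
  by (simp add: mono_rel_def)

lemma mono_rel_at_refl: "good F \<Longrightarrow> mono_rel_at E n i F F d"
  by (simp add: mono_rel_at_def dle_refl)

lemma dle_mono:
  assumes "good d" "\<And>n i. good (t1 n i)" "\<And>n i. good (t2 n i)" "mono_rel E t1 t2 d"
  shows "dle E (dsubst s t1 d) (dsubst s t2 d)"
  using assms
proof (induction d arbitrary: s t1 t2)
  case DBot
  then show ?case by (simp add: dle_refl)
next
  case (DAt i ts)
  then have "dle E (t1 (length ts) i) (t2 (length ts) i)" by (auto simp: mono_rel_def mono_rel_at_def)
  then show ?case by (simp add: dle_dsubT)
next
  case (DImp a b)
  have "mono_rel E t2 t1 a" "mono_rel E t1 t2 b" using DImp.prems(4) by (auto simp: mono_rel_def mono_rel_at_def)
  with DImp have "dle E (dsubst s t2 a) (dsubst s t1 a)" "dle E (dsubst s t1 b) (dsubst s t2 b)" by auto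
  then show ?case by (auto intro: dle_imp)
next
  case (DAll d)
  have "mono_rel E (liftH 1 t1) (liftH 1 t2) d"
    using DAll.prems(4) by (auto simp: mono_rel_def mono_rel_at_def liftH_def lift_abs_def intro: dle_dsubT)
  with DAll show ?case by (auto intro!: dle_DAll simp: liftH_def)
next
  case (DAllP n d)
  have gdH: "good (upH n t m i)" if "\<And>m i. good (t m i)" for t m i
    using that by (cases rule: shift_idx_cases[of m n i]) (auto simp: upH_0 upH_shift_idx)
  have "mono_rel E (upH n t1) (upH n t2) d"
  proof (rule mono_relI)
    fix m i assume mi: "(m, i) \<in> dfhd d"
    show "mono_rel_at E m i (upH n t1 m i) (upH n t2 m i) d"
    proof (cases rule: shift_idx_cases[of m n i])
      case 1
      then show ?thesis by (simp add: upH_0 mono_rel_at_refl)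
    next
      case (2 j)
      with mi DAllP.prems(4) show ?thesis by (auto simp: mono_rel_def mono_rel_at_def upH_shift_idx intro: dle_shift_head)
    qed
  qed
  with DAllP gdH show ?case by (auto intro!: dle_DAllP)
next
  case (DMu d ts)
  let ?n = "length ts"
  let ?t1 = "upH ?n (liftH ?n t1)" let ?t2 = "upH ?n (liftH ?n t2)"
  have gdH: "good (upH ?n (liftH ?n t) m i)" if "\<And>m i. good (t m i)" for t m i
    using that by (cases rule: shift_idx_cases[of m ?n i]) (auto simp: upH_0 upH_shift_idx liftH_def)
  have lift_abs: "dle E a b \<Longrightarrow> dle E (shift_head ?n (lift_abs ?n m a)) (shift_head ?n (lift_abs ?n m b))" for a b m
    unfolding lift_abs_def by (intro dle_shift_head dle_dsubT)
  have "mono_rel E ?t1 ?t2 d"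
  proof (rule mono_relI)
    fix m i assume mi: "(m, i) \<in> dfhd d"
    show "mono_rel_at E m i (?t1 m i) (?t2 m i) d"
    proof (cases rule: shift_idx_cases[of m ?n i])
      case 1
      then show ?thesis by (simp add: upH_0 mono_rel_at_refl)
    next
      case (2 j)
      with mi DMu.prems(4) show ?thesis by (auto simp: mono_rel_def mono_rel_at_def upH_shift_idx liftH_def intro: lift_abs)
    qed
  qed
  with DMu gdH have "dle E (dsubst (upT ?n s) ?t1 d) (dsubst (upT ?n s) ?t2 d)" by auto
  moreover have "good (dsubst s t1 (DMu d ts))" "good (dsubst s t2 (DMu d ts))"
    using DMu.prems by (intro good_dsubst; blast)+
  ultimately show ?case using dle_DMu[of E _ _ "map (tsub s) ts"] by (simp del: good_simps)
next
  case (DLit k ts)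
  then show ?case by (simp add: good_def)
qed

subsection \<open>Inversion of subtyping between arrow types\<close>

primrec darrow :: "dty \<Rightarrow> bool" where
  "darrow DBot = False"
| "darrow (DAt i ts) = False"
| "darrow (DImp a b) = True"
| "darrow (DAll a) = darrow a"
| "darrow (DAllP n a) = darrow a"
| "darrow (DMu a ts) = darrow a"
| "darrow (DLit k ts) = False"

text \<open>The shape of a representative. Unlike \<open>darrow\<close> it admits no \<mu> in front
  of the arrow, so an induction along the prefix meets quantifiers only.\<close>

primrec prenex_arrow :: "dty \<Rightarrow> bool" where
  "prenex_arrow DBot = False"
| "prenex_arrow (DAt i ts) = False"
| "prenex_arrow (DImp a b) = True"
| "prenex_arrow (DAll a) = prenex_arrow a"
| "prenex_arrow (DAllP n a) = prenex_arrow a"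
| "prenex_arrow (DMu a ts) = False"
| "prenex_arrow (DLit k ts) = False"

primrec drep :: "dty \<Rightarrow> dty" where
  "drep DBot = DBot"
| "drep (DAt i ts) = DAt i ts"
| "drep (DImp a b) = DImp a b"
| "drep (DAll a) = DAll (drep a)"
| "drep (DAllP n a) = DAllP n (drep a)"
| "drep (DMu a ts) = dsubst (consl ts TV) (hcons (length ts) (mu_abs (length ts) a)) (drep a)"
| "drep (DLit k ts) = DLit k ts"

lemma darrow_to_db [simp]: "darrow (to_db e r A) = is_arrow A"
  by (induction A arbitrary: e r) auto

lemma darrow_dsubst: "darrow d \<Longrightarrow> darrow (dsubst s t d)"
  by (induction d arbitrary: s t) auto

lemma prenex_arrow_dsubst: "prenex_arrow d \<Longrightarrow> prenex_arrow (dsubst s t d)"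
  by (induction d arbitrary: s t) auto

lemma prenex_arrow_drep: "darrow d \<Longrightarrow> prenex_arrow (drep d)"
  by (induction d) (auto intro: prenex_arrow_dsubst)

text \<open>For an arrow type the recursion of \<open>drep\<close> ends at an arrow and never at an
  atom; an atom could be replaced by an arrow type with a representative of its own.\<close>

lemma drep_dsubst: "darrow d \<Longrightarrow> drep (dsubst s t d) = dsubst s t (drep d)"
proof (induction d arbitrary: s t)
  case (DMu d ts)
  then show ?case by (simp add: dsubst_db_unfold_at[OF _ HOL.refl])
qed auto

lemma drep_dsubT: "darrow d \<Longrightarrow> drep (dsubT s d) = dsubT s (drep d)"
  using drep_dsubst[of d s head_id] by (simp add: dsubst_head_id)

lemma good_drep: "good d \<Longrightarrow> good (drep d)"
proof (induction d)
  case (DMu d ts)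
  then show ?case using good_mu_abs[OF DMu.prems HOL.refl] by (auto intro: good_dsubst good_hcons)
qed auto

text \<open>In the case of \<mu> the bound head is positive in \<open>drep d\<close> and its
  replacement \<open>mu_abs\<close> has the polarity of the whole type, so the rule of signs adds no
  occurrence of the wrong sign.\<close>

lemma polar_drep: "good d \<Longrightarrow> polar b m j d \<Longrightarrow> polar b m j (drep d)"
proof (induction d arbitrary: b m j)
  case (DMu d ts)
  let ?n = "length ts"
  have 0: "polar True ?n 0 (drep d)" and 1: "polar b m (shift_idx ?n m j) (drep d)"
    using DMu by simp_all
  have M: "polar b m j (mu_abs ?n d)" using DMu.prems by (simp add: mu_abs_def)
  have "polar_ok b m j (hcons ?n (mu_abs ?n d)) (drep d)"
  proof (rule polar_okI)
    fix n i
    show "polar_ok_at b m j n i (hcons ?n (mu_abs ?n d) n i) (drep d)"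
    proof (cases rule: shift_idx_cases[of n ?n i])
      case 1
      with 0 M show ?thesis by (cases b) (auto simp: polar_ok_at_def)
    next
      case (2 i')
      with 1 show ?thesis by (auto simp: polar_ok_at_def)
    qed
  qed
  then show ?case by (simp add: polar_dsubst)
qed auto

inductive inst_of :: "dty \<Rightarrow> dty \<Rightarrow> dty \<Rightarrow> bool" where
  imp: "inst_of (DImp a b) a b"
| all: "inst_of (dsubT (consl [u] TV) d) a b \<Longrightarrow> inst_of (DAll d) a b"
| allP: "inst_of (dsubst TV (hcons n F) d) a b \<Longrightarrow> good F \<Longrightarrow> inst_of (DAllP n d) a b"

inductive_cases inst_of_impE: "inst_of (DImp a b) g h"
inductive_cases inst_of_allE: "inst_of (DAll d) g h"
inductive_cases inst_of_allPE: "inst_of (DAllP n d) g h"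

lemma inst_of_good: "inst_of d a b \<Longrightarrow> good d \<Longrightarrow> good a \<and> good b"
  by (induction rule: inst_of.induct) (auto simp: good_dsubst good_hcons)

lemma dsubst_var_body: "dsubT (consl [u] TV) (dsubst (upT 1 s) (liftH 1 t) d) = dsubst (consl [u] s) t d"
  by (rule dsubst_inst_var) simp

definition inst_le :: "(trm \<times> trm) set \<Rightarrow> dty \<Rightarrow> dty \<Rightarrow> bool" where
  "inst_le E r1 r2 \<longleftrightarrow> (\<forall>g2 h2. inst_of r2 g2 h2 \<longrightarrow> (\<exists>g1 h1. inst_of r1 g1 h1 \<and> dle E g2 g1 \<and> dle E h1 h2))"

lemma inst_le_refl: "good r \<Longrightarrow> inst_le E r r"
  unfolding inst_le_def using inst_of_good dle_refl by blast

lemma inst_le_trans: "inst_le E a b \<Longrightarrow> inst_le E b c \<Longrightarrow> inst_le E a c"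
  unfolding inst_le_def by (meson dle_trans)

lemma inst_le_imp: "dle E g2 g1 \<Longrightarrow> dle E h1 h2 \<Longrightarrow> inst_le E (DImp g1 h1) (DImp g2 h2)"
  unfolding inst_le_def by (auto elim!: inst_of_impE intro: inst_of.imp)

lemma inst_le_all_l: "inst_le E (dsubT (consl [u] TV) d) r \<Longrightarrow> inst_le E (DAll d) r"
  unfolding inst_le_def by (meson inst_of.all)

lemma inst_le_all_r: "(\<And>u. inst_le E r (dsubT (consl [u] TV) d)) \<Longrightarrow> inst_le E r (DAll d)"
  unfolding inst_le_def by (auto elim!: inst_of_allE)

lemma inst_le_allP_l: "inst_le E (dsubst TV (hcons n F) d) r \<Longrightarrow> good F \<Longrightarrow> inst_le E (DAllP n d) r"
  unfolding inst_le_def by (meson inst_of.allP)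

lemma inst_le_allP_r: "(\<And>F. good F \<Longrightarrow> inst_le E r (dsubst TV (hcons n F) d)) \<Longrightarrow> inst_le E r (DAllP n d)"
  unfolding inst_le_def by (auto elim!: inst_of_allPE)

text \<open>The two substitutions may differ at many variables. All these places are first replaced
  by one new variable, and then a single use of \<open>dle_eq\<close> exchanges \<open>v\<close> for
  \<open>w\<close>.\<close>

lemma dle_dsubst_eq:
  assumes "eq_inst E v w" "\<And>i. s1 i = s2 i \<or> (s1 i = v \<and> s2 i = w)" "good d" "\<And>n i. good (t n i)"
  shows "dle E (dsubst s1 t d) (dsubst s2 t d)"
proof -
  \<comment> \<open>\<open>TV 0\<close> is the new variable; the values on which \<open>s1\<close>
    and \<open>s2\<close> agree are shifted to make room for it.\<close>
  define s where "s i = (if s1 i = s2 i then tsub (\<lambda>j. TV (j + 1)) (s1 i) else TV 0)" for i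
  let ?d = "dsubst s (liftH 1 t) d"
  have inst: "dsubT (consl [u] TV) ?d = dsubst (\<lambda>i. if s1 i = s2 i then s1 i else u) t d" for u
  proof -
    have "tsub (consl [u] TV) (s i) = (if s1 i = s2 i then s1 i else u)" for i
      using tsub_consl_shift[of "[u]" TV] by (simp add: s_def consl_def)
    moreover have "(\<lambda>m i. dsubT (upT m (consl [u] TV)) (liftH 1 t m i)) = t"
      by (auto simp: liftH_def lift_abs_def dsubT_dsubT tsub_upT_upT consl_def fun_eq_iff)
    ultimately show ?thesis by (simp add: dsubT_dsubst)
  qed
  have 1: "(\<lambda>i. if s1 i = s2 i then s1 i else v) = s1" "(\<lambda>i. if s1 i = s2 i then s1 i else w) = s2"
    using assms(2) by (auto simp: fun_eq_iff)
  have "dle E (dsubst s1 t d) (dsubT (consl [v] TV) ?d)"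
    unfolding inst 1 by (rule dle_refl) (use assms in \<open>auto intro: good_dsubst\<close>)
  from dle_eq[OF this assms(1)] show ?thesis unfolding inst 1 .
qed

lemma eq_inst_sym: "eq_inst E v w \<Longrightarrow> eq_inst E w v"
  unfolding eq_inst_def by blast

text \<open>Both sides have the same prefix and receive the same instances. The left component of
  the arrow is contravariant and uses the equation in the opposite direction.\<close>

lemma inst_le_eq:
  assumes "eq_inst E v w" "\<And>i. s1 i = s2 i \<or> (s1 i = v \<and> s2 i = w)" "good r" "\<And>n i. good (t n i)" "prenex_arrow r"
  shows "inst_le E (dsubst s1 t r) (dsubst s2 t r)"
  using assms
proof (induction r arbitrary: s1 s2 t)
  case (DImp a b)
  have "s2 i = s1 i \<or> (s2 i = w \<and> s1 i = v)" for i using DImp.prems(2)[of i] by auto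
  then have "dle E (dsubst s2 t a) (dsubst s1 t a)"
    by (rule dle_dsubst_eq[OF eq_inst_sym[OF DImp.prems(1)]]) (use DImp.prems(3,4) in auto)
  moreover have "dle E (dsubst s1 t b) (dsubst s2 t b)"
    by (rule dle_dsubst_eq[OF DImp.prems(1,2)]) (use DImp.prems(3,4) in auto)
  ultimately show ?case by (simp add: inst_le_imp)
next
  case (DAll d)
  show ?case unfolding dsubst.simps
  proof (rule inst_le_all_r)
    fix u
    have "inst_le E (dsubst (consl [u] s1) t d) (dsubst (consl [u] s2) t d)"
      by (rule DAll.IH) (use DAll.prems in \<open>auto simp: consl_def\<close>)
    then show "inst_le E (DAll (dsubst (upT 1 s1) (liftH 1 t) d)) (dsubT (consl [u] TV) (dsubst (upT 1 s2) (liftH 1 t) d))"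
      by (intro inst_le_all_l[of E u]) (simp only: dsubst_var_body)
  qed
next
  case (DAllP n d)
  show ?case unfolding dsubst.simps
  proof (rule inst_le_allP_r)
    fix F assume F: "good F"
    then have "good (hcons_env n F t m i)" for m i
      using DAllP.prems by (auto simp: hcons_env_def split: nat.split)
    with DAllP.prems have "inst_le E (dsubst s1 (hcons_env n F t) d) (dsubst s2 (hcons_env n F t) d)"
      by (intro DAllP.IH) auto
    then show "inst_le E (DAllP n (dsubst s1 (upH n t) d)) (dsubst TV (hcons n F) (dsubst s2 (upH n t) d))"
      by (intro inst_le_allP_l[OF _ F]) (simp only: dsubst_inst_pred)
  qed
qed auto

text \<open>The prefix is instantiated alike on both sides, so each newly instantiated head has
  equal images, and only the components of the arrow have to be compared, by
  \<open>dle_mono\<close>.\<close>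

lemma inst_le_mono:
  assumes "good r" "\<And>n i. good (t1 n i)" "\<And>n i. good (t2 n i)" "mono_rel E t1 t2 r" "prenex_arrow r"
  shows "inst_le E (dsubst s t1 r) (dsubst s t2 r)"
  using assms
proof (induction r arbitrary: s t1 t2)
  case (DImp a b)
  have "mono_rel E t2 t1 a" "mono_rel E t1 t2 b" using DImp.prems(4) by (auto simp: mono_rel_def mono_rel_at_def)
  with DImp.prems show ?case by (auto intro!: inst_le_imp dle_mono)
next
  case (DAll d)
  show ?case unfolding dsubst.simps
  proof (rule inst_le_all_r)
    fix u
    have "inst_le E (dsubst (consl [u] s) t1 d) (dsubst (consl [u] s) t2 d)"
      by (rule DAll.IH) (use DAll.prems in \<open>auto simp: mono_rel_def mono_rel_at_def\<close>)
    then show "inst_le E (DAll (dsubst (upT 1 s) (liftH 1 t1) d)) (dsubT (consl [u] TV) (dsubst (upT 1 s) (liftH 1 t2) d))"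
      by (intro inst_le_all_l[of E u]) (simp only: dsubst_var_body)
  qed
next
  case (DAllP n d)
  show ?case unfolding dsubst.simps
  proof (rule inst_le_allP_r)
    fix F assume F: "good F"
    have good: "good (hcons_env n F t m i)" if "\<And>m i. good (t m i)" for t m i
      using F that by (auto simp: hcons_env_def split: nat.split)
    have "mono_rel E (hcons_env n F t1) (hcons_env n F t2) d"
    proof (rule mono_relI)
      fix m i assume mi: "(m, i) \<in> dfhd d"
      show "mono_rel_at E m i (hcons_env n F t1 m i) (hcons_env n F t2 m i) d"
      proof (cases rule: shift_idx_cases[of m n i])
        case 1
        then show ?thesis using F by (simp add: mono_rel_at_refl)
      next
        case (2 j)
        with mi DAllP.prems(4) show ?thesis by (auto simp: mono_rel_def mono_rel_at_def)
      qed
    qed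
    with good DAllP.prems have "inst_le E (dsubst s (hcons_env n F t1) d) (dsubst s (hcons_env n F t2) d)"
      by (intro DAllP.IH) auto
    then show "inst_le E (DAllP n (dsubst s (upH n t1) d)) (dsubst TV (hcons n F) (dsubst s (upH n t2) d))"
      by (intro inst_le_allP_l[OF _ F]) (simp only: dsubst_inst_pred)
  qed
qed auto

section \<open>Arrow types are closed upwards\<close>

lemma is_arrow_substT [simp]: "is_arrow (substT \<theta> A) = is_arrow A"
  by (induction A arbitrary: \<theta>) (auto simp: Let_def)

lemma is_arrow_subst: "is_arrow A \<Longrightarrow> is_arrow (subst \<theta> \<rho> A)"
  by (induction A arbitrary: \<theta> \<rho>) (auto simp: Let_def)

lemma is_arrow_substD:
  "is_arrow (subst \<theta> \<rho> A) \<Longrightarrow> is_arrow A \<or> (\<exists>h ys F. \<rho> h = Some (ys, F) \<and> is_arrow F)"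
proof (induction A arbitrary: \<theta> \<rho>)
  case (At h ts)
  show ?case
  proof (cases "\<rho> h")
    case (Some q)
    then obtain ys F where "\<rho> h = Some (ys, F)" by (cases q) auto
    with At.prems have "\<rho> h = Some (ys, F) \<and> is_arrow F" by simp
    then show ?thesis by blast
  qed (use At.prems in simp)
next
  case (AllV x A)
  then show ?case by (auto simp: Let_def)
next
  case (AllP X n A)
  from AllP.prems show ?case unfolding subst.simps Let_def is_arrow.simps
    by (auto dest!: AllP.IH split: if_splits)
next
  case (Mu c xs D ts)
  from Mu.prems show ?case unfolding subst.simps Let_def is_arrow.simps
    by (auto dest!: Mu.IH split: if_splits)
qed auto

text \<open>The type substituted during unfolding is the fixed point itself, which contains an arrow
  only if \<open>D\<close> does.\<close>

lemma is_arrow_unfold: "is_arrow (unfold_mu c xs D ts) = is_arrow D"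
proof
  assume "is_arrow (unfold_mu c xs D ts)"
  then show "is_arrow D"
    unfolding unfold_mu_def by (auto dest!: is_arrow_substD split: if_splits)
qed (simp add: unfold_mu_def is_arrow_subst)

text \<open>Makes the middle type of a transitivity step an arrow type. The converse fails:
  \<forall>X X is below every type.\<close>

lemma subty_arrow: "subty E A B \<Longrightarrow> is_arrow A \<Longrightarrow> is_arrow B"
  by (induction rule: subty.induct) (auto simp: is_arrow_unfold is_arrow_subst)

lemma darrow_sem: "is_arrow A \<Longrightarrow> darrow (sem \<sigma> \<tau> A)"
  by (simp add: sem_def darrow_dsubst)

lemma darrow_sem_abs: "is_arrow A \<Longrightarrow> darrow (sem_abs \<sigma> \<tau> xs A)"
  by (simp add: sem_abs_def darrow_sem)

lemma darrow_sem_pred: "is_arrow A \<Longrightarrow> darrow (sem_pred \<sigma> \<tau> X n A)"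
  by (simp add: sem_pred_def darrow_dsubst)

lemma darrow_sem_mu: "is_arrow A \<Longrightarrow> darrow (sem_mu \<sigma> \<tau> c xs A)"
  by (simp add: sem_mu_def darrow_dsubst)

lemma subty_good: "subty E A B \<Longrightarrow> good (db A) \<and> good (db B)"
proof -
  assume "subty E A B"
  then have "dle E (sem TV head_env A) (sem TV head_env B)"
    using subty_sem by (simp add: head_env_def del: sem_id)
  then show ?thesis using dle_good by simp
qed

text \<open>As \<open>drep\<close> commutes with substitution on arrow types, a fixed point and its
  unfolding have the same representative. The rules \<open>fold\<close> and \<open>unfold\<close>
  thus reduce to reflexivity.\<close>

lemma drep_sem_unfold:
  assumes "wf_ty (Mu c xs D ts)" "is_arrow D"
  shows "drep (sem \<sigma> \<tau> (unfold_mu c xs D ts)) = drep (sem \<sigma> \<tau> (Mu c xs D ts))"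
    and "(\<forall>h. good (\<tau> h)) \<Longrightarrow> inst_le E (drep (sem \<sigma> \<tau> (Mu c xs D ts))) (drep (sem \<sigma> \<tau> (Mu c xs D ts)))"
proof -
  obtain d us where Tm: "db (Mu c xs D ts) = DMu d us" by simp
  then have "darrow d" using assms(2) by auto
  then have "drep (db (unfold_mu c xs D ts)) = drep (db (Mu c xs D ts))"
    unfolding db_unfold_mu[OF assms(1) Tm] Tm by (simp add: db_unfold_def drep_dsubst)
  then show "drep (sem \<sigma> \<tau> (unfold_mu c xs D ts)) = drep (sem \<sigma> \<tau> (Mu c xs D ts))"
    using assms(2) is_arrow_unfold[of c xs D ts] by (simp add: sem_def drep_dsubst del: to_db.simps)
  have "good (db (Mu c xs D ts))" using assms(1) wf_good by blast
  then show "(\<forall>h. good (\<tau> h)) \<Longrightarrow> inst_le E (drep (sem \<sigma> \<tau> (Mu c xs D ts))) (drep (sem \<sigma> \<tau> (Mu c xs D ts)))"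
    by (blast intro: inst_le_refl good_drep good_sem)
qed

lemma subty_inst_le:
  "subty E A B \<Longrightarrow> is_arrow A \<Longrightarrow>
    \<forall>\<sigma> \<tau>. (\<forall>h. good (\<tau> h)) \<longrightarrow> inst_le E (drep (sem \<sigma> \<tau> A)) (drep (sem \<sigma> \<tau> B))"
proof (induction rule: subty.induct)
  case (refl A)
  then have "good (db A)" using wf_good by blast
  then show ?case by (auto intro!: inst_le_refl good_drep good_sem)
next
  case (arr A A' B B')
  then show ?case using subty_sem[of E A A'] subty_sem[of E B B'] by (auto simp: sem_def intro!: inst_le_imp)
next
  case (allV_l x t A B)
  then have A: "arity_ok A" "is_arrow A" using wf_good[of A] by auto
  show ?case
  proof (intro allI impI)
    fix \<sigma> \<tau> assume "\<forall>h. good ((\<tau> :: head \<Rightarrow> dty) h)"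
    with allV_l A have "inst_le E (drep (sem \<sigma> \<tau> (substT (TV(x := t)) A))) (drep (sem \<sigma> \<tau> B))" by simp
    moreover have "(\<lambda>y. tsub \<sigma> (if y = x then t else TV y)) = updl \<sigma> [x] [tsub \<sigma> t]"
      by (auto simp: updl_single fun_eq_iff)
    ultimately have "inst_le E (dsubT (consl [tsub \<sigma> t] TV) (drep (sem_abs \<sigma> \<tau> [x] A))) (drep (sem \<sigma> \<tau> B))"
      using A by (simp add: sem_substT sem_abs_inst drep_dsubT[symmetric] darrow_sem_abs)
    then show "inst_le E (drep (sem \<sigma> \<tau> (AllV x A))) (drep (sem \<sigma> \<tau> B))"
      using A by (simp add: sem_AllV inst_le_all_l)
  qed
next
  case (allP_l X n ys F A B)
  then have A: "arity_ok A" "is_arrow A" and F: "arity_ok F" "good (db F)" using wf_good[of A] wf_good[of F] by auto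
  show ?case
  proof (intro allI impI)
    fix \<sigma> \<tau> assume good: "\<forall>h. good ((\<tau> :: head \<Rightarrow> dty) h)"
    let ?F = "sem_abs \<sigma> \<tau> ys F"
    have "inst_le E (drep (sem \<sigma> \<tau> (subst TV ((\<lambda>_. None)(PV X n := Some (ys, F))) A))) (drep (sem \<sigma> \<tau> B))"
      using allP_l.IH A good is_arrow_subst by blast
    then have "inst_le E (dsubst TV (hcons n ?F) (drep (sem_pred \<sigma> \<tau> X n A))) (drep (sem \<sigma> \<tau> B))"
      using A F allP_l by (simp add: drep_dsubst[symmetric] darrow_sem_pred sem_pred_inst sem_subst1)
    moreover have "good ?F" using good F by (intro good_sem_abs) auto
    ultimately show "inst_le E (drep (sem \<sigma> \<tau> (AllP X n A))) (drep (sem \<sigma> \<tau> B))"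
      unfolding sem_AllP drep.simps by (rule inst_le_allP_l)
  qed
next
  case (allV_r A B x)
  then have B: "arity_ok B" "is_arrow B" and A: "arity_ok A"
    using subty_sem[of E A B] subty_arrow[of E A B] by auto
  show ?case
  proof (intro allI impI)
    fix \<sigma> \<tau> assume good: "\<forall>h. good ((\<tau> :: head \<Rightarrow> dty) h)"
    show "inst_le E (drep (sem \<sigma> \<tau> A)) (drep (sem \<sigma> \<tau> (AllV x B)))"
      unfolding sem_AllV[OF B(1)] drep.simps
    proof (rule inst_le_all_r)
      fix u
      have "inst_le E (drep (sem (updl \<sigma> [x] [u]) \<tau> A)) (drep (sem (updl \<sigma> [x] [u]) \<tau> B))"
        using good allV_r by blast
      moreover have "sem (updl \<sigma> [x] [u]) \<tau> A = sem \<sigma> \<tau> A"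
        by (rule sem_cong) (use allV_r A in \<open>auto simp: updl_single\<close>)
      ultimately show "inst_le E (drep (sem \<sigma> \<tau> A)) (dsubT (consl [u] TV) (drep (sem_abs \<sigma> \<tau> [x] B)))"
        using B by (simp add: drep_dsubT[symmetric] darrow_sem_abs sem_abs_inst)
    qed
  qed
next
  case (allP_r A B X n)
  then have B: "arity_ok B" "is_arrow B" and A: "arity_ok A"
    using subty_sem[of E A B] subty_arrow[of E A B] by auto
  show ?case
  proof (intro allI impI)
    fix \<sigma> \<tau> assume good: "\<forall>h. good ((\<tau> :: head \<Rightarrow> dty) h)"
    show "inst_le E (drep (sem \<sigma> \<tau> A)) (drep (sem \<sigma> \<tau> (AllP X n B)))"
      unfolding sem_AllP drep.simps
    proof (rule inst_le_allP_r)
      fix F assume "good F"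
      with good allP_r have "inst_le E (drep (sem \<sigma> (\<tau>(PV X n := F)) A)) (drep (sem \<sigma> (\<tau>(PV X n := F)) B))"
        by simp
      moreover have "sem \<sigma> (\<tau>(PV X n := F)) A = sem \<sigma> \<tau> A"
        by (rule sem_cong) (use allP_r A in auto)
      ultimately show "inst_le E (drep (sem \<sigma> \<tau> A)) (dsubst TV (hcons n F) (drep (sem_pred \<sigma> \<tau> X n B)))"
        using B by (simp add: drep_dsubst[symmetric] darrow_sem_pred sem_pred_inst)
    qed
  qed
next
  case (eq A y v B w)
  then have B: "arity_ok B" "is_arrow B"
    using subty_sem[OF eq.hyps(1)] subty_arrow[OF eq.hyps(1)] by auto
  have s: "(\<lambda>z. tsub \<sigma> (if z = y then u else TV z)) = \<sigma>(y := tsub \<sigma> u)" for \<sigma> u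
    by (auto simp: fun_eq_iff)
  have "good (db (substT (TV(y := v)) B))" using subty_good[OF eq.hyps(1)] by simp
  moreover have "db (substT (TV(y := v)) B) = dsubT (TV(y := v)) (db B)"
    using sem_substT[OF B(1), of TV head_env "TV(y := v)"] by (simp add: sem_def head_env_def dsubst_head_id fun_upd_def)
  ultimately have gdB: "good (db B)" by simp
  show ?case
  proof (intro allI impI)
    fix \<sigma> \<tau> assume good: "\<forall>h. good ((\<tau> :: head \<Rightarrow> dty) h)"
    have "inst_le E (drep (sem \<sigma> \<tau> A)) (drep (sem \<sigma> \<tau> (substT (TV(y := v)) B)))"
      using eq good by blast
    moreover have "inst_le E (drep (sem \<sigma> \<tau> (substT (TV(y := v)) B))) (drep (sem \<sigma> \<tau> (substT (TV(y := w)) B)))"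
    \<comment> \<open>Both representatives are substitution instances of the representative of
      \<open>B\<close>, and they differ only in the value given to \<open>y\<close>.\<close>
    proof -
      have "inst_le E (dsubst (\<sigma>(y := tsub \<sigma> v)) (\<lambda>n i. \<tau> (idx_head n i)) (drep (db B)))
          (dsubst (\<sigma>(y := tsub \<sigma> w)) (\<lambda>n i. \<tau> (idx_head n i)) (drep (db B)))"
        by (rule inst_le_eq[OF eq_inst_tsub[OF eq.hyps(2)], of _ _ \<sigma>])
          (use good gdB B in \<open>auto intro: good_drep prenex_arrow_drep\<close>)
      moreover have "drep (sem \<sigma>' \<tau> B) = dsubst \<sigma>' (\<lambda>n i. \<tau> (idx_head n i)) (drep (db B))" for \<sigma>'
        using B by (simp add: sem_def drep_dsubst)
      ultimately show ?thesis
        using B by (simp add: sem_substT s)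
    qed
    ultimately show "inst_le E (drep (sem \<sigma> \<tau> A)) (drep (sem \<sigma> \<tau> (substT (TV(y := w)) B)))"
      by (rule inst_le_trans)
  qed
next
  case (trans A B C)
  then show ?case using subty_arrow[of E A B] by (blast intro: inst_le_trans)
next
  case (fold c xs D ts)
  then show ?case using drep_sem_unfold[of c xs D ts] by (simp add: is_arrow_unfold)
next
  case (unfold c xs D ts)
  then show ?case using drep_sem_unfold[of c xs D ts] by simp
next
  case (ind c xs D ts F)
  let ?n = "length xs"
  have D: "arity_ok D" "length ts = ?n" "distinct xs" "is_arrow D" and F: "arity_ok F" "good (db F)"
    and gdM: "good (db (Mu c xs D ts))" and wf: "wf_ty (Mu c xs D (map TV xs))"
    using ind wf_good[of D] wf_good[of F] wf_good[of "Mu c xs D ts"] by auto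
  have arF: "is_arrow F"
    using subty_arrow[OF ind.hyps(3)] is_arrow_subst[OF D(4)] by blast
  show ?case
  proof (intro allI impI)
    fix \<sigma> \<tau> assume good: "\<forall>h. good ((\<tau> :: head \<Rightarrow> dty) h)"
    let ?F = "sem_abs \<sigma> \<tau> xs F" let ?d = "sem_mu \<sigma> \<tau> c xs D" let ?us = "map (tsub \<sigma>) ts"
    let ?\<sigma> = "updl \<sigma> xs ?us"
    have "good (sem \<sigma> \<tau> (Mu c xs D ts))" using gdM good by (intro good_sem) auto
    then have gdM': "good (DMu ?d ?us)" by (simp add: sem_Mu[OF D(2)])
    have gdF: "good ?F" using F good by (intro good_sem_abs) auto
    have gdA: "good (mu_abs ?n ?d)" using good_mu_abs[OF gdM'] D by simp
    have upd: "updl TV xs (map TV xs) = TV"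
      by (auto simp: fun_eq_iff updl_pos nth_pos pos_less)
    \<comment> \<open>The premise of the rule is used here a second time, to obtain the inequality
      between the fixed point and the invariant along which monotonicity is applied.\<close>
    have "subty E (Mu c xs D (map TV xs)) F"
      using subty.ind[OF wf ind.hyps(2,3)] by (simp add: upd substT_subst subst_id)
    then have "dle E (sem_abs \<sigma> \<tau> xs (Mu c xs D (map TV xs))) ?F"
      unfolding sem_abs_def using good by (intro subty_sem[THEN conjunct2, THEN conjunct2, rule_format]) auto
    then have dle: "dle E (mu_abs ?n ?d) ?F" using D by (simp add: sem_abs_Mu)
    have "mono_rel E (hcons ?n (mu_abs ?n ?d)) (hcons ?n ?F) (drep ?d)"
    proof (rule mono_relI)
      fix m i
      show "mono_rel_at E m i (hcons ?n (mu_abs ?n ?d) m i) (hcons ?n ?F m i) (drep ?d)"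
      proof (cases rule: shift_idx_cases[of m ?n i])
        case 1
        have "polar True ?n 0 (drep ?d)" by (rule polar_drep) (use gdM' D in auto)
        with 1 dle show ?thesis by (simp add: mono_rel_at_def)
      next
        case (2 j)
        then show ?thesis by (simp add: mono_rel_at_refl)
      qed
    qed
    then have "inst_le E (dsubst (consl ?us TV) (hcons ?n (mu_abs ?n ?d)) (drep ?d))
        (dsubst (consl ?us TV) (hcons ?n ?F) (drep ?d))"
      by (rule inst_le_mono[rotated 3]) (use gdM' gdA gdF D in \<open>auto intro: good_drep prenex_arrow_drep darrow_sem_mu good_hcons\<close>)
    moreover have "drep (sem \<sigma> \<tau> (Mu c xs D ts)) = dsubst (consl ?us TV) (hcons ?n (mu_abs ?n ?d)) (drep ?d)"
      using D by (simp add: sem_Mu)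
    \<comment> \<open>The induction hypothesis is taken at the valuation that sends
      \<open>xs\<close> to the values of the arguments \<open>ts\<close>; the invariant as an
      abstraction is not affected by this.\<close>
    moreover have "sem_abs ?\<sigma> \<tau> xs F = ?F"
      by (rule sem_abs_cong) (use D in \<open>simp add: updl_pos\<close>)
    then have "drep (sem ?\<sigma> \<tau> (subst TV ((\<lambda>_. None)(PS c ?n := Some (xs, F))) D)) =
        dsubst (consl ?us TV) (hcons ?n ?F) (drep ?d)"
      using D F by (simp add: drep_dsubst[symmetric] darrow_sem_mu sem_mu_inst sem_subst1)
    moreover have "inst_le E (drep (sem ?\<sigma> \<tau> (subst TV ((\<lambda>_. None)(PS c ?n := Some (xs, F))) D))) (drep (sem ?\<sigma> \<tau> F))"
      using ind.IH is_arrow_subst[OF D(4)] good by blast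
    moreover have "sem \<sigma> \<tau> (substT (updl TV xs ts) F) = sem ?\<sigma> \<tau> F"
      using D F by (simp add: sem_substT updl_tsub)
    ultimately show "inst_le E (drep (sem \<sigma> \<tau> (Mu c xs D ts))) (drep (sem \<sigma> \<tau> (substT (updl TV xs ts) F)))"
      by (metis inst_le_trans)
  qed
qed

section \<open>Representatives and instances of named types\<close>

lemma wf_rep: "wf_ty A \<Longrightarrow> wf_ty (rep_ty A)"
proof (induction A)
  case (Mu c xs D ts)
  then show ?case by (auto intro!: wf_substT wf_subst1)
qed auto

text \<open>In the induction for \<open>db_rep\<close> the body of a binder is translated in an
  extended environment, while the induction hypothesis speaks of \<open>db\<close>.\<close>

lemma to_db_rep_env: "wf_ty A \<Longrightarrow> is_arrow A \<Longrightarrow> db (rep_ty A) = drep (db A) \<Longrightarrow> to_db e r (rep_ty A) = drep (to_db e r A)"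
proof -
  assume A: "wf_ty A" "is_arrow A" "db (rep_ty A) = drep (db A)"
  have "arity_ok A" "arity_ok (rep_ty A)" using wf_good wf_rep A(1) by blast+
  then have "to_db e r (rep_ty A) = dsubst (\<lambda>y. TV (e y)) (\<lambda>n i. head_id n (r (idx_head n i))) (drep (db A))"
    using to_db_env[of "rep_ty A" e r] A(3) by simp
  also have "\<dots> = drep (to_db e r A)"
    using to_db_env[OF \<open>arity_ok A\<close>, of e r] A(2) by (simp add: drep_dsubst)
  finally show ?thesis .
qed

lemma db_rep: "wf_ty A \<Longrightarrow> is_arrow A \<Longrightarrow> db (rep_ty A) = drep (db A)"
proof (induction A)
  case (AllV x A)
  then show ?case using to_db_rep_env[of A] by simp
next
  case (AllP X n A)
  then show ?case using to_db_rep_env[of A] by simp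
next
  case (Mu c xs D ts)
  obtain d us where Tm: "db (Mu c xs D ts) = DMu d us" by simp
  have "arity_ok (rep_ty D)" using Mu.prems wf_rep[of D] wf_good by auto
  from db_unfold_at[OF Mu.prems(1) Tm this] show ?case
    using Mu to_db_rep_env[of D] Tm by auto
qed auto

text \<open>The valuation reached by instantiating the prefix from the outside inwards. Later
  updates override earlier ones, in agreement with the convention of \<open>sim_theta\<close> for
  repeated names.\<close>

fun inst_terms :: "qbinder list \<Rightarrow> inst list \<Rightarrow> (nat \<Rightarrow> trm) \<Rightarrow> nat \<Rightarrow> trm" where
  "inst_terms (BV x # vs) (IT t # Gs) \<sigma> = inst_terms vs Gs (\<sigma>(x := t))"
| "inst_terms (v # vs) (G # Gs) \<sigma> = inst_terms vs Gs \<sigma>"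
| "inst_terms _ _ \<sigma> = \<sigma>"

fun inst_abstrs :: "qbinder list \<Rightarrow> inst list \<Rightarrow> (head \<Rightarrow> dty) \<Rightarrow> head \<Rightarrow> dty" where
  "inst_abstrs (BP X n # vs) (IF ys F # Gs) \<tau> = inst_abstrs vs Gs (\<tau>(PV X n := to_db (up_env ys (\<lambda>y. y)) head_idx F))"
| "inst_abstrs (v # vs) (G # Gs) \<tau> = inst_abstrs vs Gs \<tau>"
| "inst_abstrs _ _ \<tau> = \<tau>"

lemma fits_map_of: "list_all2 fits vs Gs \<Longrightarrow> map_of (rev (zip vs Gs)) v = Some G \<Longrightarrow> fits v G"
  by (auto dest!: map_of_SomeD simp: list_all2_iff)

lemma inst_terms_eq: "list_all2 fits vs Gs \<Longrightarrow>
  inst_terms vs Gs \<sigma> y = (case map_of (rev (zip vs Gs)) (BV y) of Some (IT t) \<Rightarrow> t | _ \<Rightarrow> \<sigma> y)"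
proof (induction vs Gs arbitrary: \<sigma> rule: list_all2_induct)
  case (Cons v vs G Gs)
  then show ?case
    by (cases v; cases G) (auto simp: map_of_append map_add_def split: option.splits inst.splits dest: fits_map_of)
qed simp

lemma inst_abstrs_eq: "list_all2 fits vs Gs \<Longrightarrow>
  inst_abstrs vs Gs \<tau> h = (case h of PV X n \<Rightarrow> (case map_of (rev (zip vs Gs)) (BP X n) of
      Some (IF ys F) \<Rightarrow> to_db (up_env ys (\<lambda>y. y)) head_idx F | _ \<Rightarrow> \<tau> h) | PS c n \<Rightarrow> \<tau> h)"
proof (induction vs Gs arbitrary: \<tau> rule: list_all2_induct)
  case (Cons v vs G Gs)
  then show ?case
    by (cases v; cases G) (auto simp: map_of_append map_add_def split: option.splits inst.splits head.splits dest: fits_map_of)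
qed (auto split: head.splits)

lemma foralls_simps [simp]: "foralls [] A = A" "foralls (v # vs) A = all_b v (foralls vs A)"
  by (simp_all add: foralls_def)

lemma arity_ok_foralls [simp]: "arity_ok (foralls vs A) = arity_ok A"
proof (induction vs)
  case (Cons v vs) then show ?case by (cases v) auto
qed simp

lemma wf_foralls [simp]: "wf_ty (foralls vs A) = wf_ty A"
proof (induction vs)
  case (Cons v vs) then show ?case by (cases v) auto
qed simp

text \<open>Each bound name is instantiated with its present value, which leaves the valuation
  unchanged, even if names repeat in \<open>vs\<close>.\<close>

lemma inst_of_foralls_id:
  assumes "arity_ok g" "arity_ok h" "\<And>h. good (\<tau> h)"
  shows "inst_of (sem \<sigma> \<tau> (foralls vs (Imp g h))) (sem \<sigma> \<tau> g) (sem \<sigma> \<tau> h)"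
proof (induction vs)
  case Nil
  then show ?case by (simp add: sem_def inst_of.imp)
next
  case (Cons v vs)
  show ?case
  proof (cases v)
    case (BV x)
    have "updl \<sigma> [x] [\<sigma> x] = \<sigma>" by (simp add: updl_single)
    with Cons.IH show ?thesis
      using assms BV by (simp add: sem_AllV inst_of.all[of "\<sigma> x"] sem_abs_inst)
  next
    case (BP X n)
    have "\<tau>(PV X n := \<tau> (PV X n)) = \<tau>" by simp
    with Cons.IH show ?thesis
      using assms BP by (simp add: sem_AllP inst_of.allP[of n "\<tau> (PV X n)"] sem_pred_inst)
  qed
qed

text \<open>Instances are stored in the valuation and never substituted into each other, so
  instantiating one quantifier after another amounts to a simultaneous substitution. A term instance
  can be taken over as it is, because \<open>db\<close> numbers free variables by their names; a
  type instance is named by \<open>ex_abs\<close>.\<close>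

lemma inst_of_foralls:
  assumes "arity_ok g" "arity_ok h"
  shows "inst_of (sem \<sigma> \<tau> (foralls vs (Imp g h))) a b \<Longrightarrow>
    \<exists>Gs. list_all2 fits vs Gs \<and> a = sem (inst_terms vs Gs \<sigma>) (inst_abstrs vs Gs \<tau>) g \<and> b = sem (inst_terms vs Gs \<sigma>) (inst_abstrs vs Gs \<tau>) h"
proof (induction vs arbitrary: \<sigma> \<tau>)
  case Nil
  then show ?case by (auto simp: sem_def elim: inst_of_impE)
next
  case (Cons v vs)
  show ?case
  proof (cases v)
    case (BV x)
    with Cons.prems assms obtain u where "inst_of (sem (updl \<sigma> [x] [u]) \<tau> (foralls vs (Imp g h))) a b"
      by (auto simp: sem_AllV sem_abs_inst elim!: inst_of_allE)
    from Cons.IH[OF this[unfolded updl_single]] obtain Gs where "list_all2 fits vs Gs"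
      "a = sem (inst_terms vs Gs (\<sigma>(x := u))) (inst_abstrs vs Gs \<tau>) g" "b = sem (inst_terms vs Gs (\<sigma>(x := u))) (inst_abstrs vs Gs \<tau>) h"
      by blast
    with BV show ?thesis by (intro exI[of _ "IT u # Gs"]) simp
  next
    case (BP X n)
    with Cons.prems assms obtain F where F: "good F" "inst_of (sem \<sigma> (\<tau>(PV X n := F)) (foralls vs (Imp g h))) a b"
      by (auto simp: sem_AllP sem_pred_inst elim!: inst_of_allPE)
    from ex_abs[OF F(1), of n] obtain ys G where G: "length ys = n" "distinct ys" "wf_ty G"
      "to_db (up_env ys (\<lambda>y. y)) head_idx G = F" by auto
    from Cons.IH[OF F(2)] obtain Gs where "list_all2 fits vs Gs"
      "a = sem (inst_terms vs Gs \<sigma>) (inst_abstrs vs Gs (\<tau>(PV X n := F))) g"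
      "b = sem (inst_terms vs Gs \<sigma>) (inst_abstrs vs Gs (\<tau>(PV X n := F))) h" by blast
    with BP G show ?thesis by (intro exI[of _ "IF ys G # Gs"]) simp
  qed
qed

lemma db_sim_subst:
  assumes "wf_ty A" "list_all2 fits vs Gs"
  shows "db (sim_subst vs Gs A) = sem (inst_terms vs Gs TV) (inst_abstrs vs Gs head_env) A" "arity_ok (sim_subst vs Gs A)"
    "dist_mu (sim_subst vs Gs A)"
proof -
  let ?\<rho> = "sim_rho vs Gs"
  have \<rho>: "length ys = arity h \<and> wf_ty F" if "?\<rho> h = Some (ys, F)" for h ys F
  proof -
    from that obtain X n where "h = PV X n" "map_of (rev (zip vs Gs)) (BP X n) = Some (IF ys F)"
      by (auto simp: sim_rho_def split: head.splits option.splits inst.splits)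
    with fits_map_of[OF assms(2)] show ?thesis by fastforce
  qed
  have A: "arity_ok A" "dist_mu A" using assms(1) wf_good by blast+
  have abstrs_ok: "abstrs_ok ?\<rho>" using \<rho> wf_good unfolding abstrs_ok_def by blast
  have "sim_theta vs Gs = inst_terms vs Gs TV"
    by (auto simp: fun_eq_iff sim_theta_def inst_terms_eq[OF assms(2)])
  moreover have "to_db_abstr ?\<rho> = (\<lambda>n i. inst_abstrs vs Gs head_env (idx_head n i))"
  proof (intro ext)
    fix n i
    have id: "head_env (idx_head n i) = head_id n i" by (simp add: head_env_def)
    show "to_db_abstr ?\<rho> n i = inst_abstrs vs Gs head_env (idx_head n i)"
      unfolding to_db_abstr_def inst_abstrs_eq[OF assms(2)] sim_rho_def id
      by (simp split: head.split option.split inst.split)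
  qed
  ultimately show "db (sim_subst vs Gs A) = sem (inst_terms vs Gs TV) (inst_abstrs vs Gs head_env) A"
    unfolding sim_subst_def to_db_subst(1)[OF A(1) abstrs_ok] sem_def by simp
  show "arity_ok (sim_subst vs Gs A)" unfolding sim_subst_def by (rule to_db_subst(2)[OF A(1) abstrs_ok])
  show "dist_mu (sim_subst vs Gs A)" unfolding sim_subst_def
    by (rule dist_mu_subst[OF A(2)]) (use \<rho> wf_good in blast)
qed

theorem theorem4p1:
  fixes E :: "(trm \<times> trm) set" and A B Ag Ad Bg Bd :: ty and vs vs' :: "qbinder list"
  assumes "wf_ty A" and "wf_ty B"
    and "is_arrow A" and "is_arrow B"
    and "rep_ty A = foralls vs (Imp Ag Ad)"
    and "rep_ty B = foralls vs' (Imp Bg Bd)"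
    and "subty E A B"
  shows "\<exists>Gs. list_all2 fits vs Gs
           \<and> subty E Bg (sim_subst vs Gs Ag)
           \<and> subty E (sim_subst vs Gs Ad) Bd"
proof -
  have wf: "wf_ty Ag" "wf_ty Ad" "wf_ty Bg" "wf_ty Bd"
    using wf_rep[OF assms(1)] wf_rep[OF assms(2)] assms(5,6) by auto
  then have ar: "arity_ok Ag" "arity_ok Ad" "arity_ok Bg" "arity_ok Bd" using wf_good by blast+
  have head_env: "good (head_env h)" for h by (simp add: head_env_def)
  have "inst_le E (drep (db A)) (drep (db B))"
    using subty_inst_le[OF assms(7,3), rule_format, of head_env TV] head_env by simp
  then have "inst_le E (sem TV head_env (foralls vs (Imp Ag Ad))) (sem TV head_env (foralls vs' (Imp Bg Bd)))"
    using db_rep[OF assms(1,3)] db_rep[OF assms(2,4)] assms(5,6) by simp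
  moreover have "inst_of (sem TV head_env (foralls vs' (Imp Bg Bd))) (sem TV head_env Bg) (sem TV head_env Bd)"
    by (rule inst_of_foralls_id) (use ar head_env in auto)
  ultimately obtain g h where gh: "inst_of (sem TV head_env (foralls vs (Imp Ag Ad))) g h"
    "dle E (db Bg) g" "dle E h (db Bd)" unfolding inst_le_def by (metis sem_id)
  from inst_of_foralls[OF ar(1,2) gh(1)] obtain Gs where Gs: "list_all2 fits vs Gs"
    "g = sem (inst_terms vs Gs TV) (inst_abstrs vs Gs head_env) Ag" "h = sem (inst_terms vs Gs TV) (inst_abstrs vs Gs head_env) Ad" by blast
  note g = db_sim_subst[OF wf(1) Gs(1)] and h = db_sim_subst[OF wf(2) Gs(1)]
  \<comment> \<open>Types related by \<open>dle\<close> are \<open>good\<close>, which yields the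
    well-formedness of the two substituted types needed for returning to
    \<open>subty\<close>.\<close>
  have "good (db (sim_subst vs Gs Ag))" "good (db (sim_subst vs Gs Ad))"
    using dle_good(2)[OF gh(2)] dle_good(1)[OF gh(3)] by (simp_all add: g(1) h(1) Gs(2,3))
  then have "wf_ty (sim_subst vs Gs Ag)" "wf_ty (sim_subst vs Gs Ad)"
    using g h wf_good by blast+
  moreover have "dle E (db Bg) (db (sim_subst vs Gs Ag))" "dle E (db (sim_subst vs Gs Ad)) (db Bd)"
    using gh g(1) h(1) Gs by simp_all
  ultimately have "subty E Bg (sim_subst vs Gs Ag)" "subty E (sim_subst vs Gs Ad) Bd"
    using wf by (auto intro: dle_subty)
  with Gs(1) show ?thesis by blast
qed

end
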